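(* Let $\{\mathcal T_h\}_{h\in(0,h_0)}$ be conforming triangulations of $\Omega$ and let $\alpha_0<\pi$ be independent of $h$. Write $\mathcal T_h=\mathcal T_h^1\cup\mathcal T_h^2$, where $\mathcal T_h^1=\{K\in\mathcal T_h:\alpha_K\le\alpha_0\}$ and $\mathcal T_h^2=\mathcal T_h\setminus\mathcal T_h^1$. Assume that, with a constant $C$ independent of $h$, (i) $\sum_{K\in\mathcal T_h^2}h_K^2\le C$; (ii) $|A_K-A_{K'}|\ge r_K+r_{K'}$ for all $K\ne K'$ in $\mathcal T_h^2$; (iii) $|A_K-B_{K'}|\ge r_K$ and $|A_K-C_{K'}|\ge r_K$ for all $K,K'\in\mathcal T_h^2$. Then $|u-U|_{H^1(\Omega)}\le C(u)h$ for all $u\in W^{2,\infty}(\Omega)$, where $C(u)$ is independent of $h$.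
   Context: $\Omega\subset\mathbb R^2$ is a bounded polygonal domain with Lipschitz boundary; $h$ is the maximal diameter of elements of $\mathcal T_h$; $X_h\subset H^1(\Omega)$ is the space of globally continuous functions that are linear on every $K\in\mathcal T_h$. For a triangle $K$: $h_K$ is its diameter, $\alpha_K$ its maximum angle, $A_K$ its maximum-angle vertex, $B_K,C_K$ the other two vertices, and $r_K=\tfrac12\min\{|A_K-B_K|,|A_K-C_K|\}$. $U\in X_h$ is the discrete (finite element) approximation of $u$, understood through Céa's lemma as the best approximation of $u$ in the discrete space: $|u-U|_{H^1(\Omega)}=\inf_{v_h\in X_h}|u-v_h|_{H^1(\Omega)}$. *)

theory Defs
  imports "HOL-Analysis.Analysis"
begin

section \<open>Weak derivatives and Sobolev spaces\<close>

definition partial_deriv :: "'n::finite \<Rightarrow> (real^'n \<Rightarrow> real) \<Rightarrow> real^'n \<Rightarrow> real" where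
  "partial_deriv i f x = frechet_derivative f (at x) (axis i 1)"

primrec times_diff :: "nat \<Rightarrow> (real^'n::finite \<Rightarrow> real) \<Rightarrow> bool" where
  "times_diff 0 f \<longleftrightarrow> continuous_on UNIV f"
| "times_diff (Suc k) f \<longleftrightarrow>
     (\<forall>x. f differentiable (at x)) \<and> (\<forall>i. times_diff k (partial_deriv i f))"

definition test_function :: "(real^'n::finite) set \<Rightarrow> (real^'n \<Rightarrow> real) \<Rightarrow> bool" where
  "test_function \<Omega> \<phi> \<longleftrightarrow> (\<forall>k. times_diff k \<phi>) \<and>
     compact (closure {x. \<phi> x \<noteq> 0}) \<and> closure {x. \<phi> x \<noteq> 0} \<subseteq> \<Omega>"

definition locally_integrable :: "(real^'n::finite) set \<Rightarrow> (real^'n \<Rightarrow> real) \<Rightarrow> bool" where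
  "locally_integrable \<Omega> f \<longleftrightarrow>
     (\<forall>S. compact S \<and> S \<subseteq> \<Omega> \<longrightarrow> set_integrable lebesgue S f)"

definition weak_partial ::
    "(real^'n::finite) set \<Rightarrow> 'n \<Rightarrow> (real^'n \<Rightarrow> real) \<Rightarrow> (real^'n \<Rightarrow> real) \<Rightarrow> bool" where
  "weak_partial \<Omega> i u g \<longleftrightarrow> locally_integrable \<Omega> u \<and> locally_integrable \<Omega> g \<and>
     (\<forall>\<phi>. test_function \<Omega> \<phi> \<longrightarrow>
        (LINT x:\<Omega>|lebesgue. u x * partial_deriv i \<phi> x) = - (LINT x:\<Omega>|lebesgue. g x * \<phi> x))"

definition L_infty :: "(real^'n::finite) set \<Rightarrow> (real^'n \<Rightarrow> real) \<Rightarrow> bool" where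
  "L_infty \<Omega> f \<longleftrightarrow> f \<in> borel_measurable (lebesgue_on \<Omega>) \<and>
     (\<exists>M. AE x in lebesgue_on \<Omega>. \<bar>f x\<bar> \<le> M)"

text \<open>Elements of Lebesgue and Sobolev spaces are represented by total functions whose values
  outside \<open>\<Omega>\<close> and on null sets are irrelevant.\<close>

definition W_2_infty :: "(real^'n::finite) set \<Rightarrow> (real^'n \<Rightarrow> real) \<Rightarrow> bool" where
  "W_2_infty \<Omega> u \<longleftrightarrow> L_infty \<Omega> u \<and>
     (\<exists>g H. \<forall>i. weak_partial \<Omega> i u (g i) \<and> L_infty \<Omega> (g i) \<and>
        (\<forall>j. weak_partial \<Omega> j (g i) (H i j) \<and> L_infty \<Omega> (H i j)))"

text \<open>On an open set the weak gradient, if it exists, is unique up to a null set, so the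
  seminorm below does not depend on the choice made here.\<close>

definition weak_grad :: "(real^'n::finite) set \<Rightarrow> (real^'n \<Rightarrow> real) \<Rightarrow> real^'n \<Rightarrow> real^'n" where
  "weak_grad \<Omega> u = (SOME g. \<forall>i. weak_partial \<Omega> i u (\<lambda>x. g x $ i))"

definition H1_seminorm :: "(real^'n::finite) set \<Rightarrow> (real^'n \<Rightarrow> real) \<Rightarrow> real" where
  "H1_seminorm \<Omega> u = sqrt (LINT x:\<Omega>|lebesgue. (norm (weak_grad \<Omega> u x))\<^sup>2)"


section \<open>Polygonal Lipschitz domains\<close>

text \<open>Near each boundary point the set is, in suitable orthonormal coordinates, the region
  strictly above the graph of a Lipschitz function. Since a Lipschitz function on an interval
  extends to the line, \<open>\<gamma>\<close> may be taken globally defined.\<close>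

definition Lipschitz_boundary :: "(real^2) set \<Rightarrow> bool" where
  "Lipschitz_boundary \<Omega> \<longleftrightarrow>
     (\<forall>p\<in>frontier \<Omega>. \<exists>V (f :: real^2 \<Rightarrow> real^2) L (\<gamma> :: real \<Rightarrow> real).
        open V \<and> p \<in> V \<and> orthogonal_transformation f \<and> L-lipschitz_on UNIV \<gamma> \<and>
        \<Omega> \<inter> V = {x \<in> V. \<gamma> (f x $ 1) < f x $ 2})"

definition polygonal_Lipschitz_domain :: "(real^2) set \<Rightarrow> bool" where
  "polygonal_Lipschitz_domain \<Omega> \<longleftrightarrow>
     open \<Omega> \<and> connected \<Omega> \<and> \<Omega> \<noteq> {} \<and> bounded \<Omega> \<and>
     (\<exists>E. finite E \<and> frontier \<Omega> = (\<Union>(a, b)\<in>E. closed_segment a b)) \<and>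
     Lipschitz_boundary \<Omega>"


section \<open>Triangles and triangulations\<close>

definition vertices :: "(real^2) set \<Rightarrow> (real^2) set" where
  "vertices K = {x. x extreme_point_of K}"

definition angle_at :: "real^2 \<Rightarrow> real^2 \<Rightarrow> real^2 \<Rightarrow> real" where
  "angle_at a b c = arccos (((b - a) \<bullet> (c - a)) / (norm (b - a) * norm (c - a)))"

definition max_angle :: "(real^2) set \<Rightarrow> real" where
  "max_angle K = Max {angle_at a b c |a b c. {a, b, c} = vertices K}"

text \<open>The library predicate \<^const>\<open>triangulation\<close> requires any two members to meet in a
  (possibly empty) common face, which is conformity.\<close>

definition conforming_triangulation :: "(real^2) set \<Rightarrow> (real^2) set set \<Rightarrow> bool" where
  "conforming_triangulation \<Omega> \<T> \<longleftrightarrow>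
     triangulation \<T> \<and> (\<forall>K\<in>\<T>. 2 simplex K) \<and> \<Union>\<T> = closure \<Omega>"

definition mesh_size :: "(real^2) set set \<Rightarrow> real" where
  "mesh_size \<T> = Max (diameter ` \<T>)"

definition small_angle_part :: "real \<Rightarrow> (real^2) set set \<Rightarrow> (real^2) set set" where
  "small_angle_part \<alpha> \<T> = {K \<in> \<T>. max_angle K \<le> \<alpha>}"

definition large_angle_part :: "real \<Rightarrow> (real^2) set set \<Rightarrow> (real^2) set set" where
  "large_angle_part \<alpha> \<T> = \<T> - small_angle_part \<alpha> \<T>"

text \<open>A maximum-angle vertex need not be unique, so \<open>a\<close>, \<open>b\<close>, \<open>c\<close> range over all admissible
  labellings of the vertices rather than being functions of \<open>K\<close>.\<close>

definition max_angle_labelling ::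
    "(real^2) set \<Rightarrow> real^2 \<Rightarrow> real^2 \<Rightarrow> real^2 \<Rightarrow> bool" where
  "max_angle_labelling K a b c \<longleftrightarrow> {a, b, c} = vertices K \<and> angle_at a b c = max_angle K"


section \<open>Finite element approximation\<close>

definition fe_space :: "(real^2) set \<Rightarrow> (real^2) set set \<Rightarrow> (real^2 \<Rightarrow> real) set" where
  "fe_space \<Omega> \<T> = {v. continuous_on (closure \<Omega>) v \<and>
     (\<forall>K\<in>\<T>. \<exists>a b. \<forall>x\<in>K. v x = a \<bullet> x + b)}"

definition fe_approximation ::
    "(real^2) set \<Rightarrow> (real^2) set set \<Rightarrow> (real^2 \<Rightarrow> real) \<Rightarrow> (real^2 \<Rightarrow> real) \<Rightarrow> bool" where
  "fe_approximation \<Omega> \<T> u U \<longleftrightarrow> U \<in> fe_space \<Omega> \<T> \<and>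
     H1_seminorm \<Omega> (\<lambda>x. u x - U x) = (INF v\<in>fe_space \<Omega> \<T>. H1_seminorm \<Omega> (\<lambda>x. u x - v x))"

end

theory Submission
  imports Defs
begin

text \<open>By Cea's lemma it suffices to find one finite element function close to \<open>u\<close>. Freeze the
  gradient of \<open>u\<close> on each triangle \<open>K\<close> at a value \<open>G K\<close>; since the second derivatives are bounded,
  \<open>u\<close> deviates on \<open>K\<close> from an affine function with gradient \<open>G K\<close> by a function with Lipschitz
  constant \<open>O(h)\<close>. On a large-angle triangle the nodal interpolant has a gradient close to \<open>G K\<close> once
  the value at the maximum-angle vertex is changed by some \<open>\<delta> K\<close> with \<open>\<bar>\<delta> K\<bar> = O(h) r K\<close>. Because the
  discs of radius \<open>r K\<close> about these vertices are disjoint and avoid the other vertices of large-angle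
  triangles, the changes extend to a function with Lipschitz constant \<open>O(h)\<close> on the plane. Adding it
  to \<open>u\<close> before interpolating changes the gradient on a triangle that satisfies the maximum angle
  condition only by \<open>O(h)\<close>, so the interpolation error is \<open>O(h)\<close> pointwise.

  The regularity needed comes from testing with smooth approximations of indicators of boxes: a
  bounded weak gradient makes averages over small squares Lipschitz in the position of the square, and
  averages converge almost everywhere to the function. Values at boundary vertices exist because
  a Lipschitz domain is locally quasiconvex.\<close>

section \<open>Smooth bumps in product form\<close>

text \<open>On a triangle with an angle near pi, the normal component of an interpolated gradient
  depends on the value at the maximum-angle vertex divided by a tiny altitude, so an O(h^2)
  discrepancy there can become arbitrarily large. That value is therefore chosen to make the
  gradient right. The triangles sharing the vertex see the change only through differences divided
  by edge lengths, hence the demand that it be Lipschitz in position. Since \<open>r K\<close> is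
  positive, the separation assumptions make all these neighbours satisfy the angle condition. The
  constant \<open>10 / sqrt (angle_const \<alpha>)\<close> arises on them: an edge difference of
  \<open>u\<close> errs by \<Lambda> and the correction adds 4\<Lambda>; recovering a gradient from
  two edges costs a factor 2 over the sine of the angle. Freezing the gradient costs nothing in
  shape: only convexity and diameter of \<open>K\<close> enter. As \<open>u\<close> is given up to a
  null set, pointwise bounds and nodal values have to be extracted from the weak formulation, and
  the gradient inside the seminorm, a Hilbert choice, has to be identified almost
  everywhere.\<close>

primrec diff_times :: "nat \<Rightarrow> (real \<Rightarrow> real) \<Rightarrow> bool" where
  "diff_times 0 f \<longleftrightarrow> True"
| "diff_times (Suc k) f \<longleftrightarrow>
     (\<exists>f'. (\<forall>x. (f has_real_derivative f' x) (at x)) \<and> diff_times k f')"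

definition smooth :: "(real \<Rightarrow> real) \<Rightarrow> bool" where
  "smooth f \<longleftrightarrow> (\<forall>k. diff_times k f)"

lemma diff_times_SucI:
  assumes "\<And>x. (f has_real_derivative f' x) (at x)" "diff_times k f'"
  shows "diff_times (Suc k) f"
  using assms by auto

lemma diff_times_mono: "diff_times (Suc k) f \<Longrightarrow> diff_times k f"
proof (induction k arbitrary: f)
  case (Suc k)
  then obtain f' where "\<forall>x. (f has_real_derivative f' x) (at x)" "diff_times (Suc k) f'"
    by auto
  with Suc.IH show ?case by auto
qed simp

lemma diff_times_const: "diff_times k (\<lambda>_. c)"
proof (induction k arbitrary: c)
  case (Suc k)
  show ?case by (rule diff_times_SucI[where f' = "\<lambda>_. 0"]) (auto intro: Suc)
qed simp

lemma diff_times_add: "diff_times k f \<Longrightarrow> diff_times k g \<Longrightarrow> diff_times k (\<lambda>x. f x + g x)"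
proof (induction k arbitrary: f g)
  case (Suc k)
  then obtain f' g' where f: "\<And>x. (f has_real_derivative f' x) (at x)" "diff_times k f'"
    and g: "\<And>x. (g has_real_derivative g' x) (at x)" "diff_times k g'" by auto
  show ?case
    by (rule diff_times_SucI[where f' = "\<lambda>x. f' x + g' x"])
       (auto intro!: derivative_eq_intros f g Suc.IH)
qed simp

lemma diff_times_mult: "diff_times k f \<Longrightarrow> diff_times k g \<Longrightarrow> diff_times k (\<lambda>x. f x * g x)"
proof (induction k arbitrary: f g)
  case (Suc k)
  then obtain f' g' where f: "\<And>x. (f has_real_derivative f' x) (at x)" "diff_times k f'"
    and g: "\<And>x. (g has_real_derivative g' x) (at x)" "diff_times k g'" by auto
  have "diff_times k f" "diff_times k g"
    using Suc.prems by (blast intro: diff_times_mono)+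
  then show ?case
    by (intro diff_times_SucI[where f' = "\<lambda>x. f' x * g x + f x * g' x"])
       (auto intro!: derivative_eq_intros f g Suc.IH diff_times_add)
qed simp

lemma diff_times_affine: "diff_times k f \<Longrightarrow> diff_times k (\<lambda>x. f (a + b * x))"
proof (induction k arbitrary: f)
  case (Suc k)
  then obtain f' where f: "\<And>x. (f has_real_derivative f' x) (at x)" "diff_times k f'" by auto
  have "((\<lambda>x. f (a + b * x)) has_real_derivative f' (a + b * x) * b) (at x)" for x
    by (rule DERIV_chain2[OF f(1)]) (auto intro!: derivative_eq_intros)
  then show ?case
    by (rule diff_times_SucI) (intro diff_times_mult diff_times_const Suc.IH f)
qed simp

text \<open>For different \<open>k\<close> the definition may supply different derivative functions;
  uniqueness of derivatives makes them one function, which is then differentiable any number of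
  times.\<close>

lemma smooth_deriv:
  assumes "smooth f"
  shows "\<exists>f'. (\<forall>x. (f has_real_derivative f' x) (at x)) \<and> smooth f'"
proof -
  obtain f' where f': "\<And>x. (f has_real_derivative f' x) (at x)"
    using assms unfolding smooth_def by (metis diff_times.simps(2))
  have "diff_times k f'" for k
  proof -
    obtain g where "\<And>x. (f has_real_derivative g x) (at x)" "diff_times k g"
      using assms unfolding smooth_def by (metis diff_times.simps(2))
    with f' show ?thesis by (metis DERIV_unique ext)
  qed
  with f' show ?thesis unfolding smooth_def by blast
qed

lemma smooth_antideriv:
  assumes "\<And>x. (f has_real_derivative f' x) (at x)" "smooth f'"
  shows "smooth f"
  using assms unfolding smooth_def by (metis diff_times.simps(1,2) old.nat.exhaust)

text \<open>The parameter \<open>c\<close> makes \<open>flat c\<close> converge pointwise, as \<open>c\<close> tends to 0, to the indicator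
  of the positive half-line; products of such functions therefore approximate indicators of boxes.\<close>

definition flat :: "real \<Rightarrow> real \<Rightarrow> real" where
  "flat c x = (if 0 < x then exp (- c / x) else 0)"

text \<open>A single term of the exponential series bounds \<open>exp (c / x)\<close> from below.
  Its degree exceeds \<open>k\<close> by two so that \<open>x\<^sup>2\<close> survives the division,
  which makes the difference quotient at 0 vanish.\<close>

lemma exp_inverse_bound:
  assumes "0 < c" "0 < (x::real)"
  shows "exp (- c / x) / x ^ k \<le> fact (k + 2) / c ^ (k + 2) * x\<^sup>2"
proof -
  have "(c / x) ^ (k + 2) / fact (k + 2) \<le> exp (c / x)"
  proof -
    have "(\<lambda>n. (c / x) ^ n / fact n) sums exp (c / x)"
      using exp_converges[of "c/x"] by (simp add: scaleR_conv_of_real field_simps)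
    then have s: "summable (\<lambda>n. (c / x) ^ n / fact n)" "suminf (\<lambda>n. (c / x) ^ n / fact n) = exp (c/x)"
      by (auto simp: sums_iff)
    have "sum (\<lambda>n. (c / x) ^ n / fact n) {k+2} \<le> suminf (\<lambda>n. (c / x) ^ n / fact n)"
      using assms s by (intro sum_le_suminf) auto
    then show ?thesis using s by simp
  qed
  then have "exp (- c / x) \<le> fact (k + 2) * (x / c) ^ (k + 2)"
    using assms by (simp add: exp_minus power_divide divide_simps mult_ac del: fact_Suc power_Suc)
  then have "exp (- c / x) / x ^ k \<le> fact (k + 2) * (x / c) ^ (k + 2) / x ^ k"
    using assms by (intro divide_right_mono) auto
  also have "\<dots> = fact (k + 2) / c ^ (k + 2) * x\<^sup>2"
    using assms by (simp add: power_add power_divide power2_eq_square)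
  finally show ?thesis .
qed

text \<open>The family \<open>exp (- c / x) / x ^ k\<close> is closed under differentiation up to linear combinations,
  which gives smoothness by induction.\<close>

lemma flat_power_deriv:
  assumes "0 < c"
  defines "g \<equiv> \<lambda>k x. if 0 < x then exp (- c / x) / x ^ k else (0::real)"
  shows "(g k has_real_derivative c * g (k + 2) x - real k * g (k + 1) x) (at x)"
proof -
  consider "x > 0" | "x < 0" | "x = 0" by linarith
  then show ?thesis
  proof cases
    case 1
    have "((\<lambda>x. exp (- c / x) / x ^ k) has_real_derivative c * g (k + 2) x - real k * g (k + 1) x) (at x)"
      using 1 by (auto intro!: derivative_eq_intros simp: g_def field_simps power2_eq_square power_diff
          split: nat.splits) (cases k; simp add: field_simps power2_eq_square)
    then show ?thesis
      by (rule has_field_derivative_transform_within_open[where S = "{0<..}"]) (use 1 in \<open>auto simp: g_def\<close>)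
  next
    case 2
    have "((\<lambda>x. 0) has_real_derivative c * g (k + 2) x - real k * g (k + 1) x) (at x)"
      using 2 by (auto simp: g_def)
    then show ?thesis
      by (rule has_field_derivative_transform_within_open[where S = "{..<0}"]) (use 2 in \<open>auto simp: g_def\<close>)
  next
    case 3
    define M where "M = fact (k + 2) / c ^ (k + 2)"
    have b: "\<bar>g k y\<bar> \<le> M * y\<^sup>2" for y
      using exp_inverse_bound[OF assms(1), of y k] assms(1) by (auto simp: g_def M_def)
    have "(\<lambda>y. g k y / y) \<midarrow>0\<rightarrow> 0"
    proof (rule Lim_null_comparison)
      show "\<forall>\<^sub>F y in at 0. norm (g k y / y) \<le> M * \<bar>y\<bar>"
        using b by (auto intro!: always_eventually simp: divide_simps power2_eq_square abs_mult[symmetric] mult.assoc)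
      show "((\<lambda>y. M * \<bar>y\<bar>) \<longlongrightarrow> 0) (at 0)"
        by (auto intro!: tendsto_eq_intros)
    qed
    then show ?thesis using 3
      by (auto simp: has_field_derivative_iff g_def)
  qed
qed

lemma smooth_flat:
  assumes "0 < c"
  shows "smooth (flat c)"
proof -
  define g where "g = (\<lambda>k x. if 0 < x then exp (- c / x) / x ^ k else (0::real))"
  have "diff_times n (g k)" for n k
  proof (induction n arbitrary: k)
    case (Suc n)
    have d: "(g k has_real_derivative c * g (k + 2) x + (- real k) * g (k + 1) x) (at x)" for x
      using flat_power_deriv[OF assms] unfolding g_def by simp
    show ?case
      by (rule diff_times_SucI[OF d]) (intro diff_times_add diff_times_mult diff_times_const Suc)
  qed simp
  moreover have "flat c = g 0"
    by (auto simp: flat_def g_def fun_eq_iff)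
  ultimately show ?thesis by (simp add: smooth_def)
qed

definition bump :: "real \<Rightarrow> real \<Rightarrow> real \<Rightarrow> real \<Rightarrow> real" where
  "bump c a b x = flat c (x - a) * flat c (b - x)"

lemma smooth_bump: "0 < c \<Longrightarrow> smooth (bump c a b)"
  using diff_times_affine[of _ "flat c" "-a" 1] diff_times_affine[of _ "flat c" b "-1"] smooth_flat[of c]
  unfolding smooth_def bump_def by (auto intro!: diff_times_mult)

lemma bump_range: "0 < c \<Longrightarrow> 0 \<le> bump c a b x \<and> bump c a b x \<le> 1"
  by (auto simp: bump_def flat_def intro!: mult_le_one)

lemma bump_eq_0: "x \<le> a \<or> b \<le> x \<Longrightarrow> bump c a b x = 0"
  by (auto simp: bump_def flat_def)

lemma bump_tendsto: "(\<lambda>n. bump (inverse (real (Suc n))) a b x) \<longlonglongrightarrow> indicator {a<..<b} x"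
proof (cases "a < x \<and> x < b")
  case True
  have "(\<lambda>n. exp (- inverse (real (Suc n)) / (x - a)) * exp (- inverse (real (Suc n)) / (b - x)))
      \<longlonglongrightarrow> exp (- 0 / (x - a)) * exp (- 0 / (b - x))"
    by (intro tendsto_intros LIMSEQ_inverse_real_of_nat) (use True in auto)
  then show ?thesis using True by (simp add: bump_def flat_def)
next
  case False
  then have "x \<le> a \<or> b \<le> x" by auto
  then show ?thesis using False by (auto simp: bump_eq_0 indicator_def)
qed

lemma smooth_isCont: "smooth f \<Longrightarrow> isCont f x"
  using smooth_deriv DERIV_isCont by metis

text \<open>Tested with \<open>\<eta>\<close> in one coordinate and bumps in the others, a weak derivative compares the
  integrals over a box and over its translate.\<close>

lemma bump_difference_antideriv:
  assumes "0 < c" "a < b" "0 < t"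
  obtains \<eta> where "\<And>z. (\<eta> has_real_derivative bump c a b z - bump c a b (z - t)) (at z)"
    "smooth \<eta>" "\<And>z. 0 \<le> \<eta> z \<and> \<eta> z \<le> t" "\<And>z. z \<le> a \<or> b + t \<le> z \<Longrightarrow> \<eta> z = 0"
proof -
  let ?\<beta> = "bump c a b"
  have cont: "continuous_on S ?\<beta>" for S
    using smooth_isCont[OF smooth_bump[OF assms(1)]] by (auto intro: continuous_at_imp_continuous_on)
  \<comment> \<open>The base point \<open>a - 1\<close> leaves room on the left: every
    \<open>z \<ge> a\<close> is interior to an interval of integration, so the derivative there is
    two-sided.\<close>
  define G where "G z = integral {a - 1..z} ?\<beta>" for z
  have G0: "G z = 0" if "z \<le> a" for z
  proof -
    have "G z = integral {a - 1..z} (\<lambda>_. 0)"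
      unfolding G_def by (rule integral_cong) (use that in \<open>auto simp: bump_eq_0\<close>)
    then show ?thesis by simp
  qed
  have dG: "(G has_real_derivative ?\<beta> z) (at z)" for z
  proof (cases "z < a")
    case True
    have "((\<lambda>_. 0) has_real_derivative ?\<beta> z) (at z)"
      using True by (auto simp: bump_eq_0)
    then show ?thesis
      by (rule has_field_derivative_transform_within_open[where S = "{..<a}"]) (use True G0 in auto)
  next
    case False
    then have "(G has_real_derivative ?\<beta> z) (at z within {a - 1..z + 1})"
      unfolding G_def by (intro integral_has_real_derivative cont) auto
    then show ?thesis
      using False by (simp add: at_within_Icc_at)
  qed
  \<comment> \<open>This writes \<open>\<eta>\<close> as \<open>t\<close> times a value of the bump,
    which bounds it by \<open>t\<close> uniformly in \<open>c\<close>.\<close>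
  have mvt: "\<exists>w. G z - G (z - t) = t * ?\<beta> w" for z
  proof -
    have "\<exists>w. z - t < w \<and> w < z \<and> G z - G (z - t) = (z - (z - t)) * ?\<beta> w"
      using assms(3) by (intro MVT2) (auto intro: dG)
    then show ?thesis by auto
  qed
  have Gb: "G z = G b" if "b \<le> z" for z
  proof (cases "b = z")
    case False
    then have "\<exists>w. b < w \<and> w < z \<and> G z - G b = (z - b) * ?\<beta> w"
      using that by (intro MVT2) (auto intro: dG)
    then show ?thesis by (auto simp: bump_eq_0)
  qed simp
  define \<eta> where "\<eta> z = G z - G (z - t)" for z
  have d: "(\<eta> has_real_derivative ?\<beta> z - ?\<beta> (z - t)) (at z)" for z
    unfolding \<eta>_def
    by (rule derivative_eq_intros dG DERIV_chain2[OF dG] refl | simp)+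
  show thesis
  proof
    show "(\<eta> has_real_derivative ?\<beta> z - ?\<beta> (z - t)) (at z)" for z by (rule d)
    have "smooth (\<lambda>z. ?\<beta> z - ?\<beta> (z - t))"
    proof -
      have "diff_times k (\<lambda>z. ?\<beta> z + (-1) * ?\<beta> (- t + 1 * z))" for k
      proof -
        have "diff_times k ?\<beta>"
          using smooth_bump[OF assms(1)] unfolding smooth_def by blast
        from diff_times_add[OF this diff_times_mult[OF diff_times_const[of k "-1"]
            diff_times_affine[OF this, of "- t" 1]]]
        show ?thesis .
      qed
      then show ?thesis by (simp add: smooth_def)
    qed
    then show "smooth \<eta>" using d by (rule smooth_antideriv[rotated])
    show "0 \<le> \<eta> z \<and> \<eta> z \<le> t" for z
    proof -
      obtain w where "\<eta> z = t * ?\<beta> w" using mvt[of z] unfolding \<eta>_def by blast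
      then show ?thesis
        using bump_range[OF assms(1), of a b w] assms(3) by (simp add: mult_le_cancel_left2)
    qed
    show "\<eta> z = 0" if "z \<le> a \<or> b + t \<le> z" for z
      using that G0[of z] G0[of "z - t"] Gb[of z] Gb[of "z - t"] assms by (auto simp: \<eta>_def)
  qed
qed

section \<open>Tensor products of one-dimensional functions as test functions\<close>

definition box_product :: "('n::finite \<Rightarrow> real \<Rightarrow> real) \<Rightarrow> real^'n \<Rightarrow> real" where
  "box_product h x = (\<Prod>j\<in>UNIV. h j (x $ j))"

lemma has_derivative_box_product:
  assumes "\<And>j z. (h j has_real_derivative h' j z) (at z)"
  shows "(box_product h has_derivative (\<lambda>y. \<Sum>i\<in>UNIV. y $ i * box_product (h(i := h' i)) x)) (at x)"
proof -
  have d: "((\<lambda>x. h j (x $ j)) has_derivative (\<lambda>y. h' j (x $ j) * y $ j)) (at x)" for j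
    by (rule has_derivative_compose[where g = "h j", OF bounded_linear_imp_has_derivative[OF bounded_linear_vec_nth]])
       (use assms[of j "x $ j"] in \<open>simp add: has_field_derivative_def\<close>)
  have "((\<lambda>x. \<Prod>j\<in>UNIV. h j (x $ j)) has_derivative
      (\<lambda>y. \<Sum>i\<in>UNIV. h' i (x $ i) * y $ i * (\<Prod>j\<in>UNIV - {i}. h j (x $ j)))) (at x)"
    by (rule has_derivative_prod) (rule d)
  moreover have "h' i (x $ i) * y $ i * (\<Prod>j\<in>UNIV - {i}. h j (x $ j)) = y $ i * box_product (h(i := h' i)) x" for i y
    by (simp add: box_product_def prod.remove[of UNIV i])
  ultimately show ?thesis
    by (simp add: box_product_def[abs_def] fun_upd_def)
qed

lemma partial_deriv_box_product:
  assumes "\<And>j z. (h j has_real_derivative h' j z) (at z)"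
  shows "partial_deriv i (box_product h) = box_product (h(i := h' i))"
proof
  fix x
  have "frechet_derivative (box_product h) (at x) = (\<lambda>y. \<Sum>i\<in>UNIV. y $ i * box_product (h(i := h' i)) x)"
    using has_derivative_box_product[of h h', OF assms] by (rule frechet_derivative_at[symmetric])
  then show "partial_deriv i (box_product h) x = box_product (h(i := h' i)) x"
    by (simp add: partial_deriv_def axis_def if_distrib[of "\<lambda>a. a * _"] cong: if_cong)
qed

text \<open>A partial derivative of a product is again such a product, with one factor replaced by
  its derivative; the induction therefore runs over all families of smooth factors.\<close>

lemma times_diff_box_product:
  assumes "\<And>j. smooth (h j)"
  shows "times_diff k (box_product h)"
  using assms
proof (induction k arbitrary: h)
  case 0
  have "continuous_on UNIV (\<lambda>x. \<Prod>j\<in>UNIV. h j (x $ j))"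
    by (intro continuous_on_prod continuous_at_imp_continuous_on ballI
        isCont_o2[where g = "h _", OF _ smooth_isCont[OF 0]] continuous_intros)
  then show ?case by (simp add: box_product_def[abs_def])
next
  case (Suc k)
  obtain h' where h': "\<And>j z. (h j has_real_derivative h' j z) (at z)" "\<And>j. smooth (h' j)"
    using smooth_deriv[OF Suc.prems] by metis
  show ?case
    unfolding times_diff.simps partial_deriv_box_product[of h h', OF h'(1)]
  proof (intro conjI allI)
    show "box_product h differentiable at x" for x
      using has_derivative_box_product[of h h', OF h'(1)] unfolding differentiable_def by blast
    show "times_diff k (box_product (h(i := h' i)))" for i
      by (rule Suc.IH) (use h' Suc.prems in auto)
  qed
qed

lemma test_function_box_product:
  fixes a b :: "real^'n::finite"
  assumes "\<And>j. smooth (h j)" "\<And>j z. z \<le> a $ j \<or> b $ j \<le> z \<Longrightarrow> h j z = 0" "cbox a b \<subseteq> \<Omega>"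
  shows "test_function \<Omega> (box_product h)"
proof -
  have "x \<in> cbox a b" if "box_product h x \<noteq> 0" for x
    unfolding mem_box_cart
  proof
    fix j
    have "h j (x $ j) \<noteq> 0" using that by (auto simp: box_product_def)
    with assms(2)[of "x $ j" j] show "a $ j \<le> x $ j \<and> x $ j \<le> b $ j" by force
  qed
  then have "{x. box_product h x \<noteq> 0} \<subseteq> cbox a b" by blast
  then have *: "closure {x. box_product h x \<noteq> 0} \<subseteq> cbox a b"
    by (rule closure_minimal) (rule closed_cbox)
  then have "compact (closure {x. box_product h x \<noteq> 0})"
    by (meson bounded_cbox bounded_subset closed_closure compact_eq_bounded_closed)
  with * times_diff_box_product[of h, OF assms(1)] assms(3) show ?thesis
    unfolding test_function_def by blast
qed

section \<open>Bounded weak gradients and Lipschitz bounds\<close>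

lemma small_cube_subset_open:
  fixes x :: "'a::euclidean_space"
  assumes "open S" "x \<in> S"
  shows "\<exists>\<delta>>0. \<forall>h. 0 < h \<and> h < \<delta> \<longrightarrow> cbox x (x + h *\<^sub>R One) \<subseteq> S"
proof -
  obtain \<epsilon> where \<epsilon>: "\<epsilon> > 0" "ball x \<epsilon> \<subseteq> S" using openE[OF assms] by blast
  define n where "n = norm (One :: 'a)"
  have "cbox x (x + h *\<^sub>R One) \<subseteq> S" if h: "0 < h" "h < \<epsilon> / (n + 1)" for h
  proof
    fix y assume y: "y \<in> cbox x (x + h *\<^sub>R One)"
    have "norm (y - x) \<le> norm (h *\<^sub>R (One :: 'a))"
      using y by (intro norm_le_componentwise) (auto simp: mem_box inner_diff_left inner_add_left)
    also have "\<dots> \<le> h * (n + 1)" using h by (simp add: n_def)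
    also have "\<dots> < \<epsilon>" using h by (simp add: n_def field_simps add_nonneg_pos)
    finally have "y \<in> ball x \<epsilon>" by (simp add: dist_norm norm_minus_commute)
    with \<epsilon>(2) show "y \<in> S" by blast
  qed
  moreover have "0 < \<epsilon> / (n + 1)" using \<epsilon> by (simp add: n_def add_nonneg_pos)
  ultimately show ?thesis by blast
qed

text \<open>\<open>d\<close> is integrable on compact subsets of \<open>\<Omega>\<close> only,
  whereas the differentiation theorem for cubes wants integrability on every box. So
  \<open>\<Omega>\<close> is covered by countably many closed boxes and \<open>d\<close> is cut off
  outside each. The box boundaries join the null set, so that small cubes with a remaining point as
  lower corner stay in its box.\<close>

lemma lebesgue_differentiation:
  fixes d :: "real^'n::finite \<Rightarrow> real"
  assumes "open \<Omega>" "locally_integrable \<Omega> d"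
  obtains N where "negligible N"
    "\<And>x. x \<in> \<Omega> - N \<Longrightarrow> ((\<lambda>s. integral (cbox x (x + s *\<^sub>R One)) d / s ^ CARD('n)) \<longlongrightarrow> d x) (at_right 0)"
proof -
  obtain \<D> where \<D>: "countable \<D>" "\<D> \<subseteq> Pow \<Omega>" "\<And>X. X \<in> \<D> \<Longrightarrow> \<exists>a b. X = cbox a b" "\<Union>\<D> = \<Omega>"
    using open_countable_Union_open_cbox[OF assms(1)] by metis
  have "\<exists>N. negligible N \<and> (\<forall>x \<in> X - N.
      ((\<lambda>s. integral (cbox x (x + s *\<^sub>R One)) d / s ^ CARD('n)) \<longlongrightarrow> d x) (at_right 0))"
    if X: "X \<in> \<D>" for X
  proof -
    obtain a b where ab: "X = cbox a b" using \<D>(3)[OF X] by blast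
    have "d absolutely_integrable_on X"
      using assms(2) \<D>(2) X ab unfolding locally_integrable_def by auto
    then have int: "d integrable_on X" by (rule set_lebesgue_integral_eq_integral)
    define f where "f x = (if x \<in> X then d x else 0)" for x
    have "f integrable_on cbox u v" for u v
    proof -
      obtain w z where wz: "cbox a b \<inter> cbox u v = cbox w z" using Int_interval by blast
      then have "d integrable_on (X \<inter> cbox u v)"
        unfolding ab wz using ab wz by (intro integrable_on_subcbox[OF int]) blast
      then show ?thesis unfolding f_def integrable_restrict_Int .
    qed
    note fint = this
    obtain N where N: "negligible N"
      "\<And>x e. \<lbrakk>x \<notin> N; 0 < e\<rbrakk> \<Longrightarrow> \<exists>\<delta>>0. \<forall>h. 0 < h \<and> h < \<delta> \<longrightarrow>
          norm (integral (cbox x (x + h *\<^sub>R One)) f /\<^sub>R h ^ DIM(real^'n) - f x) < e"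
      by (rule integrable_ccontinuous_explicit[OF fint]) (rule that)
    have "negligible (N \<union> (cbox a b - box a b))"
      by (rule negligible_Un[OF N(1) negligible_frontier_interval])
    moreover have "((\<lambda>s. integral (cbox x (x + s *\<^sub>R One)) d / s ^ CARD('n)) \<longlongrightarrow> d x) (at_right 0)"
      if x: "x \<in> X - (N \<union> (cbox a b - box a b))" for x
    proof (rule tendstoI)
      fix e :: real assume "e > 0"
      then obtain \<delta> where \<delta>: "\<delta> > 0" "\<And>h. 0 < h \<Longrightarrow> h < \<delta> \<Longrightarrow>
          norm (integral (cbox x (x + h *\<^sub>R One)) f /\<^sub>R h ^ DIM(real^'n) - f x) < e"
        using N(2)[of x e] x by blast
      have "x \<in> box a b" using x ab by auto
      from small_cube_subset_open[OF open_box this] obtain \<epsilon> where \<epsilon>: "\<epsilon> > 0"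
        "\<And>h. 0 < h \<Longrightarrow> h < \<epsilon> \<Longrightarrow> cbox x (x + h *\<^sub>R One) \<subseteq> box a b" by blast
      have sub: "cbox x (x + h *\<^sub>R One) \<subseteq> X" if h: "0 < h" "h < \<epsilon>" for h
        unfolding ab using \<epsilon>(2)[OF h] box_subset_cbox by (rule order_trans)
      have "dist (integral (cbox x (x + h *\<^sub>R One)) d / h ^ CARD('n)) (d x) < e"
        if h: "0 < h" "h < min \<delta> \<epsilon>" for h
      proof -
        have "integral (cbox x (x + h *\<^sub>R One)) f = integral (cbox x (x + h *\<^sub>R One)) d"
          using sub[of h] h by (intro integral_cong) (auto simp: f_def)
        moreover have "f x = d x" using x by (simp add: f_def)
        ultimately show ?thesis using \<delta>(2)[of h] h
          by (simp add: dist_norm divide_inverse mult.commute)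
      qed
      moreover have "0 < min \<delta> \<epsilon>" using \<delta> \<epsilon> by simp
      ultimately show "\<forall>\<^sub>F h in at_right 0. dist (integral (cbox x (x + h *\<^sub>R One)) d / h ^ CARD('n)) (d x) < e"
        unfolding eventually_at_right_field by blast
    qed
    ultimately show ?thesis by blast
  qed
  then have "\<forall>X\<in>\<D>. \<exists>N. negligible N \<and> (\<forall>x \<in> X - N.
      ((\<lambda>s. integral (cbox x (x + s *\<^sub>R One)) d / s ^ CARD('n)) \<longlongrightarrow> d x) (at_right 0))"
    by blast
  from bchoice[OF this] obtain N where N: "\<And>X. X \<in> \<D> \<Longrightarrow> negligible (N X)"
    "\<And>X x. X \<in> \<D> \<Longrightarrow> x \<in> X - N X \<Longrightarrow>
      ((\<lambda>s. integral (cbox x (x + s *\<^sub>R One)) d / s ^ CARD('n)) \<longlongrightarrow> d x) (at_right 0)"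
    by blast
  show thesis
  proof
    show "negligible (\<Union>(N ` \<D>))"
      by (rule negligible_countable_Union) (use \<D>(1) N(1) in auto)
    show "((\<lambda>s. integral (cbox x (x + s *\<^sub>R One)) d / s ^ CARD('n)) \<longlongrightarrow> d x) (at_right 0)"
      if "x \<in> \<Omega> - \<Union>(N ` \<D>)" for x
      using N(2) \<D>(4) that by blast
  qed
qed

section \<open>Integrals over boxes as limits of test integrals\<close>

lemma continuous_imp_lebesgue_measurable:
  fixes f :: "'a::euclidean_space \<Rightarrow> real"
  shows "continuous_on UNIV f \<Longrightarrow> f \<in> borel_measurable lebesgue"
  by (intro measurable_completion) (simp add: borel_measurable_continuous_onI)

text \<open>Dominated convergence with majorant \<open>B * \<bar>D x\<bar>\<close>, available since
  all \<open>\<phi> n\<close> live in one box. The limit is a gauge integral because differentiation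
  of integrals over cubes is phrased in that form.\<close>

lemma test_integral_limit:
  fixes d :: "real^'n::finite \<Rightarrow> real"
  assumes d: "locally_integrable \<Omega> d" and sub: "cbox a b \<subseteq> \<Omega>"
    and meas: "\<And>n. \<phi> n \<in> borel_measurable lebesgue" and B: "\<And>n x. \<bar>\<phi> n x\<bar> \<le> B"
    and supp: "\<And>n x. x \<notin> cbox a b \<Longrightarrow> \<phi> n x = 0"
    and lim: "\<And>x. (\<lambda>n. \<phi> n x) \<longlonglongrightarrow> \<psi> x"
  shows "(\<lambda>n. LINT x:\<Omega>|lebesgue. d x * \<phi> n x) \<longlonglongrightarrow> integral (cbox a b) (\<lambda>x. d x * \<psi> x)"
proof -
  define D where "D x = indicator (cbox a b) x * d x" for x
  have D: "integrable lebesgue D"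
    using d sub unfolding locally_integrable_def set_integrable_def D_def by auto
  have D\<phi>: "(LINT x:\<Omega>|lebesgue. d x * \<phi> n x) = (LINT x|lebesgue. D x * \<phi> n x)" for n
    unfolding set_lebesgue_integral_def
    by (rule Bochner_Integration.integral_cong) (use supp sub in \<open>auto simp: D_def indicator_def\<close>)
  have \<psi>: "\<psi> \<in> borel_measurable lebesgue"
    by (rule borel_measurable_LIMSEQ_real[OF _ meas]) (rule lim)
  have B0: "0 \<le> B" using B[of 0 undefined] by linarith
  have "\<bar>D x * \<phi> n x\<bar> \<le> B * \<bar>D x\<bar>" for n x
    using mult_left_mono[OF B[of n x] abs_ge_zero[of "D x"]] by (simp add: abs_mult mult.commute)
  note bound = this
  have lim': "(\<lambda>n. D x * \<phi> n x) \<longlonglongrightarrow> D x * \<psi> x" for x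
    by (intro tendsto_intros lim)
  have intD\<psi>: "integrable lebesgue (\<lambda>x. D x * \<psi> x)"
    and "(\<lambda>n. LINT x|lebesgue. D x * \<phi> n x) \<longlonglongrightarrow> (LINT x|lebesgue. D x * \<psi> x)"
  proof -
    have m: "(\<lambda>x. D x * \<psi> x) \<in> borel_measurable lebesgue"
      "\<And>n. (\<lambda>x. D x * \<phi> n x) \<in> borel_measurable lebesgue"
      using D meas \<psi> by (auto intro!: borel_measurable_times)
    have w: "integrable lebesgue (\<lambda>x. B * \<bar>D x\<bar>)" using D by simp
    have l: "AE x in lebesgue. (\<lambda>n. D x * \<phi> n x) \<longlonglongrightarrow> D x * \<psi> x" using lim' by simp
    have b: "AE x in lebesgue. norm (D x * \<phi> n x) \<le> B * \<bar>D x\<bar>" for n using bound by simp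
    show "integrable lebesgue (\<lambda>x. D x * \<psi> x)"
      using integrable_dominated_convergence[OF m w l b] .
    show "(\<lambda>n. LINT x|lebesgue. D x * \<phi> n x) \<longlonglongrightarrow> (LINT x|lebesgue. D x * \<psi> x)"
      using integral_dominated_convergence[OF m w l b] .
  qed
  moreover have "(LINT x|lebesgue. D x * \<psi> x) = integral (cbox a b) (\<lambda>x. d x * \<psi> x)"
  proof -
    have eq: "D x * \<psi> x = indicator (cbox a b) x *\<^sub>R (d x * \<psi> x)" for x by (simp add: D_def)
    have "(\<lambda>x. d x * \<psi> x) absolutely_integrable_on cbox a b"
      using intD\<psi> unfolding set_integrable_def eq .
    from set_lebesgue_integral_eq_integral(2)[OF this] show ?thesis
      unfolding set_lebesgue_integral_def eq .
  qed
  ultimately show ?thesis by (simp add: D\<phi>)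
qed

text \<open>Factor \<open>i\<close> has its own bound since it may be \<open>\<eta>\<close> or a
  difference of bumps, while the other factors take values in [0, 1].\<close>

lemma box_product_range:
  assumes "\<And>j z. j \<noteq> i \<Longrightarrow> 0 \<le> h j z \<and> h j z \<le> 1" "\<And>z. \<bar>h i z\<bar> \<le> M"
  shows "\<bar>box_product h x\<bar> \<le> M"
proof -
  have "\<bar>box_product h x\<bar> = \<bar>h i (x $ i)\<bar> * (\<Prod>j\<in>UNIV - {i}. \<bar>h j (x $ j)\<bar>)"
    by (simp add: box_product_def abs_mult abs_prod prod.remove[of UNIV i])
  also have "\<dots> \<le> M * 1"
    using assms by (intro mult_mono prod_le_1) (auto intro: prod_nonneg order_trans[OF abs_ge_zero])
  finally show ?thesis by simp
qed

lemma box_product_indicator: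
  "box_product (\<lambda>j. indicator {a $ j<..<b $ j}) x = indicator (box a b) x"
  by (auto simp: box_product_def indicator_def mem_box_cart)

lemma integral_indicator_box:
  fixes d :: "real^'n::finite \<Rightarrow> real"
  assumes "cbox a b \<subseteq> cbox a' b'"
  shows "integral (cbox a' b') (\<lambda>x. d x * indicator (box a b) x) = integral (cbox a b) d"
proof -
  have "integral (cbox a' b') (\<lambda>x. d x * indicator (box a b) x)
      = integral (cbox a' b') (\<lambda>x. if x \<in> box a b then d x else 0)"
    by (rule integral_cong) auto
  also have "\<dots> = integral (box a b \<inter> cbox a' b') d"
    by (rule Henstock_Kurzweil_Integration.integral_restrict_Int)
  also have "box a b \<inter> cbox a' b' = box a b" using assms box_subset_cbox by blast
  finally show ?thesis by (simp add: integral_open_interval)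
qed

lemma times_diff_0_measurable: "times_diff 0 \<phi> \<Longrightarrow> \<phi> \<in> borel_measurable lebesgue"
  by (simp add: continuous_imp_lebesgue_measurable)

lemma integral_box_eq_0:
  fixes d :: "real^'n::finite \<Rightarrow> real"
  assumes d: "locally_integrable \<Omega> d" and sub: "cbox a b \<subseteq> \<Omega>"
    and zero: "\<And>\<phi>. test_function \<Omega> \<phi> \<Longrightarrow> (LINT x:\<Omega>|lebesgue. d x * \<phi> x) = 0"
  shows "integral (cbox a b) d = 0"
proof -
  define h where "h n j = bump (inverse (real (Suc n))) (a $ j) (b $ j)" for n j
  have h: "smooth (h n j)" "z \<le> a $ j \<or> b $ j \<le> z \<Longrightarrow> h n j z = 0" "0 \<le> h n j z \<and> h n j z \<le> 1"
    "(\<lambda>n. h n j z) \<longlonglongrightarrow> indicator {a $ j<..<b $ j} z" for n j z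
    unfolding h_def by (auto simp del: of_nat_Suc intro!: smooth_bump bump_range bump_tendsto bump_eq_0)
  have test: "test_function \<Omega> (box_product (h n))" for n
    using h(1,2) sub by (rule test_function_box_product)
  have "(\<lambda>n. LINT x:\<Omega>|lebesgue. d x * box_product (h n) x)
      \<longlonglongrightarrow> integral (cbox a b) (\<lambda>x. d x * indicator (box a b) x)"
  proof (rule test_integral_limit[OF d sub, where B = 1])
    show "box_product (h n) \<in> borel_measurable lebesgue" for n
      using times_diff_box_product[of "h n" 0] h(1) by (simp add: times_diff_0_measurable)
    \<comment> \<open>All factors lie in [0, 1], so any coordinate may play the distinguished one;
      hence \<open>undefined\<close>.\<close>
    show "\<bar>box_product (h n) x\<bar> \<le> 1" for n x
      by (rule box_product_range[where i = undefined]) (use h(3) in auto)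
    show "box_product (h n) x = 0" if "x \<notin> cbox a b" for n x
      using that h(2) by (auto simp: box_product_def mem_box_cart) (meson linear)+
    show "(\<lambda>n. box_product (h n) x) \<longlonglongrightarrow> indicator (box a b) x" for x
      unfolding box_product_indicator[symmetric] unfolding box_product_def
      by (intro tendsto_prod h(4))
  qed
  then show ?thesis
    unfolding zero[OF test] integral_indicator_box[OF order_refl] by (simp add: LIMSEQ_const_iff)
qed

text \<open>The fundamental lemma of the calculus of variations: the integrals over all small cubes
  vanish, hence so do the limits of the averages, which are the values of \<open>d\<close>.\<close>

lemma weakly_zero_imp_zero:
  fixes d :: "real^'n::finite \<Rightarrow> real"
  assumes "open \<Omega>" "locally_integrable \<Omega> d"
    and zero: "\<And>\<phi>. test_function \<Omega> \<phi> \<Longrightarrow> (LINT x:\<Omega>|lebesgue. d x * \<phi> x) = 0"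
  obtains N where "negligible N" "\<And>x. x \<in> \<Omega> - N \<Longrightarrow> d x = 0"
proof -
  obtain N where N: "negligible N"
    "\<And>x. x \<in> \<Omega> - N \<Longrightarrow> ((\<lambda>s. integral (cbox x (x + s *\<^sub>R One)) d / s ^ CARD('n)) \<longlongrightarrow> d x) (at_right 0)"
    by (rule lebesgue_differentiation[OF assms(1,2)]) (rule that)
  have "d x = 0" if x: "x \<in> \<Omega> - N" for x
  proof -
    have "x \<in> \<Omega>" using x by blast
    from small_cube_subset_open[OF assms(1) this] obtain \<epsilon> where \<epsilon>: "\<epsilon> > 0"
      "\<And>h. 0 < h \<Longrightarrow> h < \<epsilon> \<Longrightarrow> cbox x (x + h *\<^sub>R One) \<subseteq> \<Omega>" by blast
    have "integral (cbox x (x + h *\<^sub>R One)) d / h ^ CARD('n) = 0" if h: "0 < h" "h < \<epsilon>" for h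
      using integral_box_eq_0[OF assms(2) \<epsilon>(2)[OF h] zero] by simp
    with \<epsilon>(1) have "\<forall>\<^sub>F h in at_right 0. integral (cbox x (x + h *\<^sub>R One)) d / h ^ CARD('n) = 0"
      unfolding eventually_at_right_field by blast
    then have "((\<lambda>s. integral (cbox x (x + s *\<^sub>R One)) d / s ^ CARD('n)) \<longlongrightarrow> 0) (at_right 0)"
      by (rule tendsto_eventually)
    with N(2)[OF x] show ?thesis
      using tendsto_unique trivial_limit_at_right_real by blast
  qed
  with N(1) that show thesis by blast
qed

lemma not_mem_cbox_cart:
  fixes x :: "real^'n::finite"
  assumes "x \<notin> cbox a b"
  shows "\<exists>j. x $ j < a $ j \<or> b $ j < x $ j"
  using assms by (auto simp: mem_box_cart not_le)

text \<open>The test function has \<open>\<eta>\<close> in coordinate \<open>i\<close> and bumps in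
  the others. Its \<open>i\<close>-th derivative tends to the indicator of the box minus that of the
  translate, while the function itself is at most \<open>t\<close> and lives in the box swept out by
  the translation. So the bound on \<open>G\<close> controls the limit.\<close>

lemma integral_box_translation_bound:
  fixes v :: "real^'n::finite \<Rightarrow> real"
  assumes weak: "weak_partial \<Omega> i v G" and t: "0 < t" and ab: "\<And>j. a $ j < b $ j"
    and sub: "cbox a (b + axis i t) \<subseteq> \<Omega>"
    and Z: "negligible Z" and M: "0 \<le> M" "\<And>x. x \<in> cbox a (b + axis i t) - Z \<Longrightarrow> \<bar>G x\<bar> \<le> M"
  shows "\<bar>integral (cbox (a + axis i t) (b + axis i t)) v - integral (cbox a b) v\<bar>
    \<le> M * t * measure lebesgue (cbox a (b + axis i t))"
proof -
  let ?R = "cbox a (b + axis i t)"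
  let ?\<beta> = "\<lambda>n j. bump (inverse (real (Suc n))) (a $ j) (b $ j)"
  have c0: "0 < inverse (real (Suc n))" for n by simp
  have "\<exists>\<eta>. (\<forall>z. (\<eta> has_real_derivative ?\<beta> n i z - ?\<beta> n i (z - t)) (at z)) \<and> smooth \<eta> \<and>
      (\<forall>z. 0 \<le> \<eta> z \<and> \<eta> z \<le> t) \<and> (\<forall>z. z \<le> a $ i \<or> b $ i + t \<le> z \<longrightarrow> \<eta> z = 0)" for n
    by (rule bump_difference_antideriv[OF c0 ab t]) blast
  then obtain \<eta> where \<eta>: "\<And>n z. (\<eta> n has_real_derivative ?\<beta> n i z - ?\<beta> n i (z - t)) (at z)"
    "\<And>n. smooth (\<eta> n)" "\<And>n z. 0 \<le> \<eta> n z \<and> \<eta> n z \<le> t"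
    "\<And>n z. z \<le> a $ i \<or> b $ i + t \<le> z \<Longrightarrow> \<eta> n z = 0"
    by metis
  define h where "h n = (?\<beta> n)(i := \<eta> n)" for n
  have hs: "smooth (h n j)" for n j
    by (auto simp: h_def \<eta>(2) simp del: of_nat_Suc intro!: smooth_bump c0)
  obtain h0 where h0: "\<And>n j z. (h n j has_real_derivative h0 n j z) (at z)"
    using smooth_deriv[OF hs] by metis
  \<comment> \<open>In coordinate \<open>i\<close> the anonymous derivative is replaced by the
    explicit difference of bumps, whose limit is known.\<close>
  define h' where "h' n = (h0 n)(i := \<lambda>z. ?\<beta> n i z - ?\<beta> n i (z - t))" for n
  have h': "(h n j has_real_derivative h' n j z) (at z)" for n j z
    using h0[of n j z] \<eta>(1)[of n z] by (cases "j = i") (simp_all add: h'_def h_def)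
  have hsupp: "h n j z = 0" if "z \<le> a $ j \<or> (b + axis i t) $ j \<le> z" for n j z
    using that by (auto simp: h_def axis_def bump_eq_0 \<eta>(4) split: if_splits)
  have test: "test_function \<Omega> (box_product (h n))" for n
    using hs hsupp sub by (rule test_function_box_product)
  let ?g = "\<lambda>n. (?\<beta> n)(i := \<lambda>z. ?\<beta> n i z - ?\<beta> n i (z - t))"
  have pd: "partial_deriv i (box_product (h n)) = box_product (?g n)" for n
    using partial_deriv_box_product[of "h n" "h' n" i, OF h'] by (simp add: h_def h'_def)
  let ?\<psi> = "\<lambda>x. indicator (box a b) x - indicator (box (a + axis i t) (b + axis i t)) x :: real"
  have prodsplit: "box_product (k(i := \<lambda>z. p z - q z)) x = box_product (k(i := p)) x - box_product (k(i := q)) x"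
    for k p q and x :: "real^'n"
    by (simp add: box_product_def prod.remove[of UNIV i] left_diff_distrib)
  have lim: "(\<lambda>n. LINT x:\<Omega>|lebesgue. v x * box_product (?g n) x) \<longlonglongrightarrow> integral ?R (\<lambda>x. v x * ?\<psi> x)"
  proof (rule test_integral_limit[OF _ sub, where B = 1])
    show "locally_integrable \<Omega> v" using weak by (simp add: weak_partial_def)
    show "box_product (?g n) \<in> borel_measurable lebesgue" for n
    proof -
      have "times_diff 0 (partial_deriv i (box_product (h n)))"
        using times_diff_box_product[of "h n" 1, OF hs] by simp
      then show ?thesis unfolding pd by (rule times_diff_0_measurable)
    qed
    show "\<bar>box_product (?g n) x\<bar> \<le> 1" for n x
    proof (rule box_product_range[where i = i])
      show "\<bar>(?g n) i z\<bar> \<le> 1" for z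
        using bump_range[OF c0[of n], of "a $ i" "b $ i" z] bump_range[OF c0[of n], of "a $ i" "b $ i" "z - t"]
        by simp linarith
    qed (use bump_range[OF c0] in auto)
    show "box_product (?g n) x = 0" if "x \<notin> ?R" for n x
    proof -
      from not_mem_cbox_cart[OF that] obtain j where j: "x $ j < a $ j \<or> (b + axis i t) $ j < x $ j"
        by blast
      then have "?g n j (x $ j) = 0"
        using t by (auto simp: axis_def bump_eq_0 split: if_splits)
      then show ?thesis unfolding box_product_def by (meson UNIV_I finite prod_zero)
    qed
    show "(\<lambda>n. box_product (?g n) x) \<longlonglongrightarrow> ?\<psi> x" for x
    proof -
      let ?I = "\<lambda>j. indicator {a $ j<..<b $ j} :: real \<Rightarrow> real"
      have "(\<lambda>n. (?g n) j (x $ j)) \<longlonglongrightarrow> (?I(i := \<lambda>z. ?I i z - ?I i (z - t))) j (x $ j)" for j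
        by (auto simp del: of_nat_Suc intro!: tendsto_diff bump_tendsto)
      then have "(\<lambda>n. box_product (?g n) x) \<longlonglongrightarrow> box_product (?I(i := \<lambda>z. ?I i z - ?I i (z - t))) x"
        unfolding box_product_def by (rule tendsto_prod)
      moreover have "box_product (?I(i := \<lambda>z. ?I i z - ?I i (z - t))) x
          = box_product ?I x - box_product (?I(i := \<lambda>z. ?I i (z - t))) x"
        unfolding prodsplit by (simp add: fun_upd_idem)
      moreover have "?I(i := \<lambda>z. ?I i (z - t)) = (\<lambda>j. indicator {(a + axis i t) $ j<..<(b + axis i t) $ j})"
        by (auto simp: fun_eq_iff axis_def indicator_def)
      ultimately show ?thesis by (simp only: box_product_indicator)
    qed
  qed
  have ax: "0 \<le> axis i t $ j" for j using t by (simp add: axis_def)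
  have subs: "cbox a b \<subseteq> ?R" "cbox (a + axis i t) (b + axis i t) \<subseteq> ?R"
  proof -
    have "x \<in> ?R" if "x \<in> cbox a b" for x
      unfolding mem_box_cart
    proof
      fix j
      have "a $ j \<le> x $ j \<and> x $ j \<le> b $ j" using that by (simp add: mem_box_cart)
      then show "a $ j \<le> x $ j \<and> x $ j \<le> (b + axis i t) $ j" using ax[of j] by simp
    qed
    then show "cbox a b \<subseteq> ?R" by blast
    have "x \<in> ?R" if "x \<in> cbox (a + axis i t) (b + axis i t)" for x
      unfolding mem_box_cart
    proof
      fix j
      have "(a + axis i t) $ j \<le> x $ j \<and> x $ j \<le> (b + axis i t) $ j"
        using that by (simp add: mem_box_cart)
      then show "a $ j \<le> x $ j \<and> x $ j \<le> (b + axis i t) $ j" using ax[of j] by simp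
    qed
    then show "cbox (a + axis i t) (b + axis i t) \<subseteq> ?R" by blast
  qed
  have intv: "v integrable_on ?R"
    using weak sub unfolding weak_partial_def locally_integrable_def
    by (meson compact_cbox set_lebesgue_integral_eq_integral(1))
  have intsub: "(\<lambda>x. v x * indicator (box c d) x) integrable_on ?R" if "cbox c d \<subseteq> ?R" for c d
  proof -
    have "v integrable_on (box c d \<inter> ?R)"
      using integrable_on_subcbox[OF intv that] inf.absorb1[OF order_trans[OF box_subset_cbox that]]
      by (simp add: integrable_on_open_interval)
    then show ?thesis
      unfolding integrable_restrict_Int[symmetric] by (rule integrable_eq) auto
  qed
  have "integral ?R (\<lambda>x. v x * ?\<psi> x)
      = integral ?R (\<lambda>x. v x * indicator (box a b) x)
        - integral ?R (\<lambda>x. v x * indicator (box (a + axis i t) (b + axis i t)) x)"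
    unfolding right_diff_distrib by (intro integral_diff intsub subs)
  then have lim': "(\<lambda>n. LINT x:\<Omega>|lebesgue. v x * box_product (?g n) x)
      \<longlonglongrightarrow> integral (cbox a b) v - integral (cbox (a + axis i t) (b + axis i t)) v"
    using lim unfolding integral_indicator_box[OF subs(1)] integral_indicator_box[OF subs(2)] by simp
  have "\<bar>LINT x:\<Omega>|lebesgue. v x * box_product (?g n) x\<bar> \<le> M * t * measure lebesgue ?R" for n
  proof -
    have "(LINT x:\<Omega>|lebesgue. v x * box_product (?g n) x) = - (LINT x:\<Omega>|lebesgue. G x * box_product (h n) x)"
      using weak test unfolding weak_partial_def pd[symmetric] by blast
    then have "\<bar>LINT x:\<Omega>|lebesgue. v x * box_product (?g n) x\<bar> = norm (LINT x:\<Omega>|lebesgue. G x * box_product (h n) x)"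
      by simp
    also have "\<dots> \<le> (LINT x|lebesgue. norm (indicator \<Omega> x *\<^sub>R (G x * box_product (h n) x)))"
      unfolding set_lebesgue_integral_def by (rule integral_norm_bound)
    also have "\<dots> \<le> (LINT x|lebesgue. (M * t) * indicator ?R x)"
    proof (rule integral_mono_AE')
      show "integrable lebesgue (\<lambda>x. (M * t) * indicator ?R x)"
        by (intro integrable_mult_right) (simp add: lmeasurable_iff_integrable[symmetric])
      have "AE x in lebesgue. x \<notin> Z"
        using Z by (simp add: negligible_iff_null_sets AE_not_in)
      then show "AE x in lebesgue. norm (indicator \<Omega> x *\<^sub>R (G x * box_product (h n) x)) \<le> (M * t) * indicator ?R x"
      proof eventually_elim
        case (elim x)
        have b: "\<bar>box_product (h n) x\<bar> \<le> t"
          by (rule box_product_range[where i = i])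
             (use \<eta>(3)[of n] bump_range[OF c0] in \<open>auto simp: h_def simp del: of_nat_Suc\<close>)
        show ?case
        proof (cases "x \<in> ?R")
          case True
          then have "\<bar>G x\<bar> * \<bar>box_product (h n) x\<bar> \<le> M * t"
            using elim M b by (intro mult_mono) auto
          then show ?thesis using True sub by (auto simp: abs_mult indicator_def)
        next
          case False
          from not_mem_cbox_cart[OF this] obtain j where j: "x $ j < a $ j \<or> (b + axis i t) $ j < x $ j"
            by blast
          then have "h n j (x $ j) = 0" by (intro hsupp) auto
          then have "box_product (h n) x = 0"
            unfolding box_product_def by (meson UNIV_I finite prod_zero)
          then show ?thesis using False by simp
        qed
      qed
      show "AE x in lebesgue. 0 \<le> (M * t) * indicator ?R x" using M(1) t by simp
    qed
    also have "\<dots> = M * t * measure lebesgue ?R"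
      by simp
    finally show ?thesis .
  qed
  then have "\<bar>integral (cbox a b) v - integral (cbox (a + axis i t) (b + axis i t)) v\<bar> \<le> M * t * measure lebesgue ?R"
    by (intro LIMSEQ_le_const2[OF tendsto_rabs[OF lim']]) auto
  then show ?thesis by (simp add: abs_minus_commute)
qed

section \<open>Averages over small squares in the plane\<close>

lemma sum_Basis_nth: "(\<Sum>x\<in>Basis. (x :: real^'n::finite) $ j) = 1"
proof -
  have "axis j 1 \<in> (Basis :: (real^'n) set)" by (auto simp: Basis_vec_def)
  from inner_sum_left_Basis[OF this, of "\<lambda>_. 1"] show ?thesis
    by (simp add: cart_eq_inner_axis inner_sum_left)
qed

lemma norm_axis_real: "norm (axis i t :: real^'n::finite) = \<bar>t\<bar>"
proof -
  have "axis i t = t *\<^sub>R (axis i 1 :: real^'n)" by (simp add: vec_eq_iff axis_def)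
  then show ?thesis by (simp add: norm_axis_1)
qed

lemma vec2_decomp: "(y :: real^2) = x + axis 1 (y $ 1 - x $ 1) + axis 2 (y $ 2 - x $ 2)"
  by (simp add: vec_eq_iff forall_2 axis_def)

lemma measure_stretched_square:
  fixes x :: "real^2"
  assumes "0 < s" "0 \<le> t"
  shows "measure lebesgue (cbox x (x + s *\<^sub>R One + axis i t)) = s * (s + t)"
proof -
  have "cbox x (x + s *\<^sub>R One + axis i t) \<noteq> {}"
    using assms by (auto simp: interval_ne_empty_cart sum_Basis_nth axis_def)
  then have "measure lebesgue (cbox x (x + s *\<^sub>R One + axis i t))
      = (\<Prod>j\<in>UNIV. (x + s *\<^sub>R One + axis i t) $ j - x $ j)"
    by (simp add: content_cbox_cart)
  also have "\<dots> = s * (s + t)"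
    using exhaust_2[of i] by (auto simp: UNIV_2 sum_Basis_nth axis_def algebra_simps)
  finally show ?thesis .
qed

lemma cbox_subset_ball_cart:
  fixes p :: "real^2"
  assumes "\<And>j. p $ j - c < a $ j" "\<And>j. b $ j < p $ j + c"
  shows "cbox a b \<subseteq> ball p (2 * c)"
proof
  fix z assume z: "z \<in> cbox a b"
  have "norm (z - p) \<le> (\<Sum>j\<in>UNIV. \<bar>(z - p) $ j\<bar>)" by (rule norm_le_l1_cart)
  also have "\<dots> < 2 * c"
  proof -
    have "\<bar>(z - p) $ j\<bar> < c" for j :: 2
    proof -
      have "a $ j \<le> z $ j \<and> z $ j \<le> b $ j" using z by (simp add: mem_box_cart)
      with assms[of j] show ?thesis by (simp add: abs_less_iff)
    qed
    from add_strict_mono[OF this[of 1] this[of 2]] show ?thesis by (simp add: sum_2)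
  qed
  finally show "z \<in> ball p (2 * c)" by (simp add: dist_norm norm_minus_commute)
qed

definition box_average :: "(real^2 \<Rightarrow> real) \<Rightarrow> real \<Rightarrow> real^2 \<Rightarrow> real" where
  "box_average v s x = integral (cbox x (x + s *\<^sub>R One)) v / s\<^sup>2"

context
  fixes \<Omega> S :: "(real^2) set" and v and G and M :: real and Z
  assumes weak: "\<And>i. weak_partial \<Omega> i v (G i)"
    and S: "S \<subseteq> \<Omega>" "open S" "convex S"
    and M: "0 \<le> M" "negligible Z" "\<And>i x. x \<in> S - Z \<Longrightarrow> \<bar>G i x\<bar> \<le> M"
begin

text \<open>A translation by at most \<open>s\<close> sweeps an area of at most twice the square,
  hence the factor 2. The swept box stays within \<open>3 * s\<close> of \<open>x\<close> in each
  coordinate, hence the radius \<open>6 * s\<close>. A negative translation is a positive one from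
  the other end, which is why \<open>pos\<close> admits base points other than
  \<open>x\<close>.\<close>

lemma box_average_axis:
  assumes "\<bar>t\<bar> \<le> s" "0 < s" "ball x (6 * s) \<subseteq> S"
  shows "\<bar>box_average v s (x + axis i t) - box_average v s x\<bar> \<le> 2 * M * \<bar>t\<bar>"
proof -
  have pos: "\<bar>box_average v s (y + axis i \<tau>) - box_average v s y\<bar> \<le> 2 * M * \<tau>"
    if "0 < \<tau>" "\<tau> \<le> s" "\<And>j. x $ j - s \<le> y $ j" "\<And>j. y $ j + axis i \<tau> $ j \<le> x $ j + s" for y \<tau>
  proof -
    have "cbox y (y + s *\<^sub>R One + axis i \<tau>) \<subseteq> ball x (2 * (3 * s))"
    proof (rule cbox_subset_ball_cart)
      show "x $ j - 3 * s < y $ j" for j using that(3)[of j] \<open>0 < s\<close> by linarith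
      show "(y + s *\<^sub>R One + axis i \<tau>) $ j < x $ j + 3 * s" for j
        using that(4)[of j] \<open>0 < s\<close> by (simp add: sum_Basis_nth)
    qed
    with assms(3) have sub: "cbox y (y + s *\<^sub>R One + axis i \<tau>) \<subseteq> S" by auto
    have "\<bar>integral (cbox (y + axis i \<tau>) (y + s *\<^sub>R One + axis i \<tau>)) v - integral (cbox y (y + s *\<^sub>R One)) v\<bar>
        \<le> M * \<tau> * measure lebesgue (cbox y (y + s *\<^sub>R One + axis i \<tau>))"
      using that \<open>0 < s\<close> sub S(1) M
      by (intro integral_box_translation_bound[OF weak]) (auto simp: sum_Basis_nth)
    also have "\<dots> = M * \<tau> * (s * (s + \<tau>))"
      using that \<open>0 < s\<close> by (subst measure_stretched_square) auto
    also have "\<dots> \<le> M * \<tau> * (s * (s + s))"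
      using that \<open>0 < s\<close> M by (intro mult_left_mono) auto
    finally have "\<bar>integral (cbox (y + axis i \<tau>) (y + s *\<^sub>R One + axis i \<tau>)) v
        - integral (cbox y (y + s *\<^sub>R One)) v\<bar> / s\<^sup>2 \<le> 2 * M * \<tau>"
      using \<open>0 < s\<close> by (simp add: field_simps power2_eq_square)
    then show ?thesis
      by (simp add: box_average_def diff_divide_distrib[symmetric] abs_divide add_ac)
  qed
  consider "t = 0" | "t > 0" | "t < 0" by linarith
  then show ?thesis
  proof cases
    case 1
    then have *: "axis i t = (0 :: real^2)" by (simp add: vec_eq_iff axis_def)
    show ?thesis unfolding * using 1 by simp
  next
    case 2
    then show ?thesis using pos[of t x] assms by (auto simp: axis_def)
  next
    case 3
    have "axis i t + axis i (- t) = (0 :: real^2)" by (simp add: vec_eq_iff axis_def)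
    then have ret: "x + axis i t + axis i (- t) = x" by (simp add: add.assoc)
    have "\<bar>box_average v s (x + axis i t + axis i (- t)) - box_average v s (x + axis i t)\<bar> \<le> 2 * M * (- t)"
      by (rule pos) (use assms 3 in \<open>auto simp: axis_def\<close>)
    then show ?thesis unfolding ret using 3 by (simp add: abs_minus_commute)
  qed
qed

text \<open>Two axis-parallel moves, each costing at most \<open>2 * M\<close> times the distance.
  The intermediate corner lies at most \<open>s\<close> from \<open>x\<close>, so a ball of radius
  \<open>8 * s\<close> contains the ball needed around it.\<close>

lemma box_average_local:
  assumes "0 < s" "ball x (8 * s) \<subseteq> S" "norm (y - x) \<le> s"
  shows "\<bar>box_average v s y - box_average v s x\<bar> \<le> 4 * M * norm (y - x)"
proof -
  define t where "t j = y $ j - x $ j" for j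
  have t: "\<bar>t j\<bar> \<le> norm (y - x)" for j
    using component_le_norm_cart[of "y - x" j] by (simp add: t_def)
  then have ts: "\<bar>t j\<bar> \<le> s" for j using assms(3) order_trans by blast
  define x' where "x' = x + axis 1 (t 1)"
  have y: "y = x' + axis 2 (t 2)" unfolding x'_def t_def by (rule vec2_decomp)
  have "ball x (6 * s) \<subseteq> ball x (8 * s)" by (rule subset_ball) (use assms(1) in simp)
  then have "ball x (6 * s) \<subseteq> S" using assms(2) by (rule order_trans)
  from box_average_axis[OF ts assms(1) this, of 1 1]
  have 1: "\<bar>box_average v s x' - box_average v s x\<bar> \<le> 2 * M * norm (y - x)"
    unfolding x'_def using mult_left_mono[OF t[of 1], of "2 * M"] M(1) by simp
  have "norm (x' - x) = \<bar>t 1\<bar>" by (simp add: x'_def norm_axis_real)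
  have "ball x' (6 * s) \<subseteq> ball x (8 * s)"
  proof
    fix z assume "z \<in> ball x' (6 * s)"
    moreover have "dist x x' \<le> s" using \<open>norm (x' - x) = _\<close> ts[of 1] by (simp add: dist_norm norm_minus_commute)
    ultimately show "z \<in> ball x (8 * s)"
      using dist_triangle[of x z x'] assms(1) by simp
  qed
  with assms(2) have "ball x' (6 * s) \<subseteq> S" by blast
  from box_average_axis[OF ts assms(1) this, of 2 2]
  have 2: "\<bar>box_average v s y - box_average v s x'\<bar> \<le> 2 * M * norm (y - x)"
    unfolding y using mult_left_mono[OF t[of 2], of "2 * M"] M(1) y by simp
  from 1 2 show ?thesis by linarith
qed

text \<open>The local bound needs squares that are small against the distance of the segment from
  the complement of \<open>S\<close>, hence only eventually. Along the segment the local constant is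
  also a global one.\<close>

lemma box_average_Lipschitz:
  assumes "x \<in> S" "y \<in> S"
  shows "\<forall>\<^sub>F s in at_right 0. \<bar>box_average v s y - box_average v s x\<bar> \<le> 4 * M * norm (y - x)"
proof (cases "x = y")
  case True
  then show ?thesis by simp
next
  case False
  have "closed_segment x y \<subseteq> S" using S(3) assms closed_segment_subset by blast
  then obtain \<epsilon> where \<epsilon>: "\<epsilon> > 0" "(\<Union>p\<in>closed_segment x y. ball p \<epsilon>) \<subseteq> S"
    by (rule compact_subset_open_imp_ball_epsilon_subset[OF compact_segment S(2)])
  have "\<bar>box_average v s y - box_average v s x\<bar> \<le> 4 * M * norm (y - x)" if s: "0 < s" "s < \<epsilon> / 8" for s
  proof -
    define \<gamma> where "\<gamma> \<tau> = x + \<tau> *\<^sub>R (y - x)" for \<tau> :: real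
    define L where "L = norm (y - x)"
    have L: "L > 0" using False by (simp add: L_def)
    define k where "k \<tau> = box_average v s (\<gamma> \<tau>)" for \<tau>
    have \<gamma>d: "norm (\<gamma> \<tau>' - \<gamma> \<tau>) = \<bar>\<tau>' - \<tau>\<bar> * L" for \<tau> \<tau>'
      by (simp add: \<gamma>_def L_def scaleR_left_diff_distrib[symmetric])
    have loc: "dist (k \<tau>') (k \<tau>) \<le> 4 * M * L * \<bar>\<tau>' - \<tau>\<bar>"
      if "\<tau> \<in> {0..1}" "\<bar>\<tau>' - \<tau>\<bar> \<le> s / L" for \<tau> \<tau>'
    proof -
      have "\<gamma> \<tau> = (1 - \<tau>) *\<^sub>R x + \<tau> *\<^sub>R y" by (simp add: \<gamma>_def algebra_simps)
      then have "\<gamma> \<tau> \<in> closed_segment x y"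
        using that(1) unfolding in_segment by auto
      then have "ball (\<gamma> \<tau>) (8 * s) \<subseteq> S" using \<epsilon>(2) s by (auto 0 4 simp: subset_eq)
      moreover have "norm (\<gamma> \<tau>' - \<gamma> \<tau>) \<le> s" using that(2) L by (simp add: \<gamma>d field_simps)
      ultimately show ?thesis using box_average_local[OF s(1)] 
        by (fastforce simp: k_def dist_real_def \<gamma>d mult_ac)
    qed
    have "(4 * M * L)-lipschitz_on {0..1} k"
    proof (rule locally_lipschitz_imp_lipschitz)
      show "0 \<le> 4 * M * L" using M(1) L by simp
      show "continuous_on {0..1} k"
        unfolding continuous_on_iff
      proof (intro ballI allI impI)
        fix \<tau> :: real and e :: real assume \<tau>: "\<tau> \<in> {0..1}" and e: "e > 0"
        let ?d = "min (s / L) (e / (4 * M * L + 1))"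
        have pos: "0 < 4 * M * L + 1" using M(1) L by (simp add: add_nonneg_pos)
        have "?d > 0" using s L e pos by simp
        moreover have "dist (k \<tau>') (k \<tau>) < e" if "dist \<tau>' \<tau> < ?d" for \<tau>'
        proof -
          have "dist (k \<tau>') (k \<tau>) \<le> 4 * M * L * \<bar>\<tau>' - \<tau>\<bar>"
            using loc[OF \<tau>] that by (simp add: dist_real_def)
          also have "\<dots> \<le> (4 * M * L + 1) * \<bar>\<tau>' - \<tau>\<bar>" by (simp add: distrib_right)
          also have "\<dots> < e" using that pos by (simp add: dist_real_def pos_less_divide_eq mult.commute)
          finally show ?thesis .
        qed
        ultimately show "\<exists>d>0. \<forall>\<tau>'\<in>{0..1}. dist \<tau>' \<tau> < d \<longrightarrow> dist (k \<tau>') (k \<tau>) < e" by blast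
      qed
      show "\<exists>z\<in>{\<tau><..\<tau>'}. dist (k z) (k \<tau>) \<le> 4 * M * L * (z - \<tau>)"
        if "\<tau> \<in> {0..<1}" "\<tau> < \<tau>'" for \<tau> \<tau>'
      proof
        \<comment> \<open>The criterion asks for some point to the right of \<open>\<tau>\<close> at
          which the bound holds; a parameter step of at most \<open>s / L\<close> moves the square
          by at most \<open>s\<close>, the range of \<open>loc\<close>.\<close>
        let ?z = "min \<tau>' (\<tau> + s / L)"
        show "?z \<in> {\<tau><..\<tau>'}" using that s L by simp
        show "dist (k ?z) (k \<tau>) \<le> 4 * M * L * (?z - \<tau>)"
          using loc[of \<tau> ?z] that s L by (auto simp: min_def)
      qed
    qed
    from lipschitz_onD[OF this, of 1 0] show ?thesis
      by (simp add: k_def \<gamma>_def L_def dist_real_def)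
  qed
  moreover have "0 < \<epsilon> / 8" using \<epsilon> by simp
  ultimately show ?thesis unfolding eventually_at_right_field by blast
qed

text \<open>The bound for averages does not involve \<open>s\<close>, so it passes to the limit at
  two points where the averages converge to the values of \<open>v\<close>.\<close>

lemma weakly_Lipschitz:
  assumes "x \<in> S" "y \<in> S"
    and "((\<lambda>s. integral (cbox x (x + s *\<^sub>R One)) v / s ^ CARD(2)) \<longlongrightarrow> v x) (at_right 0)"
    and "((\<lambda>s. integral (cbox y (y + s *\<^sub>R One)) v / s ^ CARD(2)) \<longlongrightarrow> v y) (at_right 0)"
  shows "\<bar>v y - v x\<bar> \<le> 4 * M * norm (y - x)"
proof (rule tendsto_upperbound)
  show "((\<lambda>s. \<bar>box_average v s y - box_average v s x\<bar>) \<longlongrightarrow> \<bar>v y - v x\<bar>) (at_right 0)"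
    using assms(3,4) by (intro tendsto_intros) (simp_all add: box_average_def)
  show "\<forall>\<^sub>F s in at_right 0. \<bar>box_average v s y - box_average v s x\<bar> \<le> 4 * M * norm (y - x)"
    by (rule box_average_Lipschitz[OF assms(1,2)])
qed simp

end

section \<open>Classical weak gradients\<close>

lemma integrable_compact_support:
  fixes f :: "'a::euclidean_space \<Rightarrow> real"
  assumes "continuous_on UNIV f" "compact S" "\<And>x. x \<notin> S \<Longrightarrow> f x = 0"
  shows "integrable lborel f"
proof -
  have "integrable lborel (\<lambda>x. indicator S x *\<^sub>R f x)"
    using assms by (intro borel_integrable_compact) (auto intro: continuous_on_subset)
  moreover have "(\<lambda>x. indicator S x *\<^sub>R f x) = f"
    using assms(3) by (fastforce simp: indicator_def)
  ultimately show ?thesis by simp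
qed

lemma compact_supported_bounded:
  fixes f :: "'a::euclidean_space \<Rightarrow> real"
  assumes "continuous_on UNIV f" "compact S" "\<And>x. x \<notin> S \<Longrightarrow> f x = 0"
  shows "\<exists>B>0. \<forall>x. \<bar>f x\<bar> \<le> B"
proof -
  have "continuous_on S f" using assms(1) by (rule continuous_on_subset) simp
  then have "compact (f ` S)"
    using assms(2) by (rule compact_continuous_image)
  then obtain B where B: "0 < B" "\<And>y. y \<in> f ` S \<Longrightarrow> norm y \<le> B"
    using bounded_pos[of "f ` S"] compact_imp_bounded by blast
  have "\<bar>f x\<bar> \<le> B" for x
  proof (cases "x \<in> S")
    case True
    then show ?thesis using B(2)[of "f x"] by simp
  next
    case False
    then show ?thesis using B(1) assms(3)[of x] by simp
  qed
  with B(1) show ?thesis by blast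
qed

lemma integral_shift_difference_eq_0:
  fixes f :: "'a::euclidean_space \<Rightarrow> real"
  assumes "integrable lborel f"
  shows "integrable lborel (\<lambda>x. f (x + c) - f x)" "(LINT x|lborel. f (x + c) - f x) = 0"
proof -
  have i: "integrable lborel (\<lambda>x. f (c + x))"
    using assms integrable_distr[of "(+) c" lborel borel f] by (simp add: lborel_distr_plus)
  have e: "(LINT x|lborel. f (c + x)) = (LINT x|lborel. f x)"
    using assms integral_distr[of "(+) c" lborel borel f]
    by (simp add: lborel_distr_plus borel_measurable_integrable)
  show "integrable lborel (\<lambda>x. f (x + c) - f x)" "(LINT x|lborel. f (x + c) - f x) = 0"
    using i e assms by (simp_all add: add.commute)
qed

section \<open>Test functions and their supports\<close>

definition test_support :: "(real^'n::finite \<Rightarrow> real) \<Rightarrow> (real^'n) set" where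
  "test_support f = closure {x. f x \<noteq> 0}"

context
  fixes \<Omega> :: "(real^'n::finite) set" and \<phi>
  assumes test: "test_function \<Omega> \<phi>"
begin

lemma test_support: "compact (test_support \<phi>)" "test_support \<phi> \<subseteq> \<Omega>"
  using test by (auto simp: test_function_def test_support_def)

lemma test_function_eq_0: "x \<notin> test_support \<phi> \<Longrightarrow> \<phi> x = 0"
  unfolding test_support_def by (meson closure_subset mem_Collect_eq subsetD)

lemma partial_deriv_eq_0: "x \<notin> test_support \<phi> \<Longrightarrow> partial_deriv i \<phi> x = 0"
proof -
  assume x: "x \<notin> test_support \<phi>"
  have "((\<lambda>_. 0) has_derivative (\<lambda>_. 0)) (at x)" by simp
  then have "(\<phi> has_derivative (\<lambda>_. 0)) (at x)"
  proof (rule has_derivative_transform_within_open)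
    show "open (- test_support \<phi>)" using test_support(1) by (simp add: open_Compl compact_imp_closed)
    show "x \<in> - test_support \<phi>" using x by simp
    show "0 = \<phi> y" if "y \<in> - test_support \<phi>" for y using that by (simp add: test_function_eq_0)
  qed
  then have "frechet_derivative \<phi> (at x) = (\<lambda>_. 0)" by (rule frechet_derivative_at[symmetric])
  then show ?thesis by (simp add: partial_deriv_def)
qed

lemma times_diff_test: "times_diff k \<phi>"
  using test by (simp add: test_function_def)

lemma continuous_test_function: "continuous_on UNIV \<phi>" "continuous_on UNIV (partial_deriv i \<phi>)"
  using times_diff_test[of 0] times_diff_test[of "Suc 0"] by simp_all

lemma test_function_DERIV:
  "((\<lambda>\<tau>. \<phi> (x + axis i \<tau>)) has_real_derivative partial_deriv i \<phi> (x + axis i \<tau>)) (at \<tau>)"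
proof -
  have d: "(\<phi> has_derivative frechet_derivative \<phi> (at y)) (at y)" for y
    using times_diff_test[of "Suc 0"] by (simp add: frechet_derivative_works)
  have ax: "axis i \<tau> = \<tau> *\<^sub>R axis i 1" for \<tau> :: real by (simp add: vec_eq_iff axis_def)
  have "((\<lambda>\<tau>. \<phi> (x + \<tau> *\<^sub>R axis i 1)) has_derivative
      (\<lambda>\<tau>'. frechet_derivative \<phi> (at (x + \<tau> *\<^sub>R axis i 1)) (\<tau>' *\<^sub>R axis i 1))) (at \<tau>)"
    by (rule has_derivative_compose[OF _ d]) (auto intro!: derivative_eq_intros)
  moreover have "frechet_derivative \<phi> (at y) (\<tau>' *\<^sub>R axis i 1) = partial_deriv i \<phi> y * \<tau>'" for y \<tau>'
    using linear_scale[OF has_derivative_linear[OF d[of y]]] by (simp add: partial_deriv_def)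
  ultimately show ?thesis by (simp add: has_field_derivative_def ax[symmetric])
qed

lemma test_function_bound:
  obtains B where "0 < B" "\<And>x. \<bar>\<phi> x\<bar> \<le> B" "\<And>x. \<bar>partial_deriv i \<phi> x\<bar> \<le> B"
proof -
  obtain B1 where B1: "0 < B1" "\<And>x. \<bar>\<phi> x\<bar> \<le> B1"
    using compact_supported_bounded[OF continuous_test_function(1) test_support(1)] test_function_eq_0 by blast
  obtain B2 where B2: "0 < B2" "\<And>x. \<bar>partial_deriv i \<phi> x\<bar> \<le> B2"
    using compact_supported_bounded[OF continuous_test_function(2) test_support(1)] partial_deriv_eq_0 by blast
  show thesis
  proof
    show "0 < max B1 B2" using B1 by simp
    show "\<bar>\<phi> x\<bar> \<le> max B1 B2" for x using B1(2)[of x] by simp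
    show "\<bar>partial_deriv i \<phi> x\<bar> \<le> max B1 B2" for x using B2(2)[of x] by simp
  qed
qed

text \<open>\<open>\<theta>\<close> stands for the test function as well as for its partial
  derivatives; both vanish off a compact set on which \<open>d\<close> is integrable.\<close>

lemma integrable_test:
  assumes "locally_integrable \<Omega> d"
    and "continuous_on UNIV \<theta>" "\<And>x. x \<notin> test_support \<phi> \<Longrightarrow> \<theta> x = 0"
  shows "set_integrable lebesgue \<Omega> (\<lambda>x. d x * \<theta> x)"
proof -
  let ?S = "test_support \<phi>"
  obtain B where B: "0 < B" "\<And>x. \<bar>\<theta> x\<bar> \<le> B"
    using compact_supported_bounded[OF assms(2) test_support(1)] assms(3) by blast
  have d: "integrable lebesgue (\<lambda>x. indicator ?S x *\<^sub>R d x)"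
    using assms(1) test_support unfolding locally_integrable_def set_integrable_def by blast
  have "integrable lebesgue (\<lambda>x. (indicator ?S x *\<^sub>R d x) * \<theta> x)"
  proof (rule Bochner_Integration.integrable_bound)
    show "integrable lebesgue (\<lambda>x. B * (indicator ?S x *\<^sub>R d x))" using d by simp
    show "(\<lambda>x. (indicator ?S x *\<^sub>R d x) * \<theta> x) \<in> borel_measurable lebesgue"
      using d continuous_imp_lebesgue_measurable[OF assms(2)]
      by (intro borel_measurable_times) (auto intro: borel_measurable_integrable)
    show "AE x in lebesgue. norm ((indicator ?S x *\<^sub>R d x) * \<theta> x) \<le> norm (B * (indicator ?S x *\<^sub>R d x))"
    proof (rule AE_I2)
      have "\<bar>a * \<theta> x\<bar> \<le> \<bar>B * a\<bar>" for a x
        using mult_left_mono[OF B(2)[of x] abs_ge_zero[of a]] B(1) by (simp add: abs_mult mult.commute)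
      then show "norm ((indicator ?S x *\<^sub>R d x) * \<theta> x) \<le> norm (B * (indicator ?S x *\<^sub>R d x))" for x
        unfolding real_norm_def .
    qed
  qed
  moreover have "(indicator ?S x *\<^sub>R d x) * \<theta> x = indicator \<Omega> x *\<^sub>R (d x * \<theta> x)" for x
    using assms(3)[of x] test_support(2) by (auto simp: indicator_def)
  ultimately show ?thesis unfolding set_integrable_def by (simp only:)
qed

lemmas integrable_test_function =
  integrable_test[OF _ continuous_test_function(1) test_function_eq_0]
  integrable_test[OF _ continuous_test_function(2) partial_deriv_eq_0]

end

lemma weak_partial_diff:
  assumes "weak_partial \<Omega> i u g" "weak_partial \<Omega> i v k"
  shows "weak_partial \<Omega> i (\<lambda>x. u x - v x) (\<lambda>x. g x - k x)"
proof -
  have li: "locally_integrable \<Omega> u" "locally_integrable \<Omega> v" "locally_integrable \<Omega> g" "locally_integrable \<Omega> k"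
    using assms by (auto simp: weak_partial_def)
  have "(LINT x:\<Omega>|lebesgue. (u x - v x) * partial_deriv i \<phi> x) = - (LINT x:\<Omega>|lebesgue. (g x - k x) * \<phi> x)"
    if \<phi>: "test_function \<Omega> \<phi>" for \<phi>
    using assms \<phi> integrable_test_function[OF \<phi>] li
    by (simp add: weak_partial_def left_diff_distrib set_integral_diff)
  with li show ?thesis
    unfolding weak_partial_def locally_integrable_def by (auto intro: set_integral_diff)
qed

lemma locally_integrable_continuous:
  assumes "continuous_on \<Omega> v"
  shows "locally_integrable \<Omega> v"
  unfolding locally_integrable_def set_integrable_def
proof (intro allI impI)
  fix S assume S: "compact S \<and> S \<subseteq> \<Omega>"
  then have "integrable lborel (\<lambda>x. indicator S x *\<^sub>R v x)"
    using assms by (intro borel_integrable_compact) (auto intro: continuous_on_subset)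
  note i = this
  show "integrable lebesgue (\<lambda>x. indicator S x *\<^sub>R v x)"
    by (rule integrable_completion[OF borel_measurable_integrable[OF i], THEN iffD2, OF i])
qed

lemma locally_integrable_bounded:
  assumes "g \<in> borel_measurable lebesgue" "\<And>x. \<bar>g x\<bar> \<le> B"
  shows "locally_integrable \<Omega> g"
  unfolding locally_integrable_def set_integrable_def
proof (intro allI impI)
  fix S assume S: "compact S \<and> S \<subseteq> \<Omega>"
  then have lm: "S \<in> lmeasurable" by (simp add: lmeasurable_compact)
  show "integrable lebesgue (\<lambda>x. indicator S x *\<^sub>R g x)"
  proof (rule Bochner_Integration.integrable_bound)
    show "integrable lebesgue (\<lambda>x. B * indicator S x)"
      using lm by (intro integrable_mult_right) (simp add: lmeasurable_iff_integrable[symmetric])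
    show "(\<lambda>x. indicator S x *\<^sub>R g x) \<in> borel_measurable lebesgue"
      using assms(1) lm by (intro borel_measurable_scaleR borel_measurable_indicator) (auto simp: fmeasurableD)
    show "AE x in lebesgue. norm (indicator S x *\<^sub>R g x) \<le> norm (B * indicator S x)"
      using assms(2) by (auto simp: indicator_def intro: order_trans[OF _ abs_ge_self])
  qed
qed

text \<open>Integration by parts without Fubini: the difference quotients of \<open>v \<phi>\<close> have integral 0 by
  translation invariance and converge boundedly to its partial derivative.\<close>

lemma weak_partialI:
  fixes v :: "real^'n::finite \<Rightarrow> real"
  assumes "open \<Omega>" and cont: "continuous_on \<Omega> v"
    and g: "g \<in> borel_measurable lebesgue" "\<And>x. \<bar>g x\<bar> \<le> L"
    and lip: "\<And>x t. closed_segment x (x + axis i t) \<subseteq> \<Omega> \<Longrightarrow> \<bar>v (x + axis i t) - v x\<bar> \<le> L * \<bar>t\<bar>"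
    and Z: "negligible Z"
    and deriv: "\<And>x. x \<in> \<Omega> - Z \<Longrightarrow> ((\<lambda>t. v (x + axis i t)) has_real_derivative g x) (at 0)"
  shows "weak_partial \<Omega> i v g"
proof -
  have li: "locally_integrable \<Omega> v" "locally_integrable \<Omega> g"
    using cont g by (auto intro: locally_integrable_continuous locally_integrable_bounded)
  have L0: "0 \<le> L" using g(2)[of undefined] by linarith
  have "(LINT x:\<Omega>|lebesgue. v x * partial_deriv i \<phi> x) = - (LINT x:\<Omega>|lebesgue. g x * \<phi> x)"
    if test: "test_function \<Omega> \<phi>" for \<phi>
  proof -
    let ?S = "test_support \<phi>"
    note S = test_support[OF test]
    obtain \<epsilon> where \<epsilon>: "\<epsilon> > 0" "(\<Union>p\<in>?S. ball p \<epsilon>) \<subseteq> \<Omega>"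
      by (rule compact_subset_open_imp_ball_epsilon_subset[OF S(1) assms(1) S(2)])
    \<comment> \<open>If the difference quotient at \<open>x\<close> with a step of at most
      \<open>\<epsilon> / 2\<close> is nonzero, the segment it uses lies in this compact set; there
      \<open>v\<close> is bounded and its Lipschitz bound applies.\<close>
    define S' where "S' = (\<Union>p\<in>?S. cball p (\<epsilon> / 2))"
    have S': "compact S'" unfolding S'_def by (rule compact_minkowski_sum_cball[OF S(1)])
    have S'\<Omega>: "S' \<subseteq> \<Omega>"
    proof
      fix x assume "x \<in> S'"
      then obtain p where "p \<in> ?S" "dist p x \<le> \<epsilon> / 2" unfolding S'_def by auto
      then have "p \<in> ?S" "x \<in> ball p \<epsilon>" using \<epsilon>(1) by auto
      with \<epsilon>(2) show "x \<in> \<Omega>" by blast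
    qed
    obtain B where B: "0 < B" "\<And>x. \<bar>\<phi> x\<bar> \<le> B" "\<And>x. \<bar>partial_deriv i \<phi> x\<bar> \<le> B"
      by (rule test_function_bound[OF test, of i]) (rule that)
    have "compact (v ` S')"
      using compact_continuous_image[OF continuous_on_subset[OF cont S'\<Omega>] S'] .
    then obtain V where V: "0 < V" "\<And>y. y \<in> v ` S' \<Longrightarrow> norm y \<le> V"
      using bounded_pos[of "v ` S'"] compact_imp_bounded by blast
    define F where "F x = v x * \<phi> x" for x
    have F0: "F x = 0" if "x \<notin> ?S" for x
      using test_function_eq_0[OF test that] by (simp add: F_def)
    \<comment> \<open>\<open>v\<close> is arbitrary off \<open>\<Omega>\<close>, but
      \<open>F\<close> vanishes there: \<open>\<Omega>\<close> and the complement of the support are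
      open, cover the space, and \<open>F\<close> is continuous on each.\<close>
    have "continuous_on (\<Omega> \<union> - ?S) F"
    proof (rule continuous_on_open_Un)
      show "continuous_on \<Omega> F" unfolding F_def
        using cont continuous_on_subset[OF continuous_test_function(1)[OF test]]
        by (intro continuous_on_mult) auto
      have "continuous_on (- ?S) (\<lambda>x. 0 :: real)" by simp
      then show "continuous_on (- ?S) F" by (rule continuous_on_eq) (simp add: F0)
    qed (use assms(1) compact_imp_closed[OF S(1)] in \<open>auto intro: open_Compl\<close>)
    moreover have "\<Omega> \<union> - ?S = UNIV" using S(2) by blast
    ultimately have F: "continuous_on UNIV F" by simp
    have intF: "integrable lborel F"
      by (rule integrable_compact_support[OF F S(1) F0])
    define t where "t n = \<epsilon> / 2 * inverse (real (Suc n))" for n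
    have t: "0 < t n" "t n \<le> \<epsilon> / 2" for n
      using \<epsilon>(1) by (auto simp: t_def field_simps)
    have "t \<longlonglongrightarrow> \<epsilon> / 2 * 0" unfolding t_def
      by (intro tendsto_mult tendsto_const LIMSEQ_inverse_real_of_nat)
    then have tlim: "filterlim t (at 0) sequentially"
      using t(1) by (simp add: filterlim_at less_imp_neq[symmetric])
    define D where "D n x = (F (x + axis i (t n)) - F x) / t n" for n x
    have D0: "(LINT x|lebesgue. D n x) = 0" and Dm: "D n \<in> borel_measurable lebesgue" for n
    proof -
      have "integrable lborel (D n)" "(LINT x|lborel. D n x) = 0"
        unfolding D_def using integral_shift_difference_eq_0[OF intF, of "axis i (t n)"] by simp_all
      note i = this
      show "(LINT x|lebesgue. D n x) = 0"
        using i integral_completion[OF borel_measurable_integrable[OF i(1)]] by simp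
      show "D n \<in> borel_measurable lebesgue"
        by (rule measurable_completion[OF borel_measurable_integrable[OF i(1)]])
    qed
    have bound: "\<bar>D n x\<bar> \<le> (L * B + V * B) * indicator S' x" for n x
    proof (cases "x \<in> ?S \<or> x + axis i (t n) \<in> ?S")
      case False
      then have "D n x = 0" by (simp add: D_def F0)
      then show ?thesis using L0 B(1) V(1) by simp
    next
      case True
      let ?y = "x + axis i (t n)"
      have dist: "dist x ?y = t n" using t(1)[of n] by (simp add: dist_norm norm_axis_real)
      have seg: "closed_segment x ?y \<subseteq> S'"
      proof
        fix z assume z: "z \<in> closed_segment x ?y"
        have "dist x z \<le> dist x ?y" "dist ?y z \<le> dist x ?y"
          using dist_in_closed_segment[OF z] by (simp_all add: dist_commute)
        with True dist t(2)[of n] show "z \<in> S'" unfolding S'_def by fastforce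
      qed
      have vx: "\<bar>v x\<bar> \<le> V" using V(2)[of "v x"] seg by auto
      have vd: "\<bar>v ?y - v x\<bar> \<le> L * t n"
        using lip[of x "t n"] seg S'\<Omega> t(1)[of n] by force
      have pd: "\<bar>\<phi> ?y - \<phi> x\<bar> \<le> B * t n"
      proof -
        have "\<exists>\<tau>. 0 < \<tau> \<and> \<tau> < t n \<and> \<phi> (x + axis i (t n)) - \<phi> (x + axis i 0)
            = (t n - 0) * partial_deriv i \<phi> (x + axis i \<tau>)"
          using t(1) by (intro MVT2) (auto intro: test_function_DERIV[OF test])
        then obtain \<tau> where "\<phi> ?y - \<phi> (x + axis i 0) = t n * partial_deriv i \<phi> (x + axis i \<tau>)"
          by auto
        moreover have "axis i 0 = (0 :: real^'n)" by (simp add: vec_eq_iff axis_def)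
        ultimately show ?thesis
          using B(3)[of "x + axis i \<tau>"] t(1)[of n] by (simp add: abs_mult mult.commute)
      qed
      have "F ?y - F x = (v ?y - v x) * \<phi> ?y + v x * (\<phi> ?y - \<phi> x)"
        by (simp add: F_def algebra_simps)
      then have "\<bar>F ?y - F x\<bar> \<le> \<bar>v ?y - v x\<bar> * \<bar>\<phi> ?y\<bar> + \<bar>v x\<bar> * \<bar>\<phi> ?y - \<phi> x\<bar>"
        by (metis abs_mult abs_triangle_ineq)
      also have "\<dots> \<le> (L * t n) * B + V * (B * t n)"
        using vx vd pd B V(1) L0 t(1)[of n] by (intro add_mono mult_mono) auto
      finally have "\<bar>D n x\<bar> \<le> L * B + V * B"
        using t(1)[of n] by (simp add: D_def field_simps)
      moreover have "x \<in> S'" using seg by auto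
      ultimately show ?thesis by simp
    qed
    define \<psi> where "\<psi> x = indicator \<Omega> x *\<^sub>R (g x * \<phi> x) + indicator \<Omega> x *\<^sub>R (v x * partial_deriv i \<phi> x)" for x
    have lim: "(\<lambda>n. D n x) \<longlonglongrightarrow> \<psi> x" if "x \<notin> Z" for x
    proof (cases "x \<in> \<Omega>")
      case True
      have ax: "axis i 0 = (0 :: real^'n)" by (simp add: vec_eq_iff axis_def)
      have "((\<lambda>\<tau>. F (x + axis i \<tau>)) has_real_derivative
          g x * \<phi> (x + axis i 0) + partial_deriv i \<phi> (x + axis i 0) * v (x + axis i 0)) (at 0)"
        unfolding F_def by (intro DERIV_mult deriv test_function_DERIV[OF test]) (use True that in auto)
      then have "((\<lambda>\<tau>. F (x + axis i \<tau>)) has_real_derivative \<psi> x) (at 0)"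
        using True by (simp add: \<psi>_def ax mult.commute)
      then have "((\<lambda>h. (F (x + axis i h) - F x) / h) \<longlongrightarrow> \<psi> x) (at 0)"
        by (simp add: has_field_derivative_iff ax)
      from filterlim_compose[OF this tlim] show ?thesis unfolding D_def .
    next
      case False
      then have "x \<notin> S'" using S'\<Omega> by blast
      then have "D n x = 0" for n using bound[of n x] by simp
      then show ?thesis using False by (simp add: \<psi>_def)
    qed
    have i1: "set_integrable lebesgue \<Omega> (\<lambda>x. g x * \<phi> x)"
      and i2: "set_integrable lebesgue \<Omega> (\<lambda>x. v x * partial_deriv i \<phi> x)"
      using integrable_test_function[OF test] li by blast+
    have \<psi>int: "integrable lebesgue \<psi>"
      unfolding \<psi>_def using i1 i2 unfolding set_integrable_def by (rule Bochner_Integration.integrable_add)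
    have w: "integrable lebesgue (\<lambda>x. (L * B + V * B) * indicator S' x)"
      using lmeasurable_compact[OF S']
      by (intro integrable_mult_right) (simp add: lmeasurable_iff_integrable[symmetric])
    have "AE x in lebesgue. x \<notin> Z" using Z by (simp add: negligible_iff_null_sets AE_not_in)
    then have l: "AE x in lebesgue. (\<lambda>n. D n x) \<longlonglongrightarrow> \<psi> x" by eventually_elim (rule lim)
    have b: "AE x in lebesgue. norm (D n x) \<le> (L * B + V * B) * indicator S' x" for n
      using bound by simp
    have "(\<lambda>n. LINT x|lebesgue. D n x) \<longlonglongrightarrow> (LINT x|lebesgue. \<psi> x)"
      using integral_dominated_convergence[OF borel_measurable_integrable[OF \<psi>int] Dm w l b] .
    then have "(LINT x|lebesgue. \<psi> x) = 0" by (simp add: D0 LIMSEQ_const_iff)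
    moreover have "(LINT x|lebesgue. \<psi> x)
        = (LINT x:\<Omega>|lebesgue. g x * \<phi> x) + (LINT x:\<Omega>|lebesgue. v x * partial_deriv i \<phi> x)"
      unfolding \<psi>_def set_lebesgue_integral_def
      using i1 i2 unfolding set_integrable_def by (rule Bochner_Integration.integral_add)
    ultimately show ?thesis by simp
  qed
  with li show ?thesis unfolding weak_partial_def by blast
qed

section \<open>Weak gradients of finite element functions\<close>

lemma weak_partial_unique:
  assumes "open \<Omega>" "weak_partial \<Omega> i u g" "weak_partial \<Omega> i u k"
  shows "\<exists>N. negligible N \<and> (\<forall>x\<in>\<Omega> - N. g x = k x)"
proof -
  have li: "locally_integrable \<Omega> g" "locally_integrable \<Omega> k"
    using assms(2,3) by (auto simp: weak_partial_def)
  have d: "locally_integrable \<Omega> (\<lambda>x. g x - k x)"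
    using li unfolding locally_integrable_def by (auto intro: set_integral_diff)
  have "(LINT x:\<Omega>|lebesgue. (g x - k x) * \<phi> x) = 0" if \<phi>: "test_function \<Omega> \<phi>" for \<phi>
    using assms(2,3) \<phi> integrable_test_function(1)[OF \<phi>] li
    by (simp add: weak_partial_def left_diff_distrib set_integral_diff)
  from weakly_zero_imp_zero[OF assms(1) d this]
  obtain N where "negligible N" "\<And>x. x \<in> \<Omega> - N \<Longrightarrow> g x - k x = 0" by blast
  then show ?thesis by auto
qed

text \<open>The seminorm is built on a chosen gradient about which nothing is known beyond its being
  a weak gradient. Uniqueness identifies it with \<open>g\<close> almost everywhere, and the
  pointwise bound is integrated.\<close>

lemma H1_seminorm_le:
  fixes \<Omega> :: "(real^'n::finite) set"
  assumes \<Omega>: "open \<Omega>" "bounded \<Omega>"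
    and weak: "\<And>i. weak_partial \<Omega> i w (\<lambda>x. g x $ i)"
    and bound: "negligible N" "\<And>x. x \<in> \<Omega> - N \<Longrightarrow> norm (g x) \<le> c" and c: "0 \<le> c"
  shows "H1_seminorm \<Omega> w \<le> c * sqrt (measure lebesgue \<Omega>)"
proof -
  have "\<exists>g. \<forall>i. weak_partial \<Omega> i w (\<lambda>x. g x $ i)" using weak by blast
  from someI_ex[OF this] have "\<forall>i. weak_partial \<Omega> i w (\<lambda>x. weak_grad \<Omega> w x $ i)"
    unfolding weak_grad_def .
  then have "\<forall>i. \<exists>N. negligible N \<and> (\<forall>x\<in>\<Omega> - N. weak_grad \<Omega> w x $ i = g x $ i)"
    using weak_partial_unique[OF \<Omega>(1) _ weak] by blast
  then obtain N' where N': "\<And>i. negligible (N' i)" "\<And>i x. x \<in> \<Omega> - N' i \<Longrightarrow> weak_grad \<Omega> w x $ i = g x $ i"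
    by metis
  define Z where "Z = N \<union> (\<Union>i. N' i)"
  have "negligible Z" unfolding Z_def by (intro negligible_Un bound negligible_Union) (use N' in auto)
  then have Z: "AE x in lebesgue. x \<notin> Z" by (simp add: negligible_iff_null_sets AE_not_in)
  have m: "\<Omega> \<in> lmeasurable" using \<Omega> by (simp add: lmeasurable_open)
  have "(LINT x:\<Omega>|lebesgue. (norm (weak_grad \<Omega> w x))\<^sup>2) \<le> (LINT x|lebesgue. c\<^sup>2 * indicator \<Omega> x)"
    unfolding set_lebesgue_integral_def
  \<comment> \<open>This comparison asks for integrability of the majorant alone, so measurability
    of the chosen gradient does not have to be discussed.\<close>
  proof (rule integral_mono_AE')
    show "integrable lebesgue (\<lambda>x. c\<^sup>2 * indicator \<Omega> x)"
      using m by (intro integrable_mult_right) (simp add: lmeasurable_iff_integrable[symmetric])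
    show "AE x in lebesgue. indicator \<Omega> x *\<^sub>R (norm (weak_grad \<Omega> w x))\<^sup>2 \<le> c\<^sup>2 * indicator \<Omega> x"
      using Z
    proof eventually_elim
      case (elim x)
      show ?case
      proof (cases "x \<in> \<Omega>")
        case True
        then have "weak_grad \<Omega> w x = g x" using elim N'(2) by (auto simp: vec_eq_iff Z_def)
        moreover have "norm (g x) \<le> c" using True elim bound(2) by (auto simp: Z_def)
        ultimately show ?thesis using True by (simp add: power_mono)
      qed simp
    qed
  qed simp
  also have "\<dots> = c\<^sup>2 * measure lebesgue \<Omega>" by simp
  finally have "H1_seminorm \<Omega> w \<le> sqrt (c\<^sup>2 * measure lebesgue \<Omega>)"
    unfolding H1_seminorm_def by (rule real_sqrt_le_mono)
  then show ?thesis using c by (simp add: real_sqrt_mult)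
qed

lemma axis_scaleR: "axis i t = t *\<^sub>R (axis i 1 :: real^'n::finite)"
  by (simp add: vec_eq_iff axis_def)

lemma axis_zero: "axis i 0 = (0 :: real^'n::finite)"
  by (simp add: vec_eq_iff axis_def)

lemma continuous_on_add_axis: "continuous_on A (\<lambda>t. x + axis i t :: real^'n::finite)"
proof -
  have "(\<lambda>t. x + axis i t) = (\<lambda>t. x + t *\<^sub>R axis i 1)"
    by (rule ext) (subst axis_scaleR, rule refl)
  then show ?thesis by (simp only:) (intro continuous_intros)
qed

lemma inner_axis_real: "(a :: real^'n::finite) \<bullet> axis i t = t * a $ i"
  by (simp add: inner_axis mult.commute)

lemma weak_partial_linear:
  fixes G :: "real^'n::finite"
  assumes "open \<Omega>"
  shows "weak_partial \<Omega> i (\<lambda>x. G \<bullet> x) (\<lambda>_. G $ i)"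
proof (rule weak_partialI[OF assms, where L = "\<bar>G $ i\<bar>" and Z = "{}"])
  show "continuous_on \<Omega> (\<lambda>x. G \<bullet> x)" by (intro continuous_intros)
  show "\<bar>G \<bullet> (x + axis i t) - G \<bullet> x\<bar> \<le> \<bar>G $ i\<bar> * \<bar>t\<bar>" for x t
    by (simp add: inner_add_right inner_axis_real abs_mult)
  show "((\<lambda>t. G \<bullet> (x + axis i t)) has_real_derivative G $ i) (at 0)" for x
    unfolding inner_add_right inner_axis_real by (auto intro!: derivative_eq_intros)
qed auto

text \<open>Two members meet in a common face, and a proper face misses the interior; so a common
  interior point forces the face to be all of each member.\<close>

lemma triangulation_interior_disjoint:
  assumes "triangulation \<T>" "K \<in> \<T>" "K' \<in> \<T>" "x \<in> interior K" "x \<in> interior K'"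
  shows "K = K'"
proof -
  have sub: "K \<inter> K' = K" if "K \<in> \<T>" "K' \<in> \<T>" "x \<in> interior K" "x \<in> K'" for K K'
  proof (rule ccontr)
    assume "K \<inter> K' \<noteq> K"
    moreover have "(K \<inter> K') face_of K" using assms(1) that unfolding triangulation_def by blast
    ultimately have "K \<inter> K' \<inter> interior K = {}" by (rule face_of_disjoint_interior[rotated])
    with that interior_subset show False by blast
  qed
  have "x \<in> K" "x \<in> K'" using assms(4,5) interior_subset by (meson subsetD)+
  with sub[OF assms(2,3,4)] sub[OF assms(3,2,5)] show ?thesis by blast
qed

text \<open>A finite sum of indicators of interiors makes measurability immediate; on the edges, a
  null set, no triangle claims the point and the value is 0.\<close>

definition pw_grad :: "(real^2) set set \<Rightarrow> ((real^2) set \<Rightarrow> real^2) \<Rightarrow> real^2 \<Rightarrow> real^2" where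
  "pw_grad \<T> a x = (\<Sum>K\<in>\<T>. indicator (interior K) x *\<^sub>R a K)"

lemma pw_grad_eq:
  assumes "triangulation \<T>" "K \<in> \<T>" "x \<in> interior K"
  shows "pw_grad \<T> a x = a K"
proof -
  have "finite \<T>" using assms(1) by (simp add: triangulation_def)
  moreover have "indicator (interior K') x *\<^sub>R a K' = (if K' = K then a K else 0)" if "K' \<in> \<T>" for K'
  proof (cases "x \<in> interior K'")
    case True
    with triangulation_interior_disjoint[OF assms(1,2) that assms(3)] have "K' = K" by simp
    with True show ?thesis by simp
  next
    case False
    then have "K' \<noteq> K" using assms(3) by blast
    with False show ?thesis by simp
  qed
  then have "pw_grad \<T> a x = (\<Sum>K'\<in>\<T>. if K' = K then a K else 0)"
    unfolding pw_grad_def by (rule sum.cong[OF refl])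
  ultimately show ?thesis using assms(2) by simp
qed

lemma conforming_triangulation_compact_convex:
  assumes "conforming_triangulation \<Omega> \<T>" "K \<in> \<T>"
  shows "compact K" "convex K"
proof -
  have s: "2 simplex K" using assms unfolding conforming_triangulation_def by blast
  show "compact K" by (rule compact_simplex[OF s])
  show "convex K" by (rule convex_simplex[OF s])
qed

lemma conforming_triangulation_cover:
  assumes "conforming_triangulation \<Omega> \<T>"
  shows "negligible (\<Union>(frontier ` \<T>))"
    "x \<in> \<Omega> - \<Union>(frontier ` \<T>) \<Longrightarrow> \<exists>K\<in>\<T>. x \<in> interior K"
proof -
  have fin: "finite \<T>" and cov: "\<Union>\<T> = closure \<Omega>"
    using assms by (auto simp: conforming_triangulation_def triangulation_def)
  show "negligible (\<Union>(frontier ` \<T>))"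
    using fin by (intro negligible_Union)
      (auto intro: negligible_convex_frontier conforming_triangulation_compact_convex[OF assms])
  assume x: "x \<in> \<Omega> - \<Union>(frontier ` \<T>)"
  then obtain K where "K \<in> \<T>" "x \<in> K" using cov closure_subset by blast
  moreover have "x \<notin> frontier K" using x \<open>K \<in> \<T>\<close> by blast
  ultimately show "\<exists>K\<in>\<T>. x \<in> interior K"
    using closure_subset by (auto simp: frontier_def)
qed

text \<open>Off the edges \<open>v\<close> is classically differentiable. Along a segment in
  \<open>\<Omega>\<close> the finitely many closed triangles cut the parameter interval into closed
  pieces on which the slope is at most \<open>L\<close>, and Lipschitz bounds on finitely many
  closed pieces of an interval combine to one with the same constant.\<close>

lemma weak_partial_fe:
  assumes \<Omega>: "open \<Omega>" and conf: "conforming_triangulation \<Omega> \<T>"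
    and v: "continuous_on (closure \<Omega>) v" "\<And>K x. K \<in> \<T> \<Longrightarrow> x \<in> K \<Longrightarrow> v x = a K \<bullet> x + b K"
  shows "weak_partial \<Omega> i v (\<lambda>x. pw_grad \<T> a x $ i)"
proof -
  have fin: "finite \<T>" and cov: "\<Union>\<T> = closure \<Omega>" and tri: "triangulation \<T>"
    using conf by (auto simp: conforming_triangulation_def triangulation_def)
  \<comment> \<open>Any common bound for the slopes serves, as \<open>L\<close> does not occur in
    the conclusion; the sum bounds \<open>pw_grad\<close> directly.\<close>
  define L where "L = (\<Sum>K\<in>\<T>. \<bar>a K $ i\<bar>)"
  have L: "\<bar>a K $ i\<bar> \<le> L" if "K \<in> \<T>" for K
    unfolding L_def using fin that by (intro member_le_sum) auto
  have L0: "0 \<le> L" unfolding L_def by (intro sum_nonneg) auto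
  have on_line: "v (x + axis i s) - v (x + axis i t) = (s - t) * a K $ i"
    if "K \<in> \<T>" "x + axis i s \<in> K" "x + axis i t \<in> K" for K x s t
    using that by (simp add: v(2) inner_add_right inner_axis_real left_diff_distrib)
  show ?thesis
  proof (rule weak_partialI[OF \<Omega>, where L = L and Z = "\<Union>(frontier ` \<T>)"])
    show "continuous_on \<Omega> v" using v(1) closure_subset by (rule continuous_on_subset)
    have "(\<lambda>x. \<Sum>K\<in>\<T>. indicator (interior K) x * a K $ i) \<in> borel_measurable lebesgue"
      by (intro borel_measurable_sum borel_measurable_times borel_measurable_indicator) auto
    then show "(\<lambda>x. pw_grad \<T> a x $ i) \<in> borel_measurable lebesgue"
      by (simp add: pw_grad_def)
    show "\<bar>pw_grad \<T> a x $ i\<bar> \<le> L" for x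
    proof -
      have "\<bar>pw_grad \<T> a x $ i\<bar> \<le> (\<Sum>K\<in>\<T>. \<bar>indicator (interior K) x * a K $ i\<bar>)"
        unfolding pw_grad_def by simp
      also have "\<dots> \<le> L" unfolding L_def
        by (intro sum_mono) (auto simp: indicator_def)
      finally show ?thesis .
    qed
    show "negligible (\<Union>(frontier ` \<T>))" by (rule conforming_triangulation_cover(1)[OF conf])
    show "\<bar>v (x + axis i t) - v x\<bar> \<le> L * \<bar>t\<bar>" if seg: "closed_segment x (x + axis i t) \<subseteq> \<Omega>" for x t
    proof -
      let ?I = "{min 0 t..max 0 t}"
      define U where "U K = {\<tau> \<in> ?I. x + axis i \<tau> \<in> K}" for K
      have "L-lipschitz_on ?I (\<lambda>\<tau>. v (x + axis i \<tau>))"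
      proof (rule lipschitz_on_closed_Union[OF _ _ fin L0])
        show "L-lipschitz_on (U K) (\<lambda>\<tau>. v (x + axis i \<tau>))" if "K \<in> \<T>" for K
        proof (rule lipschitz_onI[OF _ L0])
          fix s \<tau> assume "s \<in> U K" "\<tau> \<in> U K"
          then have "v (x + axis i s) - v (x + axis i \<tau>) = (s - \<tau>) * a K $ i"
            using that by (intro on_line) (auto simp: U_def)
          then show "dist (v (x + axis i s)) (v (x + axis i \<tau>)) \<le> L * dist s \<tau>"
            using mult_right_mono[OF L[OF that], of "\<bar>s - \<tau>\<bar>"]
            by (simp add: dist_real_def abs_mult mult.commute)
        qed
        show "closed (U K)" if "K \<in> \<T>" for K
        proof -
          have "closed K" using conforming_triangulation_compact_convex[OF conf that] compact_imp_closed by blast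
          then have "closed (?I \<inter> (\<lambda>\<tau>. x + axis i \<tau>) -` K)"
            by (intro continuous_closed_preimage continuous_on_add_axis) auto
          moreover have "U K = ?I \<inter> (\<lambda>\<tau>. x + axis i \<tau>) -` K" by (auto simp: U_def)
          ultimately show ?thesis by simp
        qed
        show "?I \<subseteq> (\<Union>K\<in>\<T>. U K)"
        proof
          fix \<tau> assume \<tau>: "\<tau> \<in> ?I"
          have "x + axis i \<tau> \<in> closed_segment x (x + axis i t)"
          proof (cases "t = 0")
            case True
            then have "\<tau> = 0" using \<tau> by simp
            then show ?thesis by (simp add: axis_zero)
          next
            case False
            have "x + axis i \<tau> = (1 - \<tau> / t) *\<^sub>R x + (\<tau> / t) *\<^sub>R (x + axis i t)"
              using False by (simp add: vec_eq_iff axis_def algebra_simps)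
            moreover have "0 \<le> \<tau> / t \<and> \<tau> / t \<le> 1"
              using \<tau> False by (auto simp: min_def max_def divide_simps split: if_splits)
            ultimately show ?thesis unfolding in_segment by blast
          qed
          then have "x + axis i \<tau> \<in> \<Union>\<T>" using seg cov closure_subset by blast
          then show "\<tau> \<in> (\<Union>K\<in>\<T>. U K)" using \<tau> by (auto simp: U_def)
        qed
      qed
      from lipschitz_onD[OF this, of t 0] show ?thesis
        by (simp add: dist_real_def axis_zero)
    qed
    show "((\<lambda>t. v (x + axis i t)) has_real_derivative pw_grad \<T> a x $ i) (at 0)"
      if x: "x \<in> \<Omega> - \<Union>(frontier ` \<T>)" for x
    proof -
      obtain K where K: "K \<in> \<T>" "x \<in> interior K"
        using conforming_triangulation_cover(2)[OF conf x] by blast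
      have "((\<lambda>t. v x + t * a K $ i) has_real_derivative a K $ i) (at 0)"
        by (auto intro!: derivative_eq_intros)
      then have "((\<lambda>t. v (x + axis i t)) has_real_derivative a K $ i) (at 0)"
      proof (rule has_field_derivative_transform_within_open)
        show "open ((\<lambda>t. x + axis i t) -` interior K)"
          by (rule open_vimage[OF open_interior continuous_on_add_axis])
        show "0 \<in> (\<lambda>t. x + axis i t) -` interior K" using K(2) by (simp add: axis_zero)
        show "v x + t * a K $ i = v (x + axis i t)" if "t \<in> (\<lambda>t. x + axis i t) -` interior K" for t
        proof -
          have "x + axis i t \<in> K" "x + axis i 0 \<in> K"
            using that K(2) interior_subset[of K] by (auto simp: axis_zero)
          from on_line[OF K(1) this] show ?thesis by (simp add: axis_zero)
        qed
      qed
      then show ?thesis by (simp add: pw_grad_eq[OF tri K])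
    qed
  qed
qed

section \<open>Traces at the closure of a Lipschitz domain\<close>

lemma L_infty_bounded:
  assumes "open \<Omega>" "L_infty \<Omega> f"
  shows "\<exists>M\<ge>0. \<exists>Z. negligible Z \<and> (\<forall>x\<in>\<Omega> - Z. \<bar>f x\<bar> \<le> M)"
proof -
  obtain M where "AE x in lebesgue_on \<Omega>. \<bar>f x\<bar> \<le> M" using assms(2) by (auto simp: L_infty_def)
  then have "AE x in lebesgue. x \<in> \<Omega> \<longrightarrow> \<bar>f x\<bar> \<le> M"
    using assms(1) by (subst (asm) AE_restrict_space_iff) auto
  then obtain Z where Z: "Z \<in> null_sets lebesgue" "{x \<in> space lebesgue. \<not> (x \<in> \<Omega> \<longrightarrow> \<bar>f x\<bar> \<le> M)} \<subseteq> Z"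
    unfolding eventually_ae_filter by blast
  then have "negligible Z" "\<forall>x\<in>\<Omega> - Z. \<bar>f x\<bar> \<le> max 0 M"
    by (auto simp: negligible_iff_null_sets)
  then show ?thesis by (intro exI[of _ "max 0 M"] conjI exI[of _ Z]) auto
qed

text \<open>The Minkowski sum of the segment and a small ball is convex. It supplies the convex set
  on which a bounded weak gradient yields a Lipschitz bound.\<close>

lemma convex_open_neighbourhood_of_segment:
  fixes x y :: "'a::euclidean_space"
  assumes "open \<Omega>" "closed_segment x y \<subseteq> \<Omega>"
  shows "\<exists>S. open S \<and> convex S \<and> S \<subseteq> \<Omega> \<and> x \<in> S \<and> y \<in> S"
proof -
  obtain \<epsilon> where \<epsilon>: "\<epsilon> > 0" "(\<Union>p\<in>closed_segment x y. ball p \<epsilon>) \<subseteq> \<Omega>"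
    by (rule compact_subset_open_imp_ball_epsilon_subset[OF compact_segment assms])
  define S where "S = (\<Union>p\<in>closed_segment x y. ball p \<epsilon>)"
  have "S = (\<Union>p\<in>closed_segment x y. \<Union>q\<in>ball 0 \<epsilon>. {p + q})"
  proof -
    have "ball p \<epsilon> = (\<Union>q\<in>ball 0 \<epsilon>. {p + q})" for p :: 'a
    proof (intro equalityI subsetI)
      fix z assume "z \<in> ball p \<epsilon>"
      then have "z - p \<in> ball 0 \<epsilon>" "z = p + (z - p)" by (simp_all add: dist_norm norm_minus_commute)
      then show "z \<in> (\<Union>q\<in>ball 0 \<epsilon>. {p + q})" by blast
    qed (auto simp: dist_norm)
    then show ?thesis unfolding S_def by (intro SUP_cong refl)
  qed
  then have "convex S" by (simp add: convex_sums)
  moreover have "open S" "S \<subseteq> \<Omega>" using \<epsilon>(2) by (auto simp: S_def)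
  moreover have "x \<in> S" "y \<in> S"
    unfolding S_def using \<epsilon>(1) by (blast intro: centre_in_ball[THEN iffD2] ends_in_segment)+
  ultimately show ?thesis by blast
qed

text \<open>Otherwise the null set would contain a nonempty open set.\<close>

lemma open_subset_closure_Diff_negligible:
  fixes S :: "'a::euclidean_space set"
  assumes "open S" "negligible N"
  shows "S \<subseteq> closure (S - N)"
proof
  fix x assume x: "x \<in> S"
  show "x \<in> closure (S - N)"
  proof (rule ccontr)
    assume c: "x \<notin> closure (S - N)"
    let ?T = "S - closure (S - N)"
    have "open ?T" using assms(1) by (rule open_Diff) simp
    moreover have "?T \<noteq> {}" using x c by blast
    moreover have "negligible ?T"
      using closure_subset[of "S - N"] by (intro negligible_subset[OF assms(2)]) blast
    ultimately show False using open_not_negligible by blast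
  qed
qed

lemma Lipschitz_boundary_chart:
  assumes "open \<Omega>" "Lipschitz_boundary \<Omega>" "p \<in> frontier \<Omega>"
  obtains \<epsilon> L and f :: "real^2 \<Rightarrow> real^2" and \<gamma> :: "real \<Rightarrow> real" where "0 < \<epsilon>" "orthogonal_transformation f" "0 \<le> L" "L-lipschitz_on UNIV \<gamma>"
    "\<And>x. x \<in> ball p \<epsilon> \<Longrightarrow> x \<in> \<Omega> \<longleftrightarrow> \<gamma> (f x $ 1) < f x $ 2" "p \<notin> \<Omega>"
proof -
  obtain V L and f :: "real^2 \<Rightarrow> real^2" and \<gamma> :: "real \<Rightarrow> real" where V: "open V" "p \<in> V" "orthogonal_transformation f" "L-lipschitz_on UNIV \<gamma>"
    "\<Omega> \<inter> V = {x \<in> V. \<gamma> (f x $ 1) < f x $ 2}"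
    using assms(2)[unfolded Lipschitz_boundary_def, rule_format, OF assms(3)]
    by (elim exE conjE) (rule that)
  obtain \<epsilon> where \<epsilon>: "0 < \<epsilon>" "ball p \<epsilon> \<subseteq> V" using V(1,2) open_contains_ball by blast
  have "p \<notin> \<Omega>" using assms(1,3) by (simp add: frontier_def interior_open)
  moreover have "x \<in> \<Omega> \<longleftrightarrow> \<gamma> (f x $ 1) < f x $ 2" if "x \<in> ball p \<epsilon>" for x
    using V(5) \<epsilon>(2) that by blast
  moreover have "0 \<le> L" using V(4) by (rule lipschitz_on_nonneg)
  ultimately show thesis by (intro that[OF \<epsilon>(1) V(3) _ V(4)])
qed

text \<open>A domain with a slit shows what can go wrong. Here the domain lies on one side of a
  graph, so points just below a boundary point have a neighbourhood missing \<open>\<Omega>\<close>.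
  The lemma places the interiors of the triangles, known to lie in the closure, inside
  \<open>\<Omega>\<close>.\<close>

lemma interior_closure_Lipschitz:
  assumes "open \<Omega>" "Lipschitz_boundary \<Omega>"
  shows "interior (closure \<Omega>) \<subseteq> \<Omega>"
proof (rule ccontr)
  assume "\<not> interior (closure \<Omega>) \<subseteq> \<Omega>"
  then obtain p where p: "p \<in> interior (closure \<Omega>)" "p \<notin> \<Omega>" by blast
  then have front: "p \<in> frontier \<Omega>"
    using assms(1) interior_subset[of "closure \<Omega>"] by (auto simp: frontier_def interior_open)
  obtain \<epsilon> L and f :: "real^2 \<Rightarrow> real^2" and \<gamma> :: "real \<Rightarrow> real" where \<epsilon>: "0 < \<epsilon>" and f: "orthogonal_transformation f" and "0 \<le> L"
    and \<gamma>: "L-lipschitz_on UNIV \<gamma>"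
    and \<Omega>: "\<And>x. x \<in> ball p \<epsilon> \<Longrightarrow> x \<in> \<Omega> \<longleftrightarrow> \<gamma> (f x $ 1) < f x $ 2" and "p \<notin> \<Omega>"
    by (rule Lipschitz_boundary_chart[OF assms front]) (rule that)
  have lin: "linear f" using f by (rule orthogonal_transformation_linear)
  \<comment> \<open>\<open>e\<close> is the vertical direction of the chart, and \<open>q\<close>
    below is \<open>p\<close> moved down by \<open>\<eta>\<close>, strictly under the graph.\<close>
  obtain e where e: "f e = axis 2 1" using orthogonal_transformation_surj[OF f] by (metis surjD)
  have "norm e = 1" using orthogonal_transformation_norm[OF f, of e] e by (simp add: norm_axis_1)
  obtain \<delta> where \<delta>: "0 < \<delta>" "ball p \<delta> \<subseteq> interior (closure \<Omega>)"
    using p(1) open_contains_ball[of "interior (closure \<Omega>)"] by auto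
  define \<eta> where "\<eta> = min \<epsilon> \<delta> / 2"
  have \<eta>: "0 < \<eta>" "\<eta> < \<epsilon>" "\<eta> < \<delta>" using \<epsilon> \<delta>(1) by (auto simp: \<eta>_def)
  define q where "q = p - \<eta> *\<^sub>R e"
  have "dist p q = \<eta>" using \<eta>(1) \<open>norm e = 1\<close> by (simp add: q_def dist_norm)
  have fq: "f q = f p - \<eta> *\<^sub>R axis 2 1"
    unfolding q_def using lin e by (simp add: linear_diff linear_scale)
  define T where "T = {y \<in> ball p \<epsilon>. f y $ 2 < \<gamma> (f y $ 1)}"
  have cont: "continuous_on UNIV (\<lambda>y. f y $ j)" for j
    using linear_continuous_on[OF lin[THEN linear_conv_bounded_linear[THEN iffD1]]]
    by (intro continuous_intros) auto
  have "continuous_on UNIV (\<lambda>y. \<gamma> (f y $ 1))"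
    by (rule continuous_on_compose2[OF lipschitz_on_continuous_on[OF \<gamma>] cont]) auto
  then have "open {y. f y $ 2 < \<gamma> (f y $ 1)}" using cont by (rule open_Collect_less[rotated])
  moreover have "T = ball p \<epsilon> \<inter> {y. f y $ 2 < \<gamma> (f y $ 1)}" by (auto simp: T_def)
  ultimately have "open T" by (simp add: open_Int)
  moreover have "\<Omega> \<inter> T = {}" using \<Omega> by (force simp: T_def)
  moreover have "q \<in> T"
  proof -
    have "f q $ 1 = f p $ 1" "f q $ 2 = f p $ 2 - \<eta>" by (simp_all add: fq axis_def)
    moreover have "\<not> \<gamma> (f p $ 1) < f p $ 2" using \<Omega>[of p] p(2) \<epsilon> by simp
    ultimately show ?thesis using \<open>dist p q = \<eta>\<close> \<eta> by (simp add: T_def)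
  qed
  moreover have "q \<in> closure \<Omega>"
  proof -
    have "q \<in> ball p \<delta>" using \<open>dist p q = \<eta>\<close> \<eta> by simp
    then show ?thesis using \<delta>(2) interior_subset[of "closure \<Omega>"] by blast
  qed
  ultimately show False using open_Int_closure_eq_empty[of T \<Omega>] by blast
qed

text \<open>Two points of the domain near a boundary point are joined through a third point which lies in
  the cone above both of them; an open set of such points is available, so a null set can be avoided.\<close>

lemma Lipschitz_near_frontier:
  fixes u :: "real^2 \<Rightarrow> real"
  assumes "open \<Omega>" "Lipschitz_boundary \<Omega>" "p \<in> frontier \<Omega>" "negligible N" and C: "0 \<le> C"
    and seg: "\<And>x y. x \<in> \<Omega> - N \<Longrightarrow> y \<in> \<Omega> - N \<Longrightarrow> closed_segment x y \<subseteq> \<Omega> \<Longrightarrow> \<bar>u y - u x\<bar> \<le> C * norm (y - x)"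
  shows "\<exists>\<delta>>0. \<exists>C'. \<forall>x\<in>\<Omega> - N. \<forall>y\<in>\<Omega> - N. x \<in> ball p \<delta> \<longrightarrow> y \<in> ball p \<delta> \<longrightarrow>
    \<bar>u y - u x\<bar> \<le> C' * norm (y - x)"
proof -
  obtain \<epsilon> L and f :: "real^2 \<Rightarrow> real^2" and \<gamma> :: "real \<Rightarrow> real" where \<epsilon>: "0 < \<epsilon>" and f: "orthogonal_transformation f"
    and L: "0 \<le> L" and \<gamma>: "L-lipschitz_on UNIV \<gamma>"
    and \<Omega>: "\<And>x. x \<in> ball p \<epsilon> \<Longrightarrow> x \<in> \<Omega> \<longleftrightarrow> \<gamma> (f x $ 1) < f x $ 2" and "p \<notin> \<Omega>"
    by (rule Lipschitz_boundary_chart[OF assms(1-3)]) (rule that)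
  have lin: "linear f" using f by (rule orthogonal_transformation_linear)
  have fnorm: "norm (f x - f y) = norm (x - y)" for x y
    using orthogonal_transformation_norm[OF f, of "x - y"] lin by (simp add: linear_diff)
  \<comment> \<open>Chosen so that \<open>\<delta> + (L + 3) * (2 * \<delta>) = \<epsilon>\<close>:
    the detour through the third point, at most \<open>(L + 3) * (2 * \<delta>)\<close> from either
    end, stays in the chart.\<close>
  define \<delta> where "\<delta> = \<epsilon> / (2 * L + 7)"
  have \<delta>: "0 < \<delta>" "\<delta> * (2 * L + 7) = \<epsilon>" using \<epsilon> L by (auto simp: \<delta>_def)
  \<comment> \<open>A segment rising with slope at least \<open>L\<close> from a point above the
    graph cannot cross it; \<open>near\<close> keeps it where the graph describes
    \<open>\<Omega>\<close>.\<close>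
  have cone: "closed_segment x z \<subseteq> \<Omega>"
    if x: "x \<in> \<Omega>" "x \<in> ball p \<delta>" and up: "L * \<bar>f z $ 1 - f x $ 1\<bar> \<le> f z $ 2 - f x $ 2"
      and near: "norm (z - x) \<le> (L + 3) * (2 * \<delta>)" for x z
  proof
    fix q assume "q \<in> closed_segment x z"
    then obtain \<tau> where \<tau>: "0 \<le> \<tau>" "\<tau> \<le> 1" "q = (1 - \<tau>) *\<^sub>R x + \<tau> *\<^sub>R z" unfolding in_segment by blast
    have "q - x = \<tau> *\<^sub>R (z - x)" by (simp add: \<tau>(3) algebra_simps)
    then have "norm (q - x) = \<tau> * norm (z - x)" using \<tau>(1) by simp
    also have "\<dots> \<le> norm (z - x)" using \<tau> by (simp add: mult_left_le_one_le)
    finally have "dist x q \<le> (L + 3) * (2 * \<delta>)" using near by (simp add: dist_norm norm_minus_commute)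
    then have "dist p q < \<delta> + (L + 3) * (2 * \<delta>)"
      using dist_triangle[of p q x] x(2) by simp
    also have "\<dots> = \<epsilon>" using \<delta>(2) by (simp add: algebra_simps)
    finally have q: "q \<in> ball p \<epsilon>" by simp
    have "x \<in> ball p \<epsilon>"
    proof -
      have "\<delta> \<le> \<epsilon>" using \<delta> L by (smt (verit) mult_le_cancel_left1)
      then show ?thesis using x(2) by simp
    qed
    then have fx: "\<gamma> (f x $ 1) < f x $ 2" using \<Omega> x(1) by blast
    have fq: "f q = (1 - \<tau>) *\<^sub>R f x + \<tau> *\<^sub>R f z"
      unfolding \<tau>(3) using lin by (simp add: linear_add linear_scale)
    have "\<gamma> (f q $ 1) - \<gamma> (f x $ 1) \<le> L * \<bar>f q $ 1 - f x $ 1\<bar>"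
      using lipschitz_onD[OF \<gamma>, of "f q $ 1" "f x $ 1"] by (simp add: dist_real_def)
    also have "f q $ 1 - f x $ 1 = \<tau> * (f z $ 1 - f x $ 1)" by (simp add: fq algebra_simps)
    also have "L * \<bar>\<tau> * (f z $ 1 - f x $ 1)\<bar> = \<tau> * (L * \<bar>f z $ 1 - f x $ 1\<bar>)"
      using \<tau>(1) by (simp add: abs_mult)
    also have "\<dots> \<le> \<tau> * (f z $ 2 - f x $ 2)" using up \<tau>(1) by (rule mult_left_mono)
    finally have "\<gamma> (f q $ 1) < f x $ 2 + \<tau> * (f z $ 2 - f x $ 2)" using fx by linarith
    also have "\<dots> = f q $ 2" by (simp add: fq algebra_simps)
    finally show "q \<in> \<Omega>" using \<Omega>[OF q] by blast
  qed
  have "\<bar>u y - u x\<bar> \<le> 2 * C * (L + 3) * norm (y - x)"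
    if x: "x \<in> \<Omega> - N" "x \<in> ball p \<delta>" and y: "y \<in> \<Omega> - N" "y \<in> ball p \<delta>" for x y
  proof (cases "x = y")
    case False
    define d where "d = norm (y - x)"
    have d: "0 < d" using False by (simp add: d_def)
    have "d \<le> dist p x + dist p y"
      using dist_triangle3[of y x p] by (simp add: d_def dist_norm)
    then have d2: "d \<le> 2 * \<delta>" using x(2) y(2) by simp
    \<comment> \<open>The midpoint in chart coordinates, lifted by \<open>(L + 2) * d\<close>. For
      \<open>z\<close> mapped to within \<open>d / 2\<close> of \<open>m\<close>, horizontal offsets
      from \<open>x\<close> and \<open>y\<close> are at most \<open>d\<close> and vertical ones at
      least \<open>(L + 1) * d\<close>, so \<open>z\<close> lies in both cones, at distance at most
      \<open>(L + 3) * d\<close>.\<close>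
    define m where "m = (1/2) *\<^sub>R (f x + f y) + axis 2 ((L + 2) * d)"
    define T where "T = f -` ball m (d / 2)"
    have "continuous_on UNIV f"
      by (rule linear_continuous_on[OF lin[THEN linear_conv_bounded_linear[THEN iffD1]]])
    then have "open T" unfolding T_def by (rule open_vimage[OF open_ball])
    moreover have "T \<noteq> {}"
    proof -
      obtain z where "f z = m" using orthogonal_transformation_surj[OF f] by (metis surjD)
      then have "z \<in> T" using d by (simp add: T_def)
      then show ?thesis by blast
    qed
    ultimately obtain z where z: "z \<in> T" "z \<notin> N"
      using open_not_negligible[of T] negligible_subset[OF assms(4)] by blast
    have join: "\<bar>f z $ 1 - f w $ 1\<bar> \<le> d \<and> (L + 1) * d \<le> f z $ 2 - f w $ 2 \<and> norm (z - w) \<le> (L + 3) * d"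
      if w: "w = x \<or> w = y" for w
    proof -
      have zm: "norm (f z - m) < d / 2" using z(1) by (simp add: T_def dist_norm norm_minus_commute)
      have half: "f x - (1/2) *\<^sub>R (f x + f y) = (1/2) *\<^sub>R (f x - f y)"
        "f y - (1/2) *\<^sub>R (f x + f y) = (1/2) *\<^sub>R (f y - f x)"
        by (simp_all add: vec_eq_iff field_simps)
      have wm: "norm (f w - (1/2) *\<^sub>R (f x + f y)) = d / 2"
        using w
      proof
        assume "w = x"
        then show ?thesis by (simp only: half norm_scaleR fnorm) (simp add: d_def norm_minus_commute)
      next
        assume "w = y"
        then show ?thesis by (simp only: half norm_scaleR fnorm) (simp add: d_def)
      qed
      have c1: "\<bar>(f z - m) $ j\<bar> < d / 2" for j using component_le_norm_cart[of "f z - m" j] zm by linarith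
      have c2: "\<bar>(f w - (1/2) *\<^sub>R (f x + f y)) $ j\<bar> \<le> d / 2" for j
        using component_le_norm_cart[of "f w - (1/2) *\<^sub>R (f x + f y)" j] wm by linarith
      have "f z $ j - f w $ j = (f z - m) $ j - (f w - (1/2) *\<^sub>R (f x + f y)) $ j + axis 2 ((L + 2) * d) $ j" for j
        by (simp add: m_def)
      from this[of 1] this[of 2] have
        "f z $ 1 - f w $ 1 = (f z - m) $ 1 - (f w - (1/2) *\<^sub>R (f x + f y)) $ 1"
        "f z $ 2 - f w $ 2 = (f z - m) $ 2 - (f w - (1/2) *\<^sub>R (f x + f y)) $ 2 + (L + 2) * d"
        by (simp_all add: axis_def)
      moreover have "(L + 2) * d = (L + 1) * d + d" by (simp add: algebra_simps)
      ultimately have "\<bar>f z $ 1 - f w $ 1\<bar> \<le> d" "(L + 1) * d \<le> f z $ 2 - f w $ 2"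
        using c1[of 1] c1[of 2] c2[of 1] c2[of 2] by linarith+
      moreover have "norm (z - w) \<le> (L + 3) * d"
      proof -
        have "f z - f w = (f z - m) - (f w - (1/2) *\<^sub>R (f x + f y)) + axis 2 ((L + 2) * d)"
          by (simp add: m_def)
        note dec = this
        have "norm (f z - f w) \<le> norm (f z - m) + norm (f w - (1/2) *\<^sub>R (f x + f y)) + norm (axis 2 ((L + 2) * d) :: real^2)"
          using norm_triangle_ineq[of "(f z - m) - (f w - (1/2) *\<^sub>R (f x + f y))" "axis 2 ((L + 2) * d)"]
            norm_triangle_ineq4[of "f z - m" "f w - (1/2) *\<^sub>R (f x + f y)"] unfolding dec by linarith
        also have "\<dots> \<le> d / 2 + d / 2 + (L + 2) * d"
          using zm wm L d by (simp add: norm_axis_real)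
        finally show ?thesis by (simp add: fnorm algebra_simps)
      qed
      ultimately show ?thesis by blast
    qed
    have segw: "closed_segment w z \<subseteq> \<Omega>" if w: "w = x \<or> w = y" for w
    proof (rule cone)
      show "w \<in> \<Omega>" "w \<in> ball p \<delta>" using w x y by auto
      have "L * \<bar>f z $ 1 - f w $ 1\<bar> \<le> L * d" using join[OF w] L by (intro mult_left_mono) auto
      also have "\<dots> \<le> f z $ 2 - f w $ 2" using join[OF w] d by (simp add: algebra_simps)
      finally show "L * \<bar>f z $ 1 - f w $ 1\<bar> \<le> f z $ 2 - f w $ 2" .
      have "norm (z - w) \<le> (L + 3) * d" using join[OF w] by blast
      also have "\<dots> \<le> (L + 3) * (2 * \<delta>)" using d2 L by (intro mult_left_mono) auto
      finally show "norm (z - w) \<le> (L + 3) * (2 * \<delta>)" .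
    qed
    have "z \<in> \<Omega> - N" using segw[of x] z(2) by auto
    have uw: "\<bar>u z - u w\<bar> \<le> C * ((L + 3) * d)" if w: "w = x \<or> w = y" for w
    proof -
      have "\<bar>u z - u w\<bar> \<le> C * norm (z - w)"
        using w x(1) y(1) by (intro seg \<open>z \<in> \<Omega> - N\<close> segw) auto
      also have "\<dots> \<le> C * ((L + 3) * d)" using join[OF w] C by (intro mult_left_mono) auto
      finally show ?thesis .
    qed
    have "\<bar>u y - u x\<bar> \<le> \<bar>u z - u x\<bar> + \<bar>u z - u y\<bar>" by linarith
    also have "\<dots> \<le> 2 * C * (L + 3) * d" using uw[of x] uw[of y] by (simp add: algebra_simps)
    finally show ?thesis by (simp add: d_def)
  qed simp
  with \<delta>(1) show ?thesis by blast
qed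

text \<open>Near \<open>p\<close> the function is Lipschitz off \<open>N\<close>: by convexity of a
  ball if \<open>p\<close> is inside, by the chart if \<open>p\<close> is on the boundary. One
  sequence provides the limit by completeness, and \<open>diff0\<close> transfers it to all
  others.\<close>

lemma trace_exists:
  fixes u :: "real^2 \<Rightarrow> real"
  assumes "open \<Omega>" "Lipschitz_boundary \<Omega>" "p \<in> closure \<Omega>" "negligible N" and C: "0 \<le> C"
    and seg: "\<And>x y. x \<in> \<Omega> - N \<Longrightarrow> y \<in> \<Omega> - N \<Longrightarrow> closed_segment x y \<subseteq> \<Omega> \<Longrightarrow> \<bar>u y - u x\<bar> \<le> C * norm (y - x)"
  shows "\<exists>l. \<forall>X. (\<forall>n. X n \<in> \<Omega> - N) \<longrightarrow> X \<longlonglongrightarrow> p \<longrightarrow> (\<lambda>n. u (X n)) \<longlonglongrightarrow> l"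
proof -
  have "\<exists>\<delta>>0. \<exists>C'. \<forall>x\<in>\<Omega> - N. \<forall>y\<in>\<Omega> - N. x \<in> ball p \<delta> \<longrightarrow> y \<in> ball p \<delta> \<longrightarrow>
      \<bar>u y - u x\<bar> \<le> C' * norm (y - x)"
  proof (cases "p \<in> \<Omega>")
    case True
    then obtain \<delta> where \<delta>: "0 < \<delta>" "ball p \<delta> \<subseteq> \<Omega>" using openE[OF assms(1)] by blast
    have "closed_segment x y \<subseteq> \<Omega>" if "x \<in> ball p \<delta>" "y \<in> ball p \<delta>" for x y
      using closed_segment_subset[OF that convex_ball] \<delta>(2) by (rule order_trans)
    then show ?thesis
      using \<delta>(1) by (intro exI[of _ \<delta>] conjI exI[of _ C] ballI impI seg)
  next
    case False
    then have "p \<in> frontier \<Omega>" using assms(1,3) by (simp add: frontier_def interior_open)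
    from Lipschitz_near_frontier[OF assms(1,2) this assms(4) C seg] show ?thesis .
  qed
  then obtain \<delta> C' where \<delta>: "0 < \<delta>" and C': "\<And>x y. x \<in> \<Omega> - N \<Longrightarrow> y \<in> \<Omega> - N \<Longrightarrow> x \<in> ball p \<delta> \<Longrightarrow>
      y \<in> ball p \<delta> \<Longrightarrow> \<bar>u y - u x\<bar> \<le> C' * norm (y - x)" by blast
  have ev: "\<forall>\<^sub>F n in sequentially. X n \<in> ball p \<delta>" if "X \<longlonglongrightarrow> p" for X
    using tendstoD[OF that \<delta>] by (simp add: dist_commute)
  have "p \<in> closure (\<Omega> - N)"
    using assms(3) closure_minimal[OF open_subset_closure_Diff_negligible[OF assms(1,4)] closed_closure] by blast
  then obtain X0 where X0: "\<And>n. X0 n \<in> \<Omega> - N" "X0 \<longlonglongrightarrow> p"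
    unfolding closure_sequential by blast
  have diff0: "(\<lambda>n. u (X n) - u (Y n)) \<longlonglongrightarrow> 0"
    if "\<And>n. X n \<in> \<Omega> - N" "X \<longlonglongrightarrow> p" "\<And>n. Y n \<in> \<Omega> - N" "Y \<longlonglongrightarrow> p" for X Y
  proof (rule Lim_null_comparison)
    show "\<forall>\<^sub>F n in sequentially. norm (u (X n) - u (Y n)) \<le> C' * norm (X n - Y n)"
      using ev[OF that(2)] ev[OF that(4)]
    proof eventually_elim
      case (elim n)
      then show ?case using C'[OF that(3) that(1)] by simp
    qed
    have "(\<lambda>n. C' * norm (X n - Y n)) \<longlonglongrightarrow> C' * norm (p - p)"
      by (intro tendsto_intros that)
    then show "(\<lambda>n. C' * norm (X n - Y n)) \<longlonglongrightarrow> 0" by simp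
  qed
  have "Cauchy (\<lambda>n. u (X0 n))"
  proof (rule metric_CauchyI)
    fix e :: real assume e: "e > 0"
    \<comment> \<open>\<open>C'\<close> comes without a sign, so a positive majorant takes its
      place.\<close>
    define c where "c = e / (\<bar>C'\<bar> + 1)"
    have c: "c > 0" using e by (simp add: c_def add_nonneg_pos)
    have "Cauchy X0" using X0(2) LIMSEQ_imp_Cauchy by blast
    then obtain M1 where M1: "\<And>m n. m \<ge> M1 \<Longrightarrow> n \<ge> M1 \<Longrightarrow> dist (X0 m) (X0 n) < c"
      using c unfolding Cauchy_def by blast
    obtain M2 where M2: "\<And>n. n \<ge> M2 \<Longrightarrow> X0 n \<in> ball p \<delta>"
      using ev[OF X0(2)] unfolding eventually_sequentially by blast
    have "dist (u (X0 m)) (u (X0 n)) < e" if "m \<ge> max M1 M2" "n \<ge> max M1 M2" for m n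
    proof -
      have "dist (u (X0 m)) (u (X0 n)) \<le> C' * norm (X0 m - X0 n)"
        using C'[OF X0(1) X0(1) M2 M2, of n m] that by (simp add: dist_real_def)
      also have "\<dots> \<le> (\<bar>C'\<bar> + 1) * norm (X0 m - X0 n)" by (intro mult_right_mono) auto
      also have "\<dots> < (\<bar>C'\<bar> + 1) * c"
        using M1[of m n] that by (intro mult_strict_left_mono) (auto simp: dist_norm)
      also have "\<dots> = e" by (simp add: c_def)
      finally show ?thesis .
    qed
    then show "\<exists>M. \<forall>m\<ge>M. \<forall>n\<ge>M. dist (u (X0 m)) (u (X0 n)) < e" by blast
  qed
  then obtain l where l: "(\<lambda>n. u (X0 n)) \<longlonglongrightarrow> l" using real_Cauchy_convergent convergent_def by blast
  have "(\<lambda>n. u (X n)) \<longlonglongrightarrow> l" if "\<forall>n. X n \<in> \<Omega> - N" "X \<longlonglongrightarrow> p" for X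
    using tendsto_add[OF diff0[OF _ that(2) X0] l] that(1) by simp
  then show ?thesis by blast
qed

section \<open>Triangles and interpolation\<close>

lemma simplex_vertices:
  assumes "2 simplex K"
  shows "K = convex hull (vertices K)" "\<not> affine_dependent (vertices K)" "card (vertices K) = 3"
proof -
  obtain C where C: "\<not> affine_dependent C" "int (card C) = 2 + 1" "K = convex hull C"
    using assms unfolding simplex_def by blast
  have "vertices K = C"
    unfolding vertices_def C(3) using extreme_point_of_convex_hull_affine_independent[OF C(1)] by blast
  with C show "K = convex hull (vertices K)" "\<not> affine_dependent (vertices K)" "card (vertices K) = 3"
    by auto
qed

lemma simplex_interior_nonempty:
  fixes K :: "(real^2) set"
  assumes "2 simplex K"
  shows "interior K \<noteq> {}"
proof -
  have "interior (convex hull (vertices K)) \<noteq> {}"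
    using interior_convex_hull_eq_empty[of "vertices K"] simplex_vertices(2,3)[OF assms] by simp
  then show ?thesis using simplex_vertices(1)[OF assms] by simp
qed

lemma labelled_vertices:
  assumes "2 simplex K" "{a, b, c} = vertices K"
  shows "a \<noteq> b" "a \<noteq> c" "b \<noteq> c" "a \<in> K" "b \<in> K" "c \<in> K" "\<not> collinear {a, b, c}"
proof -
  have card: "card {a, b, c} = 3" using assms simplex_vertices(3) by simp
  then show ne: "a \<noteq> b" "a \<noteq> c" "b \<noteq> c" by (auto simp: card_insert_if split: if_splits)
  show "a \<in> K" "b \<in> K" "c \<in> K"
    using assms(2) by (auto simp: vertices_def extreme_point_of_def)
  have "\<not> affine_dependent {a, b, c}"
    unfolding assms(2) by (rule simplex_vertices(2)[OF assms(1)])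
  then show "\<not> collinear {a, b, c}"
    using ne by (simp add: collinear_3_eq_affine_dependent)
qed

text \<open>Specific to the plane: the Gram determinant of two vectors and the products with them
  determine the length of \<open>G\<close>. It turns information on two edges into a bound for a
  gradient.\<close>

lemma gram_identity:
  fixes G e f :: "real^2"
  shows "(G \<bullet> G) * ((e \<bullet> e) * (f \<bullet> f) - (e \<bullet> f)\<^sup>2) =
    (G \<bullet> e)\<^sup>2 * (f \<bullet> f) + (G \<bullet> f)\<^sup>2 * (e \<bullet> e) - 2 * (G \<bullet> e) * (G \<bullet> f) * (e \<bullet> f)"
  unfolding inner_vec_def sum_2 inner_real_def by algebra

text \<open>A vanishing Gram determinant is the equality case of the Cauchy-Schwarz
  inequality.\<close>

lemma not_collinear_gram:
  fixes a b c :: "real^2"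
  assumes "\<not> collinear {a, b, c}"
  shows "((b - a) \<bullet> (b - a)) * ((c - a) \<bullet> (c - a)) - ((b - a) \<bullet> (c - a))\<^sup>2 \<noteq> 0"
proof
  let ?e = "b - a" and ?f = "c - a"
  assume "(?e \<bullet> ?e) * (?f \<bullet> ?f) - (?e \<bullet> ?f)\<^sup>2 = 0"
  then have "\<bar>?e \<bullet> ?f\<bar>\<^sup>2 = (norm ?e * norm ?f)\<^sup>2"
    by (simp add: power_mult_distrib power2_norm_eq_inner)
  then have "\<bar>?e \<bullet> ?f\<bar> = norm ?e * norm ?f"
    by (rule power2_eq_imp_eq) auto
  then have "collinear {0, ?e, ?f}" by (simp add: norm_cauchy_schwarz_equal)
  moreover have "collinear {b, a, c} \<longleftrightarrow> collinear {0, ?e, ?f}"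
    by (rule collinear_3) (simp add: NO_MATCH_def)
  moreover have "{b, a, c} = {a, b, c}" by blast
  ultimately show False using assms by simp
qed

lemma orthogonal_to_edges_eq_0:
  fixes a b c :: "real^2"
  assumes "\<not> collinear {a, b, c}" "G \<bullet> (b - a) = 0" "G \<bullet> (c - a) = 0"
  shows "G = 0"
  using gram_identity[of G "b - a" "c - a"] not_collinear_gram[OF assms(1)] assms(2,3) by simp

lemma affine_interpolation:
  fixes a b c :: "real^2" and \<alpha> \<beta> \<gamma> :: real
  assumes "\<not> collinear {a, b, c}"
  shows "\<exists>G k. G \<bullet> a + k = \<alpha> \<and> G \<bullet> b + k = \<beta> \<and> G \<bullet> c + k = \<gamma>"
proof -
  let ?e = "b - a" and ?f = "c - a"
  define E F H D where EF: "E = ?e \<bullet> ?e" "F = ?f \<bullet> ?f" "H = ?e \<bullet> ?f" "D = E * F - H\<^sup>2"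
  have D: "D \<noteq> 0" using not_collinear_gram[OF assms] by (simp add: EF)
  \<comment> \<open>Cramer's rule for the Gram system satisfied by the coefficients of
    \<open>G\<close> in the two edge vectors.\<close>
  define s t where st: "s = ((\<beta> - \<alpha>) * F - (\<gamma> - \<alpha>) * H) / D" "t = ((\<gamma> - \<alpha>) * E - (\<beta> - \<alpha>) * H) / D"
  define G where "G = s *\<^sub>R ?e + t *\<^sub>R ?f"
  have "G \<bullet> ?e = s * E + t * H" "G \<bullet> ?f = s * H + t * F"
    unfolding G_def inner_add_left inner_scaleR_left EF by (simp_all add: inner_commute)
  moreover have "s * E + t * H = \<beta> - \<alpha>"
  proof -
    have "s * E + t * H = (\<beta> - \<alpha>) * (E * F - H\<^sup>2) / D"
      unfolding st by (simp add: add_divide_distrib[symmetric] power2_eq_square algebra_simps)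
    then show ?thesis using D EF(4) by simp
  qed
  moreover have "s * H + t * F = \<gamma> - \<alpha>"
  proof -
    have "s * H + t * F = (\<gamma> - \<alpha>) * (E * F - H\<^sup>2) / D"
      unfolding st by (simp add: add_divide_distrib[symmetric] power2_eq_square algebra_simps)
    then show ?thesis using D EF(4) by simp
  qed
  ultimately have "G \<bullet> ?e = \<beta> - \<alpha>" "G \<bullet> ?f = \<gamma> - \<alpha>" by simp_all
  then show ?thesis
    by (intro exI[of _ G] exI[of _ "\<alpha> - G \<bullet> a"]) (simp add: inner_diff_right)
qed

section \<open>Angles of a triangle and the size of a gradient\<close>

definition cos_at :: "real^2 \<Rightarrow> real^2 \<Rightarrow> real^2 \<Rightarrow> real" where
  "cos_at a b c = ((b - a) \<bullet> (c - a)) / (norm (b - a) * norm (c - a))"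

lemma cos_at_bounds: "- 1 \<le> cos_at a b c" "cos_at a b c \<le> 1"
proof -
  have "\<bar>cos_at a b c\<bar> \<le> 1"
  proof (cases "b = a \<or> c = a")
    case False
    then have "0 < norm (b - a) * norm (c - a)" by simp
    then show ?thesis
      unfolding cos_at_def abs_divide using Cauchy_Schwarz_ineq2[of "b - a" "c - a"]
      by (simp add: pos_divide_le_eq)
  qed (auto simp: cos_at_def)
  then show "- 1 \<le> cos_at a b c" "cos_at a b c \<le> 1" by linarith+
qed

lemma angle_at_eq: "angle_at a b c = arccos (cos_at a b c)"
  by (simp add: angle_at_def cos_at_def)

text \<open>With \<open>s\<close>, \<open>t\<close> the components of \<open>G\<close> along the
  unit edge directions and \<open>q\<close> the cosine, the Gram identity becomes \<open>(norm
  G)\<^sup>2 * (1 - q\<^sup>2) = s\<^sup>2 + t\<^sup>2 - 2 * (s * t) * q\<close>, and each of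
  \<open>s\<close>, \<open>t\<close> is at most \<Lambda> in absolute value. The factor on the left
  is the squared sine of the angle at \<open>a\<close>.\<close>

lemma gradient_bound:
  fixes a b c G :: "real^2"
  assumes ne: "a \<noteq> b" "a \<noteq> c" and \<Lambda>: "0 \<le> \<Lambda>"
    and "\<bar>G \<bullet> (b - a)\<bar> \<le> \<Lambda> * norm (b - a)" "\<bar>G \<bullet> (c - a)\<bar> \<le> \<Lambda> * norm (c - a)"
  shows "(norm G)\<^sup>2 * (1 - (cos_at a b c)\<^sup>2) \<le> 4 * \<Lambda>\<^sup>2"
proof -
  let ?e = "b - a" and ?f = "c - a"
  define x y q where xyq: "x = norm ?e" "y = norm ?f" "q = cos_at a b c"
  have pos: "0 < x" "0 < y" using ne by (auto simp: xyq)
  have ef: "?e \<bullet> ?f = q * (x * y)" using pos by (simp add: xyq cos_at_def)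
  have q: "\<bar>q\<bar> \<le> 1" using cos_at_bounds[of a b c] by (auto simp: xyq)
  define s t where st: "s = (G \<bullet> ?e) / x" "t = (G \<bullet> ?f) / y"
  have s: "\<bar>s\<bar> \<le> \<Lambda>" "\<bar>t\<bar> \<le> \<Lambda>" using assms(4,5) pos by (auto simp: st abs_mult pos_divide_le_eq xyq)
  have "(norm G)\<^sup>2 * (x\<^sup>2 * y\<^sup>2 - (q * (x * y))\<^sup>2) = (s * x)\<^sup>2 * y\<^sup>2 + (t * y)\<^sup>2 * x\<^sup>2 - 2 * (s * x) * (t * y) * (q * (x * y))"
    using gram_identity[of G ?e ?f] pos unfolding ef
    by (simp add: power2_norm_eq_inner[symmetric] xyq[symmetric] st)
  then have "((norm G)\<^sup>2 * (1 - q\<^sup>2)) * (x * y)\<^sup>2 = (s\<^sup>2 + t\<^sup>2 - 2 * (s * t) * q) * (x * y)\<^sup>2"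
    by (simp add: power_mult_distrib algebra_simps power2_eq_square)
  then have id: "(norm G)\<^sup>2 * (1 - q\<^sup>2) = s\<^sup>2 + t\<^sup>2 - 2 * (s * t) * q" using pos by simp
  have s2: "s\<^sup>2 \<le> \<Lambda>\<^sup>2" "t\<^sup>2 \<le> \<Lambda>\<^sup>2" using s \<Lambda> by (simp_all add: abs_le_square_iff[symmetric])
  have "\<bar>s * t * q\<bar> \<le> \<Lambda> * \<Lambda> * 1"
    unfolding abs_mult using s q \<Lambda> by (intro mult_mono) auto
  then have "- 2 * (s * t) * q \<le> 2 * \<Lambda>\<^sup>2" by (simp add: power2_eq_square abs_le_iff mult_ac)
  with id s2 show ?thesis unfolding xyq(3) by linarith
qed

text \<open>By the law of cosines \<open>2 * ((y - x) \<bullet> (z - x))\<close> is the sum of the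
  squares of the adjacent sides minus that of the longest; this is at most the square of the shorter
  adjacent side, hence at most their product.\<close>

lemma cos_opposite_longest_side:
  assumes "dist x y \<le> dist y z" "dist x z \<le> dist y z"
  shows "cos_at x y z \<le> 1 / 2"
proof (cases "x = y \<or> x = z")
  case True
  then show ?thesis by (auto simp: cos_at_def)
next
  case False
  define p q l where pql: "p = norm (y - x)" "q = norm (z - x)" "l = norm (y - z)"
  have pos: "0 < p" "0 < q" using False by (auto simp: pql)
  have "p \<le> l" "q \<le> l" using assms by (simp_all add: pql dist_norm norm_minus_commute)
  have "l\<^sup>2 = p\<^sup>2 + q\<^sup>2 - 2 * ((y - x) \<bullet> (z - x))"
    unfolding pql power2_norm_eq_inner by (simp add: inner_diff_left inner_diff_right inner_commute)
  moreover have "p\<^sup>2 \<le> l\<^sup>2" "q\<^sup>2 \<le> l\<^sup>2" using \<open>p \<le> l\<close> \<open>q \<le> l\<close> pos by simp_all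
  moreover have "min p q * min p q \<le> p * q" using pos by (intro mult_mono) auto
  ultimately have "2 * ((y - x) \<bullet> (z - x)) \<le> p * q"
    by (auto simp: min_def power2_eq_square split: if_splits)
  then show ?thesis using pos by (simp add: cos_at_def pql[symmetric] pos_divide_le_eq)
qed

lemma max_angle_ge:
  assumes "2 simplex K" "{a, b, c} = vertices K"
  shows "angle_at a b c \<le> max_angle K"
proof -
  have fin: "finite (vertices K)" using assms(2) by (metis finite.emptyI finite.insertI)
  let ?S = "{angle_at a b c |a b c. {a, b, c} = vertices K}"
  have "?S \<subseteq> (\<lambda>(a, b, c). angle_at a b c) ` (vertices K \<times> vertices K \<times> vertices K)" by force
  then have "finite ?S" using fin by (meson finite_SigmaI finite_imageI finite_subset)
  moreover have "angle_at a b c \<in> ?S" using assms(2) by blast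
  ultimately show ?thesis unfolding max_angle_def by (rule Max_ge)
qed

text \<open>The largest angle is at least pi/3: otherwise all three cosines would exceed 1/2, since
  \<open>arccos\<close> is decreasing, contradicting the bound at the vertex opposite a longest
  side.\<close>

lemma cos_at_max_angle:
  assumes "2 simplex K" "max_angle_labelling K a b c"
  shows "cos_at a b c \<le> 1 / 2"
proof (rule ccontr)
  assume gt: "\<not> ?thesis"
  have V: "{a, b, c} = vertices K" and max: "angle_at a b c = max_angle K"
    using assms(2) by (auto simp: max_angle_labelling_def)
  have all: "1 / 2 < cos_at x y z" if "{x, y, z} = vertices K" for x y z
  proof -
    have "arccos (cos_at x y z) \<le> arccos (cos_at a b c)"
      using max_angle_ge[OF assms(1) that] by (simp add: max[symmetric] angle_at_eq)
    then have "cos_at a b c \<le> cos_at x y z"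
      using cos_at_bounds by (subst (asm) arccos_le_mono) (auto simp: abs_le_iff minus_le_iff)
    with gt show ?thesis by linarith
  qed
  have "dist a b \<le> dist b c \<and> dist a c \<le> dist b c
      \<or> dist b a \<le> dist a c \<and> dist b c \<le> dist a c
      \<or> dist c a \<le> dist a b \<and> dist c b \<le> dist a b"
    using dist_commute[of b a] dist_commute[of c a] dist_commute[of c b] by linarith
  then consider "dist a b \<le> dist b c \<and> dist a c \<le> dist b c"
    | "dist b a \<le> dist a c \<and> dist b c \<le> dist a c"
    | "dist c a \<le> dist a b \<and> dist c b \<le> dist a b"
    by blast
  then show False
  proof cases
    case 1
    then show False using cos_opposite_longest_side[of a b c] all[OF V] by linarith
  next
    case 2
    have "{b, a, c} = vertices K" using V by blast
    then show False using 2 cos_opposite_longest_side[of b a c] all[of b a c] by linarith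
  next
    case 3
    have "{c, a, b} = vertices K" using V by blast
    then show False using 3 cos_opposite_longest_side[of c a b] all[of c a b] by linarith
  qed
qed

text \<open>A lower bound for the squared sine of a maximum angle: \<open>3 / 4\<close> is its value
  at pi/3, the least possible maximum angle, and the other term its value at \<alpha>.\<close>

definition angle_const :: "real \<Rightarrow> real" where
  "angle_const \<alpha> = min (3 / 4) (1 - (cos \<alpha>)\<^sup>2)"

text \<open>A nonnegative cosine is controlled by the lower bound pi/3 for the angle, a negative one
  by the upper bound \<alpha>. Positivity of the constant uses the given triangle: its angle forces
  \<alpha> to be positive, which \<open>\<alpha> < pi\<close> alone does not.\<close>

lemma sin_max_angle_ge:
  assumes "2 simplex K" "max_angle_labelling K a b c" "max_angle K \<le> \<alpha>" "\<alpha> < pi"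
  shows "0 < angle_const \<alpha>" "angle_const \<alpha> \<le> 1 - (cos_at a b c)\<^sup>2"
proof -
  let ?q = "cos_at a b c"
  have ac: "arccos ?q \<le> \<alpha>" using assms(2,3) by (simp add: max_angle_labelling_def angle_at_eq)
  have q: "?q \<le> 1 / 2" by (rule cos_at_max_angle[OF assms(1,2)])
  have lb: "0 < arccos ?q"
  proof -
    have "arccos 1 < arccos ?q" using q cos_at_bounds[of a b c] by (intro arccos_less_arccos) auto
    then show ?thesis by simp
  qed
  then have \<alpha>: "0 < \<alpha>" using ac by linarith
  have "cos \<alpha> \<le> cos (arccos ?q)" using lb ac assms(4) by (intro cos_monotone_0_pi_le) auto
  also have "\<dots> = ?q" using cos_at_bounds by (simp add: cos_arccos)
  finally have le: "cos \<alpha> \<le> ?q" .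
  have gt: "- 1 < cos \<alpha>" using cos_monotone_0_pi[of \<alpha> pi] \<alpha> assms(4) by simp
  have "cos \<alpha> < 1" using le q by linarith
  then have "\<bar>cos \<alpha>\<bar> < 1" using gt by linarith
  then have "(cos \<alpha>)\<^sup>2 < 1" by (simp add: abs_square_less_1)
  then show "0 < angle_const \<alpha>" by (simp add: angle_const_def)
  show "angle_const \<alpha> \<le> 1 - ?q\<^sup>2"
  proof (cases "0 \<le> ?q")
    case True
    then have "?q\<^sup>2 \<le> (1 / 2)\<^sup>2" using q by (intro power_mono) auto
    then show ?thesis by (simp add: angle_const_def power2_eq_square)
  next
    case False
    then have "\<bar>?q\<bar> \<le> \<bar>cos \<alpha>\<bar>" using le by linarith
    then have "?q\<^sup>2 \<le> (cos \<alpha>)\<^sup>2" by (simp add: abs_le_square_iff)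
    then show ?thesis by (simp add: angle_const_def)
  qed
qed

text \<open>McShane's extension: the lower envelope of cones of slope \<open>M\<close> over the
  data. Data are pairs so that a point may be listed repeatedly; for equal points the hypothesis
  forces equal values.\<close>

lemma finite_Lipschitz_extension:
  fixes R :: "('a::metric_space \<times> real) set"
  assumes "finite R" "0 \<le> M"
    and R: "\<And>p s q t. (p, s) \<in> R \<Longrightarrow> (q, t) \<in> R \<Longrightarrow> s - t \<le> M * dist p q"
  obtains w where "\<And>x y. \<bar>w x - w y\<bar> \<le> M * dist x y" "\<And>p s. (p, s) \<in> R \<Longrightarrow> w p = s"
proof (cases "R = {}")
  case True
  show thesis by (rule that[of "\<lambda>_. 0"]) (use True assms(2) in auto)
next
  case False
  define W where "W x = (\<lambda>(p, s). s + M * dist x p) ` R" for x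
  have W: "finite (W x)" "W x \<noteq> {}" for x using assms(1) False by (auto simp: W_def)
  have le: "Min (W x) \<le> Min (W y) + M * dist x y" for x y
  proof -
    obtain p s where ps: "(p, s) \<in> R" "Min (W y) = s + M * dist y p"
      using Min_in[OF W, of y] by (auto simp: W_def)
    have "Min (W x) \<le> s + M * dist x p"
      using ps(1) by (intro Min_le W) (auto simp: W_def)
    also have "\<dots> \<le> s + M * (dist x y + dist y p)"
      using assms(2) dist_triangle by (intro add_left_mono mult_left_mono) auto
    finally show ?thesis by (simp add: ps(2) algebra_simps)
  qed
  show thesis
  proof (rule that[of "\<lambda>x. Min (W x)"])
    show "\<bar>Min (W x) - Min (W y)\<bar> \<le> M * dist x y" for x y
      using le[of x y] le[of y x] by (simp add: dist_commute abs_le_iff)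
    show "Min (W p) = s" if ps: "(p, s) \<in> R" for p s
    proof (rule Min_eqI[OF W(1)])
      show "s \<in> W p" using ps by (force simp: W_def)
      show "s \<le> z" if z: "z \<in> W p" for z
      proof -
        obtain q t where "(q, t) \<in> R" "z = t + M * dist p q" using z by (auto simp: W_def)
        then show ?thesis using R[OF ps \<open>(q, t) \<in> R\<close>] by simp
      qed
    qed
  qed
qed

text \<open>The common face is the convex hull of its extreme points, which are vertices of both
  triangles. The two affine functions agree at these, and the set where they agree is
  convex.\<close>

lemma conforming_affine_agree:
  fixes a :: "(real^2) set \<Rightarrow> real^2"
  assumes conf: "conforming_triangulation \<Omega> \<T>"
    and val: "\<And>K p. K \<in> \<T> \<Longrightarrow> p \<in> vertices K \<Longrightarrow> a K \<bullet> p + b K = val p"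
    and K: "K \<in> \<T>" "K' \<in> \<T>" "x \<in> K" "x \<in> K'"
  shows "a K \<bullet> x + b K = a K' \<bullet> x + b K'"
proof -
  have tri: "triangulation \<T>" using conf by (simp add: conforming_triangulation_def)
  let ?F = "K \<inter> K'"
  have face: "?F face_of K" using tri K(1,2) unfolding triangulation_def by blast
  have "K' \<inter> K face_of K'" using tri K(1,2) unfolding triangulation_def by blast
  then have face': "?F face_of K'" by (simp add: Int_commute)
  have "compact ?F" "convex ?F"
    using conforming_triangulation_compact_convex[OF conf] K(1,2)
    by (auto intro: compact_Int convex_Int)
  then have F: "?F = convex hull {p. p extreme_point_of ?F}" by (rule Krein_Milman_Minkowski)
  let ?H = "{z. (a K - a K') \<bullet> z = b K' - b K}"
  have "{p. p extreme_point_of ?F} \<subseteq> ?H"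
  proof
    fix p assume "p \<in> {p. p extreme_point_of ?F}"
    then have "p \<in> vertices K" "p \<in> vertices K'"
      using extreme_point_of_face[OF face] extreme_point_of_face[OF face'] by (auto simp: vertices_def)
    then have "a K \<bullet> p + b K = a K' \<bullet> p + b K'" using val K(1,2) by metis
    then show "p \<in> ?H" by (simp add: inner_diff_left algebra_simps)
  qed
  then have "convex hull {p. p extreme_point_of ?F} \<subseteq> ?H"
    by (rule hull_minimal) (rule convex_hyperplane)
  with F K(3,4) have "x \<in> ?H" by blast
  then show ?thesis by (simp add: inner_diff_left algebra_simps)
qed

text \<open>Agreement on common faces makes the choice of triangle in the definition of
  \<open>v\<close> immaterial, and finitely many closed pieces glue to a continuous
  function.\<close>

lemma nodal_interpolant:
  assumes conf: "conforming_triangulation \<Omega> \<T>"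
  obtains v a b where "continuous_on (closure \<Omega>) v"
    "\<And>K x. K \<in> \<T> \<Longrightarrow> x \<in> K \<Longrightarrow> v x = a K \<bullet> x + b K"
    "\<And>K p. K \<in> \<T> \<Longrightarrow> p \<in> vertices K \<Longrightarrow> v p = val p"
proof -
  have fin: "finite \<T>" and cov: "\<Union>\<T> = closure \<Omega>"
    using conf by (auto simp: conforming_triangulation_def triangulation_def)
  have "\<exists>G k. \<forall>p\<in>vertices K. G \<bullet> p + k = val p" if "K \<in> \<T>" for K
  proof -
    have s: "2 simplex K" using conf that unfolding conforming_triangulation_def by blast
    obtain x y z where xyz: "vertices K = {x, y, z}"
      using simplex_vertices(3)[OF s] unfolding card_3_iff by blast
    then have "\<not> collinear {x, y, z}" using labelled_vertices(7)[OF s] by simp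
    from affine_interpolation[OF this, of "val x" "val y" "val z"] show ?thesis unfolding xyz by auto
  qed
  then obtain a b where ab: "\<And>K p. K \<in> \<T> \<Longrightarrow> p \<in> vertices K \<Longrightarrow> a K \<bullet> p + b K = val p"
    by metis
  define v where "v x = (let K = SOME K. K \<in> \<T> \<and> x \<in> K in a K \<bullet> x + b K)" for x
  have v: "v x = a K \<bullet> x + b K" if "K \<in> \<T>" "x \<in> K" for K x
  proof -
    let ?K = "SOME K. K \<in> \<T> \<and> x \<in> K"
    have "?K \<in> \<T> \<and> x \<in> ?K" by (rule someI[of _ K]) (use that in blast)
    then show ?thesis unfolding v_def Let_def
      using conforming_affine_agree[OF conf, of a b val, OF ab] that by blast
  qed
  show thesis
  proof
    have "continuous_on (\<Union>K\<in>\<T>. K) v"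
    proof (rule continuous_on_closed_Union[OF fin])
      show "closed K" if "K \<in> \<T>" for K
        using conforming_triangulation_compact_convex(1)[OF conf that] by (rule compact_imp_closed)
      show "continuous_on K v" if "K \<in> \<T>" for K
      proof -
        have "continuous_on K (\<lambda>x. a K \<bullet> x + b K)" by (intro continuous_intros)
        then show ?thesis by (rule continuous_on_eq) (simp add: v[OF that])
      qed
    qed
    then show "continuous_on (closure \<Omega>) v" using cov by simp
    show "v x = a K \<bullet> x + b K" if "K \<in> \<T>" "x \<in> K" for K x by (rule v[OF that])
    show "v p = val p" if "K \<in> \<T>" "p \<in> vertices K" for K p
      using v[OF that(1), of p] ab[OF that] that(2) by (simp add: vertices_def extreme_point_of_def)
  qed
qed

text \<open>\<open>u\<close> is the trace of the function to be approximated and \<open>G K\<close> a frozen value of its gradient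
  on \<open>K\<close>. Only the values at the vertices \<open>A K\<close> of large-angle triangles need a correction; the
  separation assumptions say precisely that these corrections form a Lipschitz function on the
  finite set of all \<open>A K\<close>, \<open>B K\<close>, \<open>D K\<close>.\<close>

lemma corrected_interpolant:
  fixes A B D :: "(real^2) set \<Rightarrow> real^2"
  assumes conf: "conforming_triangulation \<Omega> \<T>" and \<alpha>: "\<alpha> < pi" and \<Lambda>: "0 \<le> \<Lambda>"
    and lab: "\<And>K. K \<in> \<T> \<Longrightarrow> max_angle_labelling K (A K) (B K) (D K)"
    and r: "\<And>K. K \<in> \<T> \<Longrightarrow> r K = 1/2 * min (dist (A K) (B K)) (dist (A K) (D K))"
    and sep: "\<And>K K'. K \<in> large_angle_part \<alpha> \<T> \<Longrightarrow> K' \<in> large_angle_part \<alpha> \<T> \<Longrightarrow> K \<noteq> K' \<Longrightarrow>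
      dist (A K) (A K') \<ge> r K + r K'"
    and sep': "\<And>K K'. K \<in> large_angle_part \<alpha> \<T> \<Longrightarrow> K' \<in> large_angle_part \<alpha> \<T> \<Longrightarrow>
      dist (A K) (B K') \<ge> r K \<and> dist (A K) (D K') \<ge> r K"
    and osc: "\<And>K p q. K \<in> \<T> \<Longrightarrow> p \<in> K \<Longrightarrow> q \<in> K \<Longrightarrow>
      \<bar>u q - u p - G K \<bullet> (q - p)\<bar> \<le> \<Lambda> * norm (q - p)"
  obtains v a b where "continuous_on (closure \<Omega>) v"
    "\<And>K x. K \<in> \<T> \<Longrightarrow> x \<in> K \<Longrightarrow> v x = a K \<bullet> x + b K"
    "\<And>K. K \<in> \<T> \<Longrightarrow> norm (a K - G K) \<le> max 1 (10 / sqrt (angle_const \<alpha>)) * \<Lambda>"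
proof -
  let ?L = "large_angle_part \<alpha> \<T>"
  have fin: "finite \<T>" using conf by (simp add: conforming_triangulation_def triangulation_def)
  have L\<T>: "K \<in> \<T>" if "K \<in> ?L" for K using that by (simp add: large_angle_part_def)
  have finL: "finite ?L" using fin by (simp add: large_angle_part_def)
  have simp2: "2 simplex K" if "K \<in> \<T>" for K
    using conf that unfolding conforming_triangulation_def by blast
  have V: "{A K, B K, D K} = vertices K" if "K \<in> \<T>" for K
    using lab[OF that] by (simp add: max_angle_labelling_def)
  note vert = labelled_vertices[OF simp2 V]
  text \<open>On a large-angle triangle the target gradient \<open>c K\<close> matches \<open>u\<close> on the longest edge and
    \<open>G K\<close> in the normal direction; \<open>\<delta> K\<close> is the change of the value at \<open>A K\<close> that this requires.\<close>
  define c where "c K = G K + ((u (D K) - u (B K) - G K \<bullet> (D K - B K)) / (norm (D K - B K))\<^sup>2) *\<^sub>R (D K - B K)" for K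
  define \<delta> where "\<delta> K = u (B K) + c K \<bullet> (A K - B K) - u (A K)" for K
  have cG: "norm (c K - G K) \<le> \<Lambda>" if K: "K \<in> \<T>" for K
  proof -
    let ?n = "norm (D K - B K)"
    have n: "0 < ?n" using vert(3)[OF K K] by simp
    have "norm (c K - G K) = \<bar>u (D K) - u (B K) - G K \<bullet> (D K - B K)\<bar> / ?n"
      using n by (simp add: c_def power2_eq_square)
    also have "\<dots> \<le> \<Lambda>" using osc[OF K vert(5)[OF K K] vert(6)[OF K K]] n by (simp add: pos_divide_le_eq)
    finally show ?thesis .
  qed
  have cDB: "c K \<bullet> (D K - B K) = u (D K) - u (B K)" if K: "K \<in> \<T>" for K
  proof -
    have "(norm (D K - B K))\<^sup>2 \<noteq> 0" using vert(3)[OF K K] by simp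
    then show ?thesis by (simp add: c_def inner_add_left power2_norm_eq_inner)
  qed
  \<comment> \<open>One \<Lambda> comes from replacing \<open>G K\<close> by \<open>c K\<close>, the
    other from the oscillation of \<open>u\<close>.\<close>
  have edge: "\<bar>u q + c K \<bullet> (p - q) - u p\<bar> \<le> 2 * \<Lambda> * dist p q" if K: "K \<in> \<T>" and pq: "p \<in> K" "q \<in> K" for K p q
  proof -
    have "\<bar>(c K - G K) \<bullet> (p - q)\<bar> \<le> norm (c K - G K) * norm (p - q)" by (rule Cauchy_Schwarz_ineq2)
    also have "\<dots> \<le> \<Lambda> * norm (p - q)" using cG[OF K] by (intro mult_right_mono) auto
    finally have 1: "\<bar>(c K - G K) \<bullet> (p - q)\<bar> \<le> \<Lambda> * dist p q" by (simp add: dist_norm)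
    have 2: "\<bar>u p - u q - G K \<bullet> (p - q)\<bar> \<le> \<Lambda> * dist p q" using osc[OF K pq(2,1)] by (simp add: dist_norm)
    have "u q + c K \<bullet> (p - q) - u p = (c K - G K) \<bullet> (p - q) - (u p - u q - G K \<bullet> (p - q))"
      by (simp add: inner_diff_left)
    with 1 2 show ?thesis by (simp add: abs_le_iff)
  qed
  have \<delta>: "\<bar>\<delta> K\<bar> \<le> 4 * \<Lambda> * r K" if K: "K \<in> \<T>" for K
  proof -
    have "\<bar>\<delta> K\<bar> \<le> 2 * \<Lambda> * dist (A K) (B K)"
      unfolding \<delta>_def by (rule edge[OF K vert(4)[OF K K] vert(5)[OF K K]])
    \<comment> \<open>As \<open>c K\<close> reproduces \<open>u\<close> along the edge from
      \<open>B K\<close> to \<open>D K\<close>, the change can be measured from either end, hence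
      against the shorter adjacent edge. That edge has length \<open>2 * r K\<close>, so 2\<Lambda>
      becomes 4\<Lambda>.\<close>
    moreover have "\<delta> K = u (D K) + c K \<bullet> (A K - D K) - u (A K)"
      using cDB[OF K] by (simp add: \<delta>_def inner_diff_right)
    then have "\<bar>\<delta> K\<bar> \<le> 2 * \<Lambda> * dist (A K) (D K)"
      using edge[OF K vert(4)[OF K K] vert(6)[OF K K]] by simp
    ultimately show ?thesis by (auto simp: r[OF K] min_def)
  qed
  \<comment> \<open>Prescribing 0 at \<open>B K\<close> and \<open>D K\<close> keeps the interpolant
    exact on the longest-edge data used for \<open>c K\<close>.\<close>
  define R where "R = (\<lambda>K. (A K, \<delta> K)) ` ?L \<union> (\<lambda>K. (B K, 0)) ` ?L \<union> (\<lambda>K. (D K, 0)) ` ?L"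
  have M0: "0 \<le> 4 * \<Lambda>" using \<Lambda> by simp
  have AA: "\<bar>\<delta> K - \<delta> K'\<bar> \<le> 4 * \<Lambda> * dist (A K) (A K')" if K: "K \<in> ?L" "K' \<in> ?L" for K K'
  proof (cases "K = K'")
    case False
    have "\<bar>\<delta> K - \<delta> K'\<bar> \<le> 4 * \<Lambda> * (r K + r K')"
      using \<delta>[OF L\<T>[OF K(1)]] \<delta>[OF L\<T>[OF K(2)]] by (simp add: abs_le_iff distrib_left)
    also have "\<dots> \<le> 4 * \<Lambda> * dist (A K) (A K')" using sep[OF K False] M0 by (rule mult_left_mono)
    finally show ?thesis .
  qed simp
  have AB: "\<bar>\<delta> K\<bar> \<le> 4 * \<Lambda> * dist (A K) p" if K: "K \<in> ?L" "K' \<in> ?L" "p = B K' \<or> p = D K'" for K K' p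
  proof -
    have "r K \<le> dist (A K) p" using sep'[OF K(1,2)] K(3) by auto
    then have "4 * \<Lambda> * r K \<le> 4 * \<Lambda> * dist (A K) p" using M0 by (rule mult_left_mono)
    with \<delta>[OF L\<T>[OF K(1)]] show ?thesis by linarith
  qed
  \<comment> \<open>The correction is extended to the whole plane because the other triangles may
    have vertices both inside and outside the prescribed finite set; on all their edges it
    contributes slope at most 4\<Lambda>.\<close>
  obtain w where w: "\<And>x y. \<bar>w x - w y\<bar> \<le> 4 * \<Lambda> * dist x y" "\<And>p s. (p, s) \<in> R \<Longrightarrow> w p = s"
  proof (rule finite_Lipschitz_extension[of R "4 * \<Lambda>"])
    show "finite R" using finL by (simp add: R_def)
    show "s - t \<le> 4 * \<Lambda> * dist p q" if "(p, s) \<in> R" "(q, t) \<in> R" for p s q t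
    proof -
      have cases: "(\<exists>K\<in>?L. p = A K \<and> s = \<delta> K) \<or> s = 0 \<and> (\<exists>K\<in>?L. p = B K \<or> p = D K)"
        "(\<exists>K\<in>?L. q = A K \<and> t = \<delta> K) \<or> t = 0 \<and> (\<exists>K\<in>?L. q = B K \<or> q = D K)"
        using that by (auto simp: R_def)
      have "\<bar>s - t\<bar> \<le> 4 * \<Lambda> * dist p q"
        using cases
      proof (elim disjE)
        assume "\<exists>K\<in>?L. p = A K \<and> s = \<delta> K" "\<exists>K\<in>?L. q = A K \<and> t = \<delta> K"
        then show ?thesis using AA by blast
      next
        assume "\<exists>K\<in>?L. p = A K \<and> s = \<delta> K" "t = 0 \<and> (\<exists>K\<in>?L. q = B K \<or> q = D K)"
        then show ?thesis using AB by auto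
      next
        assume "s = 0 \<and> (\<exists>K\<in>?L. p = B K \<or> p = D K)" "\<exists>K\<in>?L. q = A K \<and> t = \<delta> K"
        then show ?thesis using AB[of _ _ p] by (auto simp: dist_commute)
      next
        assume "s = 0 \<and> (\<exists>K\<in>?L. p = B K \<or> p = D K)" "t = 0 \<and> (\<exists>K\<in>?L. q = B K \<or> q = D K)"
        then show ?thesis using M0 by simp
      qed
      then show ?thesis by linarith
    qed
  qed (use M0 in auto)
  obtain v a b where v: "continuous_on (closure \<Omega>) v"
    "\<And>K x. K \<in> \<T> \<Longrightarrow> x \<in> K \<Longrightarrow> v x = a K \<bullet> x + b K"
    "\<And>K p. K \<in> \<T> \<Longrightarrow> p \<in> vertices K \<Longrightarrow> v p = u p + w p"
    using nodal_interpolant[OF conf, of "\<lambda>p. u p + w p"] by blast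
  have diff: "a K \<bullet> (q - p) = (u q + w q) - (u p + w p)"
    if "K \<in> \<T>" "p \<in> vertices K" "q \<in> vertices K" for K p q
  proof -
    have "p \<in> K" "q \<in> K" using that by (auto simp: vertices_def extreme_point_of_def)
    then show ?thesis
      using v(2)[OF that(1), of p] v(2)[OF that(1), of q] v(3)[OF that(1,2)] v(3)[OF that(1,3)]
      by (simp add: inner_diff_right)
  qed
  have vs: "A K \<in> vertices K" "B K \<in> vertices K" "D K \<in> vertices K" if "K \<in> \<T>" for K
    using V[OF that] by blast+
  have bound: "norm (a K - G K) \<le> max 1 (10 / sqrt (angle_const \<alpha>)) * \<Lambda>" if K: "K \<in> \<T>" for K
  proof (cases "K \<in> ?L")
    case True
    have wv: "w (A K) = \<delta> K" "w (B K) = 0" "w (D K) = 0"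
      by (rule w(2); use True in \<open>simp add: R_def\<close>)+
    \<comment> \<open>With the corrected value at \<open>A K\<close>, the interpolated gradient
      agrees with the target along two independent edges, so the two are equal, however flat the
      triangle.\<close>
    have "(a K - c K) \<bullet> (A K - B K) = 0"
      using diff[OF K vs(2)[OF K] vs(1)[OF K]] by (simp add: wv inner_diff_left \<delta>_def)
    moreover have "(a K - c K) \<bullet> (D K - B K) = 0"
      using diff[OF K vs(2)[OF K] vs(3)[OF K]] cDB[OF K] by (simp add: wv inner_diff_left)
    moreover have "{B K, A K, D K} = {A K, B K, D K}" by blast
    then have "\<not> collinear {B K, A K, D K}" using vert(7)[OF K K] by simp
    ultimately have "a K - c K = 0" by (intro orthogonal_to_edges_eq_0)
    then have "norm (a K - G K) \<le> 1 * \<Lambda>" using cG[OF K] by simp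
    also have "\<dots> \<le> max 1 (10 / sqrt (angle_const \<alpha>)) * \<Lambda>" using \<Lambda> by (intro mult_right_mono) auto
    finally show ?thesis .
  next
    case False
    then have ang: "max_angle K \<le> \<alpha>" using K by (simp add: large_angle_part_def small_angle_part_def)
    note ac = sin_max_angle_ge[OF simp2[OF K] lab[OF K] ang \<alpha>]
    \<comment> \<open>\<Lambda> from the oscillation of \<open>u\<close> and 4\<Lambda> from the
      Lipschitz constant of the correction.\<close>
    have edge': "\<bar>(a K - G K) \<bullet> (q - p)\<bar> \<le> (5 * \<Lambda>) * norm (q - p)"
      if pq: "p \<in> vertices K" "q \<in> vertices K" for p q
    proof -
      have "p \<in> K" "q \<in> K" using pq by (auto simp: vertices_def extreme_point_of_def)
      from osc[OF K this] have 1: "\<bar>u q - u p - G K \<bullet> (q - p)\<bar> \<le> \<Lambda> * norm (q - p)" .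
      have 2: "\<bar>w q - w p\<bar> \<le> 4 * \<Lambda> * norm (q - p)" using w(1)[of q p] by (simp add: dist_norm)
      have "(a K - G K) \<bullet> (q - p) = (u q - u p - G K \<bullet> (q - p)) + (w q - w p)"
        using diff[OF K pq] by (simp add: inner_diff_left)
      with 1 2 show ?thesis by (simp add: abs_le_iff)
    qed
    have "(norm (a K - G K))\<^sup>2 * angle_const \<alpha> \<le> (norm (a K - G K))\<^sup>2 * (1 - (cos_at (A K) (B K) (D K))\<^sup>2)"
      using ac(2) by (rule mult_left_mono) simp
    also have "\<dots> \<le> 4 * (5 * \<Lambda>)\<^sup>2"
      using \<Lambda> by (intro gradient_bound edge' vs K vert(1)[OF K K] vert(2)[OF K K]) auto
    also have "\<dots> = (10 * \<Lambda>)\<^sup>2" by (simp add: power_mult_distrib)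
    finally have "(norm (a K - G K))\<^sup>2 * angle_const \<alpha> \<le> (10 * \<Lambda>)\<^sup>2" .
    then have "(norm (a K - G K) * sqrt (angle_const \<alpha>))\<^sup>2 \<le> (10 * \<Lambda>)\<^sup>2"
      using ac(1) by (simp add: power_mult_distrib)
    then have "norm (a K - G K) * sqrt (angle_const \<alpha>) \<le> 10 * \<Lambda>"
      by (rule power2_le_imp_le) (use \<Lambda> in simp)
    then have "norm (a K - G K) \<le> 10 / sqrt (angle_const \<alpha>) * \<Lambda>"
      using ac(1) by (simp add: field_simps)
    also have "\<dots> \<le> max 1 (10 / sqrt (angle_const \<alpha>)) * \<Lambda>" using \<Lambda> by (intro mult_right_mono) auto
    finally show ?thesis .
  qed
  show thesis using v(1,2) bound by (rule that)
qed

section \<open>Local estimates from bounded second derivatives\<close>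

abbreviation lebesgue_point :: "(real^2 \<Rightarrow> real) \<Rightarrow> real^2 \<Rightarrow> bool" where
  "lebesgue_point v x \<equiv>
    ((\<lambda>s. integral (cbox x (x + s *\<^sub>R One)) v / s ^ CARD(2)) \<longlongrightarrow> v x) (at_right 0)"

text \<open>\<open>weakly_Lipschitz\<close> is used twice. Applied to the gradient components with
  the bound \<open>M\<close> for their derivatives, it gives \<open>4 * M * h\<close> for the
  deviation from the value at \<open>x0\<close>; applied to \<open>u\<close> minus the linear
  function with gradient \<open>G\<close>, whose derivatives are thus bounded by
  \<open>4 * M * h\<close>, it gives \<open>16 * M * h\<close>. Only convexity and diameter of
  \<open>S\<close> enter.\<close>

lemma gradient_oscillation:
  fixes u :: "real^2 \<Rightarrow> real"
  assumes \<Omega>: "open \<Omega>"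
    and g: "\<And>i. weak_partial \<Omega> i u (g i)" and H: "\<And>i j. weak_partial \<Omega> j (g i) (H i j)"
    and M: "0 \<le> M" "negligible Z" "\<And>i j x. x \<in> \<Omega> - Z \<Longrightarrow> \<bar>H i j x\<bar> \<le> M"
    and S: "S \<subseteq> \<Omega>" "open S" "convex S" "S \<noteq> {}"
    and diam: "\<And>x y. x \<in> S \<Longrightarrow> y \<in> S \<Longrightarrow> norm (y - x) \<le> h" and h: "0 \<le> h"
    and N: "negligible N" "\<And>i x. x \<in> \<Omega> - N \<Longrightarrow> lebesgue_point (g i) x"
  shows "\<exists>G N'. negligible N' \<and> (\<forall>i. \<forall>x\<in>S - N. \<bar>g i x - G $ i\<bar> \<le> 4 * M * h) \<and>
    (\<forall>x\<in>S - N'. \<forall>y\<in>S - N'. \<bar>u y - u x - G \<bullet> (y - x)\<bar> \<le> 16 * M * h * norm (y - x))"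
proof -
  have "\<not> S \<subseteq> N" using open_not_negligible[OF S(2,4)] negligible_subset[OF N(1)] by blast
  then obtain x0 where x0: "x0 \<in> S" "x0 \<notin> N" by blast
  define G where "G = (\<chi> i. g i x0)"
  have MS: "\<bar>H i j x\<bar> \<le> M" if "x \<in> S - Z" for i j x using M(3) S(1) that by blast
  have osc: "\<bar>g i x - G $ i\<bar> \<le> 4 * M * h" if x: "x \<in> S - N" for i x
  proof -
    have "\<bar>g i x - g i x0\<bar> \<le> 4 * M * norm (x - x0)"
      by (rule weakly_Lipschitz[where G = "H i", OF H S(1-3) M(1,2) MS])
         (use x x0 S(1) N(2) in auto)
    also have "\<dots> \<le> 4 * M * h" using M(1) diam x x0 by (intro mult_left_mono) auto
    finally show ?thesis by (simp add: G_def)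
  qed
  define v where "v x = u x - G \<bullet> x" for x
  have v: "weak_partial \<Omega> i v (\<lambda>x. g i x - G $ i)" for i
    unfolding v_def by (rule weak_partial_diff[OF g weak_partial_linear[OF \<Omega>]])
  then have "locally_integrable \<Omega> v" by (simp add: weak_partial_def)
  then obtain N' where N': "negligible N'" "\<And>x. x \<in> \<Omega> - N' \<Longrightarrow> lebesgue_point v x"
    using lebesgue_differentiation[OF \<Omega>] by blast
  have "\<bar>u y - u x - G \<bullet> (y - x)\<bar> \<le> 16 * M * h * norm (y - x)" if x: "x \<in> S - N'" and y: "y \<in> S - N'" for x y
  proof -
    have "\<bar>v y - v x\<bar> \<le> 4 * (4 * M * h) * norm (y - x)"
      by (rule weakly_Lipschitz[where G = "\<lambda>i x. g i x - G $ i", OF v S(1-3) _ N(1) osc])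
         (use x y S(1) N'(2) M(1) h in auto)
    then show ?thesis by (simp add: v_def inner_diff_right algebra_simps)
  qed
  with N'(1) osc show ?thesis by blast
qed

text \<open>Every segment in \<open>\<Omega>\<close> has a convex open neighbourhood inside it, so
  bounded first derivatives give the Lipschitz bound along segments from which the limits
  exist.\<close>

lemma W_2_infty_trace:
  fixes u :: "real^2 \<Rightarrow> real"
  assumes \<Omega>: "open \<Omega>" "Lipschitz_boundary \<Omega>"
    and g: "\<And>i. weak_partial \<Omega> i u (g i)"
    and M: "0 \<le> M" "negligible Z" "\<And>i x. x \<in> \<Omega> - Z \<Longrightarrow> \<bar>g i x\<bar> \<le> M"
    and N: "negligible N" "\<And>x. x \<in> \<Omega> - N \<Longrightarrow> lebesgue_point u x"
  shows "\<exists>t. \<forall>p\<in>closure \<Omega>. \<forall>X. (\<forall>n. X n \<in> \<Omega> - N) \<longrightarrow> X \<longlonglongrightarrow> p \<longrightarrow> (\<lambda>n. u (X n)) \<longlonglongrightarrow> t p"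
proof -
  have seg: "\<bar>u y - u x\<bar> \<le> 4 * M * norm (y - x)"
    if xy: "x \<in> \<Omega> - N" "y \<in> \<Omega> - N" "closed_segment x y \<subseteq> \<Omega>" for x y
  proof -
    obtain S where S: "open S" "convex S" "S \<subseteq> \<Omega>" "x \<in> S" "y \<in> S"
      using convex_open_neighbourhood_of_segment[OF \<Omega>(1) xy(3)] by blast
    have MS: "\<bar>g i z\<bar> \<le> M" if "z \<in> S - Z" for i z using M(3) S(3) that by blast
    show ?thesis
      by (rule weakly_Lipschitz[where G = g, OF g S(3,1,2) M(1,2) MS S(4,5) N(2)[OF xy(1)] N(2)[OF xy(2)]])
  qed
  have "\<forall>p\<in>closure \<Omega>. \<exists>l. \<forall>X. (\<forall>n. X n \<in> \<Omega> - N) \<longrightarrow> X \<longlonglongrightarrow> p \<longrightarrow> (\<lambda>n. u (X n)) \<longlonglongrightarrow> l"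
    using trace_exists[OF \<Omega> _ N(1) _ seg] M(1) by simp
  from bchoice[OF this] show ?thesis .
qed

text \<open>Both points are approached from the interior of \<open>K\<close>, avoiding
  \<open>N\<close>, where the trace need not be a limit of \<open>u\<close>, and \<open>N'\<close>,
  where the oscillation bound may fail; the inequality survives the limit.\<close>

lemma trace_oscillation:
  fixes u :: "real^2 \<Rightarrow> real"
  assumes t: "\<forall>p\<in>closure \<Omega>. \<forall>X. (\<forall>n. X n \<in> \<Omega> - N) \<longrightarrow> X \<longlonglongrightarrow> p \<longrightarrow> (\<lambda>n. u (X n)) \<longlonglongrightarrow> t p"
    and K: "closed K" "convex K" "interior K \<noteq> {}" "interior K \<subseteq> \<Omega>"
    and N: "negligible N" "negligible N'"
    and osc: "\<And>x y. x \<in> interior K - N' \<Longrightarrow> y \<in> interior K - N' \<Longrightarrow>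
      \<bar>u y - u x - G \<bullet> (y - x)\<bar> \<le> \<Lambda> * norm (y - x)"
    and pq: "p \<in> K" "q \<in> K"
  shows "\<bar>t q - t p - G \<bullet> (q - p)\<bar> \<le> \<Lambda> * norm (q - p)"
proof -
  let ?T = "interior K - (N \<union> N')"
  have clK: "closure (interior K) = K"
    using convex_closure_interior[OF K(2,3)] K(1) by (simp add: closure_closed)
  have dense: "K \<subseteq> closure ?T"
    using closure_minimal[OF open_subset_closure_Diff_negligible[OF open_interior negligible_Un[OF N]] closed_closure, of K]
    by (simp only: clK)
  have K\<Omega>: "K \<subseteq> closure \<Omega>" using closure_mono[OF K(4)] by (simp only: clK)
  obtain X where X: "\<And>n. X n \<in> ?T" "X \<longlonglongrightarrow> p"
    using closure_sequential[of p ?T] dense pq(1) by blast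
  obtain Y where Y: "\<And>n. Y n \<in> ?T" "Y \<longlonglongrightarrow> q"
    using closure_sequential[of q ?T] dense pq(2) by blast
  have "X n \<in> \<Omega> - N" "Y n \<in> \<Omega> - N" for n using X(1)[of n] Y(1)[of n] K(4) by auto
  then have lim: "(\<lambda>n. u (X n)) \<longlonglongrightarrow> t p" "(\<lambda>n. u (Y n)) \<longlonglongrightarrow> t q"
    using t X(2) Y(2) pq K\<Omega> by blast+
  have le: "\<bar>u (Y n) - u (X n) - G \<bullet> (Y n - X n)\<bar> \<le> \<Lambda> * norm (Y n - X n)" for n
    using osc[of "X n" "Y n"] X(1)[of n] Y(1)[of n] by blast
  show ?thesis
  proof (rule LIMSEQ_le)
    show "(\<lambda>n. \<bar>u (Y n) - u (X n) - G \<bullet> (Y n - X n)\<bar>) \<longlonglongrightarrow> \<bar>t q - t p - G \<bullet> (q - p)\<bar>"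
      by (intro tendsto_intros lim X Y)
    show "(\<lambda>n. \<Lambda> * norm (Y n - X n)) \<longlonglongrightarrow> \<Lambda> * norm (q - p)"
      by (intro tendsto_intros X Y)
  qed (use le in blast)
qed

text \<open>The infimum is a lower bound of the attained values because seminorms are bounded below
  by 0.\<close>

lemma fe_approximation_le:
  assumes "fe_approximation \<Omega> \<T> u U" "v \<in> fe_space \<Omega> \<T>"
  shows "H1_seminorm \<Omega> (\<lambda>x. u x - U x) \<le> H1_seminorm \<Omega> (\<lambda>x. u x - v x)"
proof -
  have "bdd_below ((\<lambda>v. H1_seminorm \<Omega> (\<lambda>x. u x - v x)) ` fe_space \<Omega> \<T>)"
  proof (rule bdd_belowI2)
    show "0 \<le> H1_seminorm \<Omega> (\<lambda>x. u x - v x)" for v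
      unfolding H1_seminorm_def set_lebesgue_integral_def
      by (intro real_sqrt_ge_zero Bochner_Integration.integral_nonneg) simp
  qed
  from cINF_lower[OF this assms(2)] assms(1) show ?thesis
    by (simp add: fe_approximation_def)
qed

section \<open>Convergence\<close>

theorem theorem5:
  fixes \<Omega> :: "(real^2) set"
    and h\<^sub>0 \<alpha>\<^sub>0 C :: real
    and \<T> :: "real \<Rightarrow> (real^2) set set"
    and A B D :: "(real^2) set \<Rightarrow> real^2"
    and r :: "(real^2) set \<Rightarrow> real"
  assumes "polygonal_Lipschitz_domain \<Omega>"
    and "0 < h\<^sub>0"
    and "\<And>h. h \<in> {0<..<h\<^sub>0} \<Longrightarrow> conforming_triangulation \<Omega> (\<T> h)"
    and "\<And>h. h \<in> {0<..<h\<^sub>0} \<Longrightarrow> mesh_size (\<T> h) = h"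
    and "\<alpha>\<^sub>0 < pi"
    and "\<And>h K. h \<in> {0<..<h\<^sub>0} \<Longrightarrow> K \<in> \<T> h \<Longrightarrow> max_angle_labelling K (A K) (B K) (D K)"
    and "\<And>h K. h \<in> {0<..<h\<^sub>0} \<Longrightarrow> K \<in> \<T> h \<Longrightarrow>
           r K = 1/2 * min (dist (A K) (B K)) (dist (A K) (D K))"
    and "\<And>h. h \<in> {0<..<h\<^sub>0} \<Longrightarrow> (\<Sum>K\<in>large_angle_part \<alpha>\<^sub>0 (\<T> h). (diameter K)\<^sup>2) \<le> C"
    and "\<And>h K K'. h \<in> {0<..<h\<^sub>0} \<Longrightarrow>
           K \<in> large_angle_part \<alpha>\<^sub>0 (\<T> h) \<Longrightarrow> K' \<in> large_angle_part \<alpha>\<^sub>0 (\<T> h) \<Longrightarrow> K \<noteq> K' \<Longrightarrow>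
           dist (A K) (A K') \<ge> r K + r K'"
    and "\<And>h K K'. h \<in> {0<..<h\<^sub>0} \<Longrightarrow>
           K \<in> large_angle_part \<alpha>\<^sub>0 (\<T> h) \<Longrightarrow> K' \<in> large_angle_part \<alpha>\<^sub>0 (\<T> h) \<Longrightarrow>
           dist (A K) (B K') \<ge> r K \<and> dist (A K) (D K') \<ge> r K"
  shows "\<forall>u. W_2_infty \<Omega> u \<longrightarrow>
           (\<exists>C\<^sub>u. \<forall>h\<in>{0<..<h\<^sub>0}. \<forall>U. fe_approximation \<Omega> (\<T> h) u U \<longrightarrow>
              H1_seminorm \<Omega> (\<lambda>x. u x - U x) \<le> C\<^sub>u * h)"
proof (intro allI impI)
  fix u assume W: "W_2_infty \<Omega> u"
  have \<Omega>: "open \<Omega>" "bounded \<Omega>" "Lipschitz_boundary \<Omega>"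
    using assms(1) by (auto simp: polygonal_Lipschitz_domain_def)
  obtain g H where g: "\<And>i. weak_partial \<Omega> i u (g i)" and gL: "\<And>i. L_infty \<Omega> (g i)"
    and H: "\<And>i j. weak_partial \<Omega> j (g i) (H i j)" and HL: "\<And>i j. L_infty \<Omega> (H i j)"
  proof -
    from W obtain g H where gH: "\<forall>i. weak_partial \<Omega> i u (g i) \<and> L_infty \<Omega> (g i) \<and>
        (\<forall>j. weak_partial \<Omega> j (g i) (H i j) \<and> L_infty \<Omega> (H i j))"
      unfolding W_2_infty_def by (elim conjE exE) (rule that)
    show thesis by (rule that[of g H]) (simp_all add: gH)
  qed
  \<comment> \<open>An arbitrary finite index type serves both the gradient and, with pairs as
    indices, the second derivatives.\<close>
  have "\<exists>M\<ge>0. \<exists>Z. negligible Z \<and> (\<forall>i. \<forall>x\<in>\<Omega> - Z. \<bar>F i x\<bar> \<le> M)"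
    if F: "\<And>i. L_infty \<Omega> (F i)" for F :: "'i::finite \<Rightarrow> real^2 \<Rightarrow> real"
  proof -
    have "\<forall>i. \<exists>M. \<exists>Z. M \<ge> 0 \<and> negligible Z \<and> (\<forall>x\<in>\<Omega> - Z. \<bar>F i x\<bar> \<le> M)"
      using L_infty_bounded[OF \<Omega>(1) F] by blast
    then obtain M Z where MZ: "\<And>i. 0 \<le> M i" "\<And>i. negligible (Z i)" "\<And>i x. x \<in> \<Omega> - Z i \<Longrightarrow> \<bar>F i x\<bar> \<le> M i"
      by metis
    have "\<bar>F i x\<bar> \<le> sum M UNIV" if "x \<in> \<Omega> - (\<Union>i. Z i)" for i x
    proof -
      have "\<bar>F i x\<bar> \<le> M i" using MZ(3) that by blast
      also have "\<dots> \<le> sum M UNIV" using MZ(1) by (intro member_le_sum) auto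
      finally show ?thesis .
    qed
    moreover have "negligible (\<Union>i. Z i)" by (intro negligible_Union) (use MZ(2) in auto)
    moreover have "0 \<le> sum M UNIV" using MZ(1) by (intro sum_nonneg) auto
    ultimately show ?thesis by blast
  qed
  note uniform = this
  obtain M1 Z1 where M1: "0 \<le> M1" "negligible Z1" "\<And>i x. x \<in> \<Omega> - Z1 \<Longrightarrow> \<bar>g i x\<bar> \<le> M1"
    using uniform[of g, OF gL] by blast
  have "\<exists>M\<ge>0. \<exists>Z. negligible Z \<and> (\<forall>ij. \<forall>x\<in>\<Omega> - Z. \<bar>(\<lambda>(i, j). H i j) ij x\<bar> \<le> M)"
    by (rule uniform) (use HL in auto)
  then obtain M Z where MZ: "0 \<le> M" "negligible Z"
    "\<forall>ij. \<forall>x\<in>\<Omega> - Z. \<bar>(\<lambda>(i, j). H i j) ij x\<bar> \<le> M" by blast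
  have "\<bar>H i j x\<bar> \<le> M" if "x \<in> \<Omega> - Z" for i j x
    using MZ(3)[rule_format, OF that, of "(i, j)"] by simp
  note M = MZ(1,2) this
  have lp: "\<exists>N. negligible N \<and> (\<forall>x\<in>\<Omega> - N. lebesgue_point f x)" if "locally_integrable \<Omega> f" for f
    by (rule lebesgue_differentiation[OF \<Omega>(1) that]) blast
  have li: "locally_integrable \<Omega> u" "locally_integrable \<Omega> (g i)" for i
    using g[of undefined] g[of i] by (simp_all add: weak_partial_def)
  obtain N0 where N0: "negligible N0" "\<forall>x\<in>\<Omega> - N0. lebesgue_point u x"
    using lp[OF li(1)] by (elim exE conjE) (rule that)
  have "\<forall>i. \<exists>N. negligible N \<and> (\<forall>x\<in>\<Omega> - N. lebesgue_point (g i) x)"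
    by (intro allI lp li(2))
  from choice[OF this] obtain N1 where
    N1: "\<forall>i. negligible (N1 i) \<and> (\<forall>x\<in>\<Omega> - N1 i. lebesgue_point (g i) x)" ..
  have N01: "negligible N0" "\<And>x. x \<in> \<Omega> - N0 \<Longrightarrow> lebesgue_point u x"
    "\<And>i. negligible (N1 i)" "\<And>i x. x \<in> \<Omega> - N1 i \<Longrightarrow> lebesgue_point (g i) x"
    using N0 N1 by simp_all
  define N where "N = N0 \<union> (\<Union>i. N1 i)"
  have N: "negligible N" "\<And>x. x \<in> \<Omega> - N \<Longrightarrow> lebesgue_point u x"
    "\<And>i x. x \<in> \<Omega> - N \<Longrightarrow> lebesgue_point (g i) x"
  proof -
    show "negligible N" unfolding N_def by (intro negligible_Un N01 negligible_Union) (use N01(3) in auto)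
  qed (use N01(2,4) in \<open>auto simp: N_def\<close>)
  have "\<exists>t. \<forall>p\<in>closure \<Omega>. \<forall>X. (\<forall>n. X n \<in> \<Omega> - N) \<longrightarrow> X \<longlonglongrightarrow> p \<longrightarrow> (\<lambda>n. u (X n)) \<longlonglongrightarrow> t p"
    by (rule W_2_infty_trace[OF \<Omega>(1,3) g M1 N(1,2)])
  then obtain t where
    t: "\<forall>p\<in>closure \<Omega>. \<forall>X. (\<forall>n. X n \<in> \<Omega> - N) \<longrightarrow> X \<longlonglongrightarrow> p \<longrightarrow> (\<lambda>n. u (X n)) \<longlonglongrightarrow> t p" ..
  \<comment> \<open>Pointwise error: \<open>8 * M * h\<close> from freezing the gradient, two
    components of \<open>4 * M * h\<close> each, and \<open>c * (16 * M * h)\<close> between frozen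
    and interpolated gradient. The square root of the area turns this into a bound for the
    seminorm.\<close>
  define c where "c = max 1 (10 / sqrt (angle_const \<alpha>\<^sub>0))"
  define C\<^sub>u where "C\<^sub>u = (8 * M + c * (16 * M)) * sqrt (measure lebesgue \<Omega>)"
  have "H1_seminorm \<Omega> (\<lambda>x. u x - U x) \<le> C\<^sub>u * h"
    if h: "h \<in> {0<..<h\<^sub>0}" and U: "fe_approximation \<Omega> (\<T> h) u U" for h U
  proof -
    have h0: "0 < h" using h by simp
    have conf: "conforming_triangulation \<Omega> (\<T> h)" by (rule assms(3)[OF h])
    then have fin: "finite (\<T> h)" and cov: "\<Union>(\<T> h) = closure \<Omega>" and tri: "triangulation (\<T> h)"
      by (auto simp: conforming_triangulation_def triangulation_def)
    have K: "closed K" "convex K" "compact K" "interior K \<noteq> {}" "interior K \<subseteq> \<Omega>"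
      "\<And>x y. x \<in> K \<Longrightarrow> y \<in> K \<Longrightarrow> norm (y - x) \<le> h" if "K \<in> \<T> h" for K
    proof -
      have s: "2 simplex K" using conf that unfolding conforming_triangulation_def by blast
      show "closed K" "convex K" "compact K"
        using closed_simplex[OF s] convex_simplex[OF s] compact_simplex[OF s] .
      show "interior K \<noteq> {}" by (rule simplex_interior_nonempty[OF s])
      have "K \<subseteq> closure \<Omega>" using cov that by blast
      then show "interior K \<subseteq> \<Omega>"
        using interior_mono[of K "closure \<Omega>"] interior_closure_Lipschitz[OF \<Omega>(1,3)] by (meson order_trans)
      fix x y assume "x \<in> K" "y \<in> K"
      then have "norm (y - x) \<le> diameter K"
        using diameter_bounded_bound[OF compact_imp_bounded[OF compact_simplex[OF s]], of y x] by (simp add: dist_norm)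
      also have "\<dots> \<le> mesh_size (\<T> h)" unfolding mesh_size_def using fin that by (intro Max_ge) auto
      finally show "norm (y - x) \<le> h" using assms(4)[OF h] by simp
    qed
    have "\<exists>G. (\<forall>i. \<forall>x\<in>interior K - N. \<bar>g i x - G $ i\<bar> \<le> 4 * M * h) \<and>
        (\<forall>p\<in>K. \<forall>q\<in>K. \<bar>t q - t p - G \<bullet> (q - p)\<bar> \<le> 16 * M * h * norm (q - p))" if k: "K \<in> \<T> h" for K
    proof -
      have "norm (y - x) \<le> h" if "x \<in> interior K" "y \<in> interior K" for x y
        using K(6)[OF k] that interior_subset[of K] by blast
      note diam = this
      have "\<exists>G N'. negligible N' \<and> (\<forall>i. \<forall>x\<in>interior K - N. \<bar>g i x - G $ i\<bar> \<le> 4 * M * h) \<and>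
          (\<forall>x\<in>interior K - N'. \<forall>y\<in>interior K - N'. \<bar>u y - u x - G \<bullet> (y - x)\<bar> \<le> 16 * M * h * norm (y - x))"
        by (rule gradient_oscillation[OF \<Omega>(1) g H M K(5)[OF k] open_interior
            convex_interior[OF K(2)[OF k]] K(4)[OF k] diam less_imp_le[OF h0] N(1,3)])
      then obtain G N' where G: "negligible N'" "\<forall>i. \<forall>x\<in>interior K - N. \<bar>g i x - G $ i\<bar> \<le> 4 * M * h"
        "\<forall>x\<in>interior K - N'. \<forall>y\<in>interior K - N'. \<bar>u y - u x - G \<bullet> (y - x)\<bar> \<le> 16 * M * h * norm (y - x)"
        by blast
      have "\<bar>t q - t p - G \<bullet> (q - p)\<bar> \<le> 16 * M * h * norm (q - p)" if "p \<in> K" "q \<in> K" for p q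
        by (rule trace_oscillation[OF t K(1,2,4,5)[OF k] N(1) G(1) _ that]) (use G(3) in blast)+
      with G(2) show ?thesis by blast
    qed
    then obtain G where G1: "\<And>K i x. K \<in> \<T> h \<Longrightarrow> x \<in> interior K - N \<Longrightarrow> \<bar>g i x - G K $ i\<bar> \<le> 4 * M * h"
      and G2: "\<And>K p q. K \<in> \<T> h \<Longrightarrow> p \<in> K \<Longrightarrow> q \<in> K \<Longrightarrow>
        \<bar>t q - t p - G K \<bullet> (q - p)\<bar> \<le> 16 * M * h * norm (q - p)"
      by metis
    have \<Lambda>: "0 \<le> 16 * M * h" using M(1) h0 by simp
    \<comment> \<open>Nodal values are taken from the trace \<open>t\<close>: vertices may lie on
      the boundary or in the exceptional null set, where single values of \<open>u\<close> carry no
      information. The link back to \<open>u\<close> is \<open>G K\<close>, close to the gradient of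
      \<open>u\<close> by \<open>G1\<close> and to the increments of \<open>t\<close> by
      \<open>G2\<close>.\<close>
    obtain v a b where v: "continuous_on (closure \<Omega>) v"
      "\<And>K x. K \<in> \<T> h \<Longrightarrow> x \<in> K \<Longrightarrow> v x = a K \<bullet> x + b K"
      "\<And>K. K \<in> \<T> h \<Longrightarrow> norm (a K - G K) \<le> max 1 (10 / sqrt (angle_const \<alpha>\<^sub>0)) * (16 * M * h)"
      by (rule corrected_interpolant[OF conf assms(5) \<Lambda> assms(6)[OF h] assms(7)[OF h]
          assms(9)[OF h] assms(10)[OF h] G2]) (assumption+, rule that)
    have vfe: "v \<in> fe_space \<Omega> (\<T> h)" unfolding fe_space_def using v(1,2) by blast
    have weak: "weak_partial \<Omega> i (\<lambda>x. u x - v x) (\<lambda>x. ((\<chi> i. g i x) - pw_grad (\<T> h) a x) $ i)" for i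
      using weak_partial_diff[OF g weak_partial_fe[OF \<Omega>(1) conf v(1,2)]] by simp
    have "H1_seminorm \<Omega> (\<lambda>x. u x - v x) \<le> ((8 * M + c * (16 * M)) * h) * sqrt (measure lebesgue \<Omega>)"
    proof (rule H1_seminorm_le[OF \<Omega>(1,2) weak])
      show "negligible (N \<union> \<Union>(frontier ` \<T> h))"
        by (intro negligible_Un N(1) conforming_triangulation_cover(1)[OF conf])
      show "norm ((\<chi> i. g i x) - pw_grad (\<T> h) a x) \<le> (8 * M + c * (16 * M)) * h"
        if x: "x \<in> \<Omega> - (N \<union> \<Union>(frontier ` \<T> h))" for x
      proof -
        obtain K where k: "K \<in> \<T> h" "x \<in> interior K"
          using conforming_triangulation_cover(2)[OF conf, of x] x by blast
        have pw: "pw_grad (\<T> h) a x = a K" by (rule pw_grad_eq[OF tri k])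
        have "norm ((\<chi> i. g i x) - G K) \<le> (\<Sum>i\<in>UNIV. \<bar>((\<chi> i. g i x) - G K) $ i\<bar>)" by (rule norm_le_l1_cart)
        also have "\<dots> \<le> (\<Sum>i\<in>(UNIV::2 set). 4 * M * h)"
        proof (rule sum_mono)
          show "\<bar>((\<chi> i. g i x) - G K) $ i\<bar> \<le> 4 * M * h" for i
            using G1[OF k(1), of x i] k(2) x by simp
        qed
        finally have 1: "norm ((\<chi> i. g i x) - G K) \<le> 8 * M * h" by simp
        have "norm ((\<chi> i. g i x) - a K) \<le> norm ((\<chi> i. g i x) - G K) + norm (a K - G K)"
          using norm_triangle_ineq4[of "(\<chi> i. g i x) - G K" "a K - G K"] by simp
        also have "\<dots> \<le> (8 * M + c * (16 * M)) * h" using 1 v(3)[OF k(1), folded c_def] by (simp add: algebra_simps)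
        finally show ?thesis unfolding pw .
      qed
      have "0 \<le> c" by (simp add: c_def)
      then show "0 \<le> (8 * M + c * (16 * M)) * h" using M(1) h0 by simp
    qed
    also have "\<dots> = C\<^sub>u * h" by (simp add: C\<^sub>u_def)
    finally show ?thesis using fe_approximation_le[OF U vfe] by linarith
  qed
  then show "\<exists>C\<^sub>u. \<forall>h\<in>{0<..<h\<^sub>0}. \<forall>U. fe_approximation \<Omega> (\<T> h) u U \<longrightarrow>
      H1_seminorm \<Omega> (\<lambda>x. u x - U x) \<le> C\<^sub>u * h" by blast
qed

end
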